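(* Let $\Delta$ be a simplicial complex, let $S$ be the polynomial ring over a field whose variables are the vertices of $\Delta$, and let $I=\mathcal{F}(\Delta)\subset S$ be the facet ideal of $\Delta$. Suppose $\Delta$ contains a strongly disjoint set of bouquets $\mathcal{B}$. Let $\mathcal{B}=\mathcal{B}'\sqcup\mathcal{B}''$ be a partition of $\mathcal{B}$ into disjoint subsets $\mathcal{B}'$ and $\mathcal{B}''$, and let $$b'=|\mathrm{Facets}(\mathcal{B}')|,\quad b''=|\mathrm{Facets}(\mathcal{B}'')|,\quad b=b'+b''=|\mathrm{Facets}(\mathcal{B})|.$$ Then the monomials $$\mathbf{m}=\prod_{x\in V(\mathcal{B}')}x\quad\text{and}\quad \mathbf{m}'=\prod_{x\in V(\mathcal{B}'')}x$$ are lattice complements in $\mathrm{LCM}(I)$, and $$\beta_{b',\mathbf{m}}(S/I)\neq 0\quad\text{and}\quad\beta_{b'',\mathbf{m}'}(S/I)\neq 0.$$ In particular, $t_b\leq t_{b'}+t_{b''}$.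
   Context: Simplicial complexes are finite; $V(\Delta)$ is the vertex set of $\Delta$ (each $\{v\}$, $v\in V(\Delta)$, is a face) and $\mathrm{Facets}(\Delta)$ is the set of maximal faces (facets). $\langle F_1,\ldots,F_q\rangle$ denotes the simplicial complex with facets $F_1,\ldots,F_q$. A subcollection of $\Delta$ is a subcomplex whose facets are facets of $\Delta$. A facet $F$ of a complex $B$ has a free vertex $v$ in $B$ if $v\in F$ and $v$ lies in no other facet of $B$. The facet ideal $\mathcal{F}(\Delta)$ is generated by the monomials $\prod_{x\in F}x$ for $F\in\mathrm{Facets}(\Delta)$. Simplicial bouquet: a subcollection $B=\langle G_1,\ldots,G_t\rangle$ of $\Delta$ such that each facet $G_i$ has at least one free vertex in $B$ and $\mathrm{Root}(B):=\bigcap_{i=1}^t G_i\neq\emptyset$. The distance $\mathrm{dist}_\Delta(F,F')$ of distinct facets $F,F'$ of $\Delta$ is the minimum $\alpha$ for which there is a sequence of facets $F=F_0,F_1,\ldots,F_\alpha=F'$ of $\Delta$ with $F_{i-1}\cap F_i\neq\emptyset$ for all $i$ ($\infty$ if there is none). $F,F'$ are $3$-disjoint in $\Delta$ if $\mathrm{dist}_\Delta(F,F')\geq 3$; a set of facets is pairwise $3$-disjoint if every two distinct members are $3$-disjoint in $\Delta$. For a set $\mathcal{B}=\{B_1,\ldots,B_d\}$ of simplicial bouquets of $\Delta$, put $\mathrm{Facets}(\mathcal{B})=\bigcup_i\mathrm{Facets}(B_i)$ and $V(\mathcal{B})=\bigcup_i V(B_i)$. $\mathcal{B}$ is strongly disjoint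 in $\Delta$ if (1) $V(B_i)\cap V(B_j)=\emptyset$ for $i\neq j$, and (2) one can choose a facet $G_i$ from each $B_i$ so that $\{G_1,\ldots,G_d\}$ is pairwise $3$-disjoint in $\Delta$. $\Delta$ contains the strongly disjoint set of bouquets $\mathcal{B}=\{B_1,\ldots,B_d\}$ if $\mathcal{B}$ is a strongly disjoint set of bouquets of $\Delta$ such that (1) $V(\Delta)=V(\mathcal{B})$, and (2) whenever $F\in\mathrm{Facets}(\Delta)\setminus\mathrm{Facets}(\mathcal{B})$ and $F\cap G\neq\emptyset$ for some $G\in\mathrm{Facets}(B_i)$ and some $i\in\{1,\ldots,d\}$, then $G\setminus\mathrm{Root}(B_i)\subseteq F$. $\mathrm{LCM}(I)$ is the lattice, ordered by divisibility, of least common multiples of subsets of the minimal monomial generators of $I$ (with $\mathrm{lcm}(\emptyset)=1$). Two monomials $\mathbf{m},\mathbf{m}'\in\mathrm{LCM}(I)$ are lattice complements if $\mathrm{lcm}(\mathbf{m},\mathbf{m}')$ is the product of all variables of $S$ and $\gcd(\mathbf{m},\mathbf{m}')\notin I$. $\beta_{i,j}(S/I)$ and $\beta_{i,\mathbf{m}}(S/I)$ denote the graded and the multigraded Betti numbers of $S/I$ over $S$, and $t_i=\max\{j:\beta_{i,j}(S/I)\neq 0\}$. *)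

theory Defs
  imports
    "HOL-Library.Poly_Mapping"
    "HOL-Library.Extended_Nat"
    "HOL-Algebra.Ideal"
    "Jordan_Normal_Form.Matrix"
begin

section \<open>Simplicial complexes and bouquets\<close>

text \<open>A complex is the set of all its faces.\<close>

definition simplicial_complex :: "'v set set \<Rightarrow> bool" where
  "simplicial_complex \<Delta> \<longleftrightarrow>
     finite \<Delta> \<and> (\<forall>F\<in>\<Delta>. finite F) \<and> (\<forall>F\<in>\<Delta>. \<forall>G. G \<subseteq> F \<longrightarrow> G \<in> \<Delta>)"

definition vertices :: "'v set set \<Rightarrow> 'v set" where
  "vertices \<Delta> = {v. {v} \<in> \<Delta>}"

definition facets :: "'v set set \<Rightarrow> 'v set set" where
  "facets \<Delta> = {F \<in> \<Delta>. \<forall>G\<in>\<Delta>. F \<subseteq> G \<longrightarrow> G = F}"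

definition subcollection :: "'v set set \<Rightarrow> 'v set set \<Rightarrow> bool" where
  "subcollection \<Delta> B \<longleftrightarrow> simplicial_complex B \<and> B \<subseteq> \<Delta> \<and> facets B \<subseteq> facets \<Delta>"

definition free_vertex :: "'v set set \<Rightarrow> 'v set \<Rightarrow> 'v \<Rightarrow> bool" where
  "free_vertex B F v \<longleftrightarrow> v \<in> F \<and> (\<forall>G\<in>facets B. G \<noteq> F \<longrightarrow> v \<notin> G)"

definition Root :: "'v set set \<Rightarrow> 'v set" where
  "Root B = \<Inter>(facets B)"

text \<open>The void complex is excluded explicitly, since the intersection of no sets is the
  universe, so that its \<open>Root\<close> would count as nonempty.\<close>

definition bouquet :: "'v set set \<Rightarrow> 'v set set \<Rightarrow> bool" where
  "bouquet \<Delta> B \<longleftrightarrow>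
     subcollection \<Delta> B \<and> facets B \<noteq> {} \<and>
     (\<forall>G\<in>facets B. \<exists>v. free_vertex B G v) \<and> Root B \<noteq> {}"

definition facet_path :: "'v set set \<Rightarrow> 'v set \<Rightarrow> 'v set \<Rightarrow> nat \<Rightarrow> bool" where
  "facet_path \<Delta> F F' n \<longleftrightarrow>
     (\<exists>p. p 0 = F \<and> p n = F' \<and> (\<forall>i\<le>n. p i \<in> facets \<Delta>) \<and>
          (\<forall>i<n. p i \<inter> p (Suc i) \<noteq> {}))"

text \<open>The infimum of the empty set is \<open>\<infinity>\<close>.\<close>

definition facet_dist :: "'v set set \<Rightarrow> 'v set \<Rightarrow> 'v set \<Rightarrow> enat" where
  "facet_dist \<Delta> F F' = Inf {enat n | n. facet_path \<Delta> F F' n}"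

definition three_disjoint :: "'v set set \<Rightarrow> 'v set \<Rightarrow> 'v set \<Rightarrow> bool" where
  "three_disjoint \<Delta> F F' \<longleftrightarrow> facet_dist \<Delta> F F' \<ge> 3"

definition Facets_of :: "'v set set set \<Rightarrow> 'v set set" where
  "Facets_of \<B> = (\<Union>B\<in>\<B>. facets B)"

definition V_of :: "'v set set set \<Rightarrow> 'v set" where
  "V_of \<B> = (\<Union>B\<in>\<B>. vertices B)"

definition strongly_disjoint :: "'v set set \<Rightarrow> 'v set set set \<Rightarrow> bool" where
  "strongly_disjoint \<Delta> \<B> \<longleftrightarrow>
     (\<forall>B\<in>\<B>. bouquet \<Delta> B) \<and>
     (\<forall>B\<in>\<B>. \<forall>B'\<in>\<B>. B \<noteq> B' \<longrightarrow> vertices B \<inter> vertices B' = {}) \<and>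
     (\<exists>G. (\<forall>B\<in>\<B>. G B \<in> facets B) \<and> pairwise (three_disjoint \<Delta>) (G ` \<B>))"

definition contains_strongly_disjoint :: "'v set set \<Rightarrow> 'v set set set \<Rightarrow> bool" where
  "contains_strongly_disjoint \<Delta> \<B> \<longleftrightarrow>
     strongly_disjoint \<Delta> \<B> \<and> vertices \<Delta> = V_of \<B> \<and>
     (\<forall>F \<in> facets \<Delta> - Facets_of \<B>. \<forall>B\<in>\<B>. \<forall>G\<in>facets B.
        F \<inter> G \<noteq> {} \<longrightarrow> G - Root B \<subseteq> F)"

section \<open>Polynomials and the facet ideal\<close>

text \<open>A monomial is given by its exponent vector, and a polynomial is a finitely supported
  map from monomials to coefficients.\<close>

type_synonym 'v pp = "'v \<Rightarrow>\<^sub>0 nat"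
type_synonym ('v, 'k) mpoly = "('v \<Rightarrow>\<^sub>0 nat) \<Rightarrow>\<^sub>0 'k"

definition poly_ring :: "'v set \<Rightarrow> (('v, 'k::field) mpoly) ring" where
  "poly_ring V =
     \<lparr>carrier = {p. \<forall>t \<in> Poly_Mapping.keys p. Poly_Mapping.keys t \<subseteq> V},
      monoid.mult = (*), one = 1, zero = 0, add = (+)\<rparr>"

definition mon :: "'v pp \<Rightarrow> ('v, 'k::field) mpoly" where
  "mon t = Poly_Mapping.single t 1"

text \<open>The squarefree monomial \<open>\<Prod>\<^sub>x\<^sub>\<in>\<^sub>A x\<close>, as an exponent vector.\<close>

definition prod_vars :: "'v set \<Rightarrow> 'v pp" where
  "prod_vars A = (\<Sum>x\<in>A. Poly_Mapping.single x 1)"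

definition facet_ideal :: "'v set set \<Rightarrow> ('v, 'k::field) mpoly set" where
  "facet_ideal \<Delta> = genideal (poly_ring (vertices \<Delta>)) ((\<lambda>F. mon (prod_vars F)) ` facets \<Delta>)"

section \<open>The lcm lattice\<close>

text \<open>The least common multiple of a finite set of monomials, which is \<open>1\<close> (the zero exponent
  vector) for the empty set.\<close>

definition lcm_pp :: "'v pp set \<Rightarrow> 'v pp" where
  "lcm_pp A = (\<Sum>x \<in> (\<Union>t\<in>A. Poly_Mapping.keys t).
                 Poly_Mapping.single x (Max ((\<lambda>t. Poly_Mapping.lookup t x) ` A)))"

definition gcd_pp :: "'v pp \<Rightarrow> 'v pp \<Rightarrow> 'v pp" where
  "gcd_pp s t = (\<Sum>x \<in> Poly_Mapping.keys s \<inter> Poly_Mapping.keys t.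
      Poly_Mapping.single x (min (Poly_Mapping.lookup s x) (Poly_Mapping.lookup t x)))"

text \<open>A monomial ideal has exactly one inclusion-minimal set of monomial generators.\<close>

definition min_gens :: "'v set \<Rightarrow> ('v, 'k::field) mpoly set \<Rightarrow> 'v pp set" where
  "min_gens V I = (THE M. (\<forall>t\<in>M. Poly_Mapping.keys t \<subseteq> V) \<and>
      genideal (poly_ring V) (mon ` M) = I \<and>
      (\<forall>N. N \<subset> M \<longrightarrow> genideal (poly_ring V) (mon ` N) \<noteq> I))"

definition lcm_lattice :: "'v set \<Rightarrow> ('v, 'k::field) mpoly set \<Rightarrow> 'v pp set" where
  "lcm_lattice V I = {lcm_pp A | A. A \<subseteq> min_gens V I}"

definition lattice_complements ::
    "'v set \<Rightarrow> ('v, 'k::field) mpoly set \<Rightarrow> 'v pp \<Rightarrow> 'v pp \<Rightarrow> bool" where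
  "lattice_complements V I m m' \<longleftrightarrow>
     m \<in> lcm_lattice V I \<and> m' \<in> lcm_lattice V I \<and> lcm_pp {m, m'} = prod_vars V \<and> mon (gcd_pp m m') \<notin> I"

section \<open>Minimal graded free resolutions and Betti numbers\<close>

text \<open>The grading is given by an additive map \<open>w\<close> from monomials to degrees: the identity yields
  the multigrading, the total degree the standard grading.\<close>

definition homogeneous :: "('v pp \<Rightarrow> 'g) \<Rightarrow> 'g::comm_monoid_add \<Rightarrow> 'g \<Rightarrow>
    ('v, 'k::field) mpoly \<Rightarrow> bool" where
  "homogeneous w c d p \<longleftrightarrow> (\<forall>t \<in> Poly_Mapping.keys p. w t + c = d)"

definition free_mod :: "'v set \<Rightarrow> nat \<Rightarrow> ('v, 'k::field) mpoly vec set" where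
  "free_mod V n = {v \<in> carrier_vec n. \<forall>j<n. v $ j \<in> carrier (poly_ring V)}"

text \<open>A graded free resolution
  \<open>\<dots> \<rightarrow> F\<^sub>2 \<rightarrow> F\<^sub>1 \<rightarrow> F\<^sub>0 \<rightarrow> S/I \<rightarrow> 0\<close> over \<open>S = k[V]\<close> by free modules of finite rank.
  The list \<open>degs i\<close> consists of the degrees of the basis elements of \<open>F\<^sub>i\<close>, the matrix \<open>D i\<close>
  represents \<open>F\<^sub>i\<^sub>+\<^sub>1 \<rightarrow> F\<^sub>i\<close>, and the entries of \<open>\<epsilon>\<close> are homogeneous representatives in \<open>S\<close> of the
  images in \<open>S/I\<close> of the basis elements of \<open>F\<^sub>0\<close>; an element \<open>v\<close> of \<open>F\<^sub>0\<close> is thus sent to the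
  class of \<open>\<epsilon> \<bullet> v\<close>. The three final conditions are exactness at \<open>S/I\<close>, at \<open>F\<^sub>0\<close> and at
  \<open>F\<^sub>i\<^sub>+\<^sub>1\<close>. Degrees outside the monoid of degrees of monomials need not be considered, because
  no generator of a minimal resolution of \<open>S/I\<close> has such a degree.\<close>

definition graded_free_resolution ::
    "'v set \<Rightarrow> ('v pp \<Rightarrow> 'g::comm_monoid_add) \<Rightarrow> ('v, 'k::field) mpoly set \<Rightarrow>
     (nat \<Rightarrow> 'g list) \<Rightarrow> (nat \<Rightarrow> ('v, 'k) mpoly mat) \<Rightarrow> ('v, 'k) mpoly vec \<Rightarrow> bool" where
  "graded_free_resolution V w I degs D \<epsilon> \<longleftrightarrow>
     (let F = (\<lambda>i. free_mod V (length (degs i))) in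
       \<epsilon> \<in> F 0 \<and>
       (\<forall>j < length (degs 0). homogeneous w 0 (degs 0 ! j) (\<epsilon> $ j)) \<and>
       (\<forall>i. D i \<in> carrier_mat (length (degs i)) (length (degs (Suc i))) \<and>
          (\<forall>p < length (degs i). \<forall>q < length (degs (Suc i)).
             D i $$ (p, q) \<in> carrier (poly_ring V) \<and>
             homogeneous w (degs i ! p) (degs (Suc i) ! q) (D i $$ (p, q)))) \<and>
       (\<forall>s \<in> carrier (poly_ring V). \<exists>v \<in> F 0. s - \<epsilon> \<bullet> v \<in> I) \<and>
       (\<forall>v \<in> F 0. \<epsilon> \<bullet> v \<in> I \<longleftrightarrow> (\<exists>u \<in> F 1. v = D 0 *\<^sub>v u)) \<and>
       (\<forall>i. \<forall>v \<in> F (Suc i). D i *\<^sub>v v = 0\<^sub>v (length (degs i)) \<longleftrightarrow>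
          (\<exists>u \<in> F (Suc (Suc i)). v = D (Suc i) *\<^sub>v u)))"

text \<open>Minimality: the image of \<open>F\<^sub>i\<^sub>+\<^sub>1\<close> lies in \<open>\<mm>F\<^sub>i\<close>, where the ideal \<open>\<mm>\<close> generated by the
  variables consists of the polynomials with constant coefficient \<open>0\<close>.\<close>

definition minimal_graded_free_resolution ::
    "'v set \<Rightarrow> ('v pp \<Rightarrow> 'g::comm_monoid_add) \<Rightarrow> ('v, 'k::field) mpoly set \<Rightarrow>
     (nat \<Rightarrow> 'g list) \<Rightarrow> (nat \<Rightarrow> ('v, 'k) mpoly mat) \<Rightarrow> ('v, 'k) mpoly vec \<Rightarrow> bool" where
  "minimal_graded_free_resolution V w I degs D \<epsilon> \<longleftrightarrow>
     graded_free_resolution V w I degs D \<epsilon> \<and>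
     (\<forall>i. \<forall>p < length (degs i). \<forall>q < length (degs (Suc i)).
        Poly_Mapping.lookup (D i $$ (p, q)) 0 = 0)"

text \<open>The number of basis elements of degree \<open>d\<close> in the \<open>i\<close>-th module of a minimal graded free
  resolution of \<open>S/I\<close>, which does not depend on the resolution chosen.\<close>

definition graded_betti ::
    "'v set \<Rightarrow> ('v pp \<Rightarrow> 'g::comm_monoid_add) \<Rightarrow> ('v, 'k::field) mpoly set \<Rightarrow>
     nat \<Rightarrow> 'g \<Rightarrow> nat" where
  "graded_betti V w I i d =
     (SOME n. \<exists>degs D \<epsilon>. minimal_graded_free_resolution V w I degs D \<epsilon> \<and>
                n = count_list (degs i) d)"

definition total_deg :: "'v pp \<Rightarrow> nat" where
  "total_deg t = (\<Sum>x \<in> Poly_Mapping.keys t. Poly_Mapping.lookup t x)"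

abbreviation betti_multi ::
    "'v set \<Rightarrow> ('v, 'k::field) mpoly set \<Rightarrow> nat \<Rightarrow> 'v pp \<Rightarrow> nat" where
  "betti_multi V I i m \<equiv> graded_betti V (\<lambda>t. t) I i m"

abbreviation betti ::
    "'v set \<Rightarrow> ('v, 'k::field) mpoly set \<Rightarrow> nat \<Rightarrow> nat \<Rightarrow> nat" where
  "betti V I i j \<equiv> graded_betti V total_deg I i j"

definition t_max :: "'v set \<Rightarrow> ('v, 'k::field) mpoly set \<Rightarrow> nat \<Rightarrow> nat" where
  "t_max V I i = Max {j. betti V I i j \<noteq> 0}"

end

theory Submission
  imports Defs
begin

text \<open>Over \<open>S = k[V]\<close> let \<open>I\<close> be the facet ideal. The facets of a strongly disjoint set of bouquets \<open>\<B>'\<close>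
can be listed so that they form a well-ordered cover of \<open>A = V(\<B>')\<close>: no listed facet is contained in
the union of the others, because each has a free vertex; and every other facet \<open>H \<subseteq> A\<close> satisfies
\<open>F \<subseteq> H \<union> (union of the facets listed after F)\<close> for some listed \<open>F\<close>. The order that works lists the
pairwise 3-disjoint facets \<open>G\<^sub>B\<close> last. Such an
\<open>H\<close> belongs to no bouquet, since distinct bouquets are vertex-disjoint. If it meets some other facet \<open>F\<close> of a bouquet \<open>B\<close>, then \<open>H\<close> contains
\<open>F\<close> up to \<open>Root(B) \<subseteq> G\<^sub>B\<close>, and \<open>G\<^sub>B\<close> comes later. If \<open>H\<close> meets none of them, it is covered by the \<open>G\<^sub>B\<close>,
of which it can meet only one by 3-disjointness; then \<open>H \<subseteq> G\<^sub>B\<close>, so \<open>H = G\<^sub>B\<close> by maximality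
(\<open>ex_well_ordered_list\<close>).

A well-ordered cover by \<open>s\<close> facets with union \<open>A\<close> forces the Betti number in homological degree \<open>s\<close>
and multidegree \<open>x\<^sup>A\<close> to be nonzero. Put the facets of the cover first in a linear order of all
facets and form the Lyubeznik resolution. The cover is an admissible set \<open>\<sigma>\<close>. The first property says that
removing an element from \<open>\<sigma>\<close> lowers the degree, so the column of \<open>\<sigma>\<close> in the differential has no
constant entries. The second says that no admissible set \<open>\<sigma> \<union> {h}\<close> has the same degree as \<open>\<sigma>\<close>, so the row of
\<open>\<sigma>\<close> has no constant entries either. Such a basis element survives in every graded free resolution
(\<open>critical_degree\<close>): the comparison maps \<open>L \<rightarrow> F \<rightarrow> L\<close> compose to a map homotopic to the identity, and the
homotopy terms contribute nothing to the constant coefficient at position \<open>(\<sigma>, \<sigma>)\<close>. Hence a basis element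
of \<open>F\<close> has the degree of \<open>\<sigma>\<close>.

The same criterion shows that any two minimal graded free resolutions have the same degrees, so a Betti
number is nonzero exactly at the degrees of one minimal resolution fixed in advance
(\<open>graded_betti_nonzero_iff\<close>). One such resolution is built from scalar matrices between basis elements
whose degrees are squarefree (\<open>ex_minimal_exact_frame\<close>), and it serves the multigrading and the standard
grading alike. All its degrees divide the product of the variables, so \<open>t(b) \<le> |V|\<close>, while the nonvanishing
Betti numbers give \<open>|V| = |V(\<B>')| + |V(\<B>'')| \<le> t(b') + t(b'')\<close>.\<close>

section \<open>Monomial ideals\<close>

text \<open>Divisibility of monomials is the pointwise order of exponent vectors; the order \<open>\<le>\<close> on finitely
  supported maps is a linear order instead.\<close>

definition pp_dvd :: "'v pp \<Rightarrow> 'v pp \<Rightarrow> bool" where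
  "pp_dvd s t \<longleftrightarrow> (\<forall>x. Poly_Mapping.lookup s x \<le> Poly_Mapping.lookup t x)"

lemma pp_dvd_add: "pp_dvd s (s + t)"
  by (simp add: pp_dvd_def lookup_add)

lemma pp_dvd_eq: "pp_dvd s t \<Longrightarrow> s + (t - s) = t"
  by (rule poly_mapping_eqI) (simp add: pp_dvd_def lookup_add lookup_minus)

lemma pp_dvd_trans: "pp_dvd s t \<Longrightarrow> pp_dvd t u \<Longrightarrow> pp_dvd s u"
  by (auto simp: pp_dvd_def intro: order_trans)

lemma pp_dvd_antisym: "pp_dvd s t \<Longrightarrow> pp_dvd t s \<Longrightarrow> s = t"
  by (rule poly_mapping_eqI) (simp add: pp_dvd_def order_antisym)

lemma keys_add_pp: "Poly_Mapping.keys (s + t) = Poly_Mapping.keys s \<union> Poly_Mapping.keys (t :: 'v pp)"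
  by (auto simp: in_keys_iff lookup_add)

lemma keys_minus_pp: "Poly_Mapping.keys (s - t) \<subseteq> Poly_Mapping.keys (s :: 'v pp)"
  by (auto simp: in_keys_iff lookup_minus)

lemma add_eq_0_pp: "s + t = 0 \<longleftrightarrow> s = 0 \<and> t = (0 :: 'v pp)"
proof
  assume "s + t = 0"
  then have "Poly_Mapping.keys (s + t) = {}" by simp
  then show "s = 0 \<and> t = 0" by (simp add: keys_add_pp)
qed simp

lemma lookup_prod_vars:
  "finite A \<Longrightarrow> Poly_Mapping.lookup (prod_vars A) x = (if x \<in> A then 1 else 0)"
  by (simp add: prod_vars_def lookup_sum lookup_single when_def)

lemma keys_prod_vars: "finite A \<Longrightarrow> Poly_Mapping.keys (prod_vars A) = A"
  by (auto simp: in_keys_iff lookup_prod_vars split: if_splits)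

lemma prod_vars_eq_0: "finite A \<Longrightarrow> prod_vars A = 0 \<longleftrightarrow> A = {}"
  by (metis keys_eq_empty keys_prod_vars)

lemma prod_vars_dvd: "finite A \<Longrightarrow> pp_dvd (prod_vars A) u \<longleftrightarrow> A \<subseteq> Poly_Mapping.keys u"
  unfolding pp_dvd_def by (auto simp: lookup_prod_vars in_keys_iff Suc_le_eq)

lemma prod_vars_diff: "finite B \<Longrightarrow> A \<subseteq> B \<Longrightarrow> prod_vars A + prod_vars (B - A) = prod_vars B"
  by (rule poly_mapping_eqI) (auto simp: lookup_add lookup_prod_vars finite_subset)

lemma total_deg_prod_vars: "finite A \<Longrightarrow> total_deg (prod_vars A) = card A"
  by (simp add: total_deg_def keys_prod_vars lookup_prod_vars)

lemma total_deg_add: "total_deg (s + t) = total_deg s + total_deg t"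
proof -
  let ?K = "Poly_Mapping.keys s \<union> Poly_Mapping.keys t"
  have "total_deg u = (\<Sum>x\<in>?K. Poly_Mapping.lookup u x)" if "Poly_Mapping.keys u \<subseteq> ?K" for u :: "'a pp"
    unfolding total_deg_def using that
    by (intro sum.mono_neutral_left) (auto simp: in_keys_iff)
  then show ?thesis
    by (simp add: keys_add_pp lookup_add sum.distrib)
qed

lemma lookup_single_mult_add:
  fixes p :: "('v, 'k::field) mpoly"
  shows "Poly_Mapping.lookup (Poly_Mapping.single s c * p) (s + t) = c * Poly_Mapping.lookup p t"
proof -
  let ?X = "\<lambda>l. \<Sum>q::'v pp. Poly_Mapping.lookup p q when s + t = l + q"
  have "(\<lambda>l. Poly_Mapping.lookup (Poly_Mapping.single s c) l * ?X l) = (\<lambda>l. c * ?X s when l = s)"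
    by (rule ext) (simp add: lookup_single when_def)
  then have "Poly_Mapping.lookup (Poly_Mapping.single s c * p) (s + t) = (\<Sum>l::'v pp. c * ?X s when l = s)"
    unfolding lookup_mult by (rule arg_cong[where f = Sum_any])
  also have "\<dots> = c * ?X s"
    by (rule Sum_any_when_equal)
  also have "?X s = Poly_Mapping.lookup p t"
    by simp
  finally show ?thesis .
qed

lemma lookup_single_mult_not_dvd:
  fixes p :: "('v, 'k::field) mpoly"
  assumes "\<not> pp_dvd s t"
  shows "Poly_Mapping.lookup (Poly_Mapping.single s c * p) t = 0"
proof -
  have "Poly_Mapping.keys (Poly_Mapping.single s c * p) \<subseteq> {a + b | a b. a \<in> Poly_Mapping.keys (Poly_Mapping.single s c) \<and> b \<in> Poly_Mapping.keys p}"
    by (rule keys_mult)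
  then have "t \<notin> Poly_Mapping.keys (Poly_Mapping.single s c * p)"
    using assms pp_dvd_add by (fastforce split: if_splits)
  then show ?thesis by (simp add: in_keys_iff)
qed

text \<open>Taking the constant coefficient is multiplicative, because a product of two monomials is \<open>1\<close> only if both
  of them are. This reduces questions about a matrix modulo the variables to its matrix of constant
  coefficients.\<close>

lemma lookup_mult_0:
  fixes p q :: "('v, 'k::field) mpoly"
  shows "Poly_Mapping.lookup (p * q) 0 = Poly_Mapping.lookup p 0 * Poly_Mapping.lookup q 0"
proof -
  have "(\<Sum>b. Poly_Mapping.lookup q b when (0::'v pp) = a + b) = (Poly_Mapping.lookup q 0 when a = 0)" for a
  proof -
    have "(\<lambda>b. Poly_Mapping.lookup q b when (0::'v pp) = a + b)
        = (\<lambda>b. (Poly_Mapping.lookup q 0 when a = 0) when b = 0)"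
      by (rule ext) (use add_eq_0_pp in \<open>auto simp: when_def\<close>)
    then have "(\<Sum>b. Poly_Mapping.lookup q b when (0::'v pp) = a + b)
        = (\<Sum>b::'v pp. (Poly_Mapping.lookup q 0 when a = 0) when b = 0)"
      by (rule arg_cong[where f = Sum_any])
    then show ?thesis unfolding Sum_any_when_equal .
  qed
  then have "Poly_Mapping.lookup (p * q) 0 = (\<Sum>a::'v pp. (Poly_Mapping.lookup p 0 * Poly_Mapping.lookup q 0) when a = 0)"
    unfolding lookup_mult by (intro arg_cong[where f = Sum_any] ext) (simp add: when_def)
  then show ?thesis by simp
qed

lemma keys_diff_mpoly:
  fixes p q :: "('v, 'k::field) mpoly"
  shows "Poly_Mapping.keys (p - q) \<subseteq> Poly_Mapping.keys p \<union> Poly_Mapping.keys q"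
  by (auto simp: in_keys_iff lookup_minus)

lemma keys_mult_mpoly:
  fixes p q :: "('v, 'k::field) mpoly"
  assumes "t \<in> Poly_Mapping.keys (p * q)"
  obtains a c where "a \<in> Poly_Mapping.keys p" "c \<in> Poly_Mapping.keys q" "t = a + c"
proof -
  have "t \<in> {a + b |a b. a \<in> Poly_Mapping.keys p \<and> b \<in> Poly_Mapping.keys q}"
    using keys_mult assms by (rule subsetD)
  then show ?thesis using that by auto
qed

lemma poly_mapping_sum_singles:
  "(\<Sum>t\<in>Poly_Mapping.keys p. Poly_Mapping.single t (Poly_Mapping.lookup p t)) = p"
  by (rule poly_mapping_eqI) (auto simp: lookup_sum lookup_single when_def in_keys_iff)


lemma poly_ring_simps [simp]:
  "x \<otimes>\<^bsub>poly_ring V\<^esub> y = x * y" "\<one>\<^bsub>poly_ring V\<^esub> = 1" "\<zero>\<^bsub>poly_ring V\<^esub> = 0" "x \<oplus>\<^bsub>poly_ring V\<^esub> y = x + y"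
  by (simp_all add: poly_ring_def)

lemma poly_ring_carrier:
  "p \<in> carrier (poly_ring V) \<longleftrightarrow> (\<forall>t\<in>Poly_Mapping.keys p. Poly_Mapping.keys t \<subseteq> V)"
  by (simp add: poly_ring_def)

lemma poly_ring_closed [simp]:
  "0 \<in> carrier (poly_ring V)" "1 \<in> carrier (poly_ring V)"
  "p \<in> carrier (poly_ring V) \<Longrightarrow> q \<in> carrier (poly_ring V) \<Longrightarrow> p + q \<in> carrier (poly_ring V)"
  "p \<in> carrier (poly_ring V) \<Longrightarrow> q \<in> carrier (poly_ring V) \<Longrightarrow> p - q \<in> carrier (poly_ring V)"
  "p \<in> carrier (poly_ring V) \<Longrightarrow> - p \<in> carrier (poly_ring V)"
  "p \<in> carrier (poly_ring V) \<Longrightarrow> q \<in> carrier (poly_ring V) \<Longrightarrow> p * q \<in> carrier (poly_ring V)"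
proof -
  show "p + q \<in> carrier (poly_ring V)" if "p \<in> carrier (poly_ring V)" "q \<in> carrier (poly_ring V)"
    using that keys_add[of p q] by (auto simp: poly_ring_carrier)
  show "p - q \<in> carrier (poly_ring V)" if "p \<in> carrier (poly_ring V)" "q \<in> carrier (poly_ring V)"
    using that keys_diff_mpoly[of p q] by (auto simp: poly_ring_carrier)
  show "p * q \<in> carrier (poly_ring V)" if "p \<in> carrier (poly_ring V)" "q \<in> carrier (poly_ring V)"
    using that unfolding poly_ring_carrier by (auto simp: keys_add_pp elim!: keys_mult_mpoly dest!: bspec)
  show "- p \<in> carrier (poly_ring V)" if "p \<in> carrier (poly_ring V)"
  proof -
    have "Poly_Mapping.keys (- p) = Poly_Mapping.keys p" by (simp add: set_eq_iff in_keys_iff)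
    then show ?thesis using that by (simp add: poly_ring_carrier)
  qed
qed (simp_all add: poly_ring_carrier)

lemma poly_ring_sum [simp]:
  "(\<And>x. x \<in> A \<Longrightarrow> f x \<in> carrier (poly_ring V)) \<Longrightarrow> sum f A \<in> carrier (poly_ring V)"
  by (induction A rule: infinite_finite_induct) auto

lemma poly_ring_single [simp]:
  "Poly_Mapping.single t c \<in> carrier (poly_ring V) \<longleftrightarrow> c = 0 \<or> Poly_Mapping.keys t \<subseteq> V"
  by (simp add: poly_ring_carrier)

lemma cring_poly_ring: "cring (poly_ring V :: ('v, 'k::field) mpoly ring)"
proof (rule cringI)
  show "abelian_group (poly_ring V :: ('v, 'k) mpoly ring)"
  proof (rule abelian_groupI, goal_cases)
    case (6 x)
    then show ?case by (intro bexI[of _ "- x"]) simp_all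
  qed (simp_all add: algebra_simps)
  show "Group.comm_monoid (poly_ring V :: ('v, 'k) mpoly ring)"
    by (rule comm_monoidI) (simp_all add: algebra_simps)
qed (simp add: algebra_simps)

text \<open>Membership in a monomial ideal is tested monomial by monomial; \<open>genideal_mon\<close> identifies this set with the
  ideal generated by the monomials with exponents in \<open>M\<close>.\<close>

definition monomial_ideal :: "'v set \<Rightarrow> 'v pp set \<Rightarrow> ('v, 'k::field) mpoly set" where
  "monomial_ideal V M = {p \<in> carrier (poly_ring V). \<forall>t\<in>Poly_Mapping.keys p. \<exists>s\<in>M. pp_dvd s t}"

lemma monomial_ideal_closed:
  shows "0 \<in> monomial_ideal V M"
    and "p \<in> monomial_ideal V M \<Longrightarrow> q \<in> monomial_ideal V M \<Longrightarrow> p + q \<in> monomial_ideal V M"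
    and "p \<in> monomial_ideal V M \<Longrightarrow> q \<in> monomial_ideal V M \<Longrightarrow> p - q \<in> monomial_ideal V M"
    and "p \<in> monomial_ideal V M \<Longrightarrow> - p \<in> monomial_ideal V M"
    and "p \<in> carrier (poly_ring V) \<Longrightarrow> q \<in> monomial_ideal V M \<Longrightarrow> p * q \<in> monomial_ideal V M"
proof -
  show "p + q \<in> monomial_ideal V M" if "p \<in> monomial_ideal V M" "q \<in> monomial_ideal V M"
    using that keys_add[of p q] unfolding monomial_ideal_def by auto
  show "p - q \<in> monomial_ideal V M" if "p \<in> monomial_ideal V M" "q \<in> monomial_ideal V M"
  proof -
    show ?thesis using that keys_diff_mpoly[of p q] unfolding monomial_ideal_def by auto
  qed
  show "p * q \<in> monomial_ideal V M" if "p \<in> carrier (poly_ring V)" "q \<in> monomial_ideal V M"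
  proof -
    have "\<exists>s\<in>M. pp_dvd s t" if "t \<in> Poly_Mapping.keys (p * q)" for t
    proof -
      obtain a c where "t = a + c" "c \<in> Poly_Mapping.keys q"
        using \<open>t \<in> _\<close> by (rule keys_mult_mpoly)
      obtain s where "s \<in> M" "pp_dvd s c"
        using \<open>q \<in> _\<close> \<open>c \<in> _\<close> by (auto simp: monomial_ideal_def)
      then show ?thesis
        using pp_dvd_trans[OF _ pp_dvd_add[of c a]] \<open>t = _\<close> by (auto simp: add.commute)
    qed
    then show ?thesis using that unfolding monomial_ideal_def by auto
  qed
  show "0 \<in> monomial_ideal V M"
    by (simp add: monomial_ideal_def)
  show "- p \<in> monomial_ideal V M" if "p \<in> monomial_ideal V M"
  proof -
    have "Poly_Mapping.keys (- p) = Poly_Mapping.keys p" by (simp add: set_eq_iff in_keys_iff)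
    then show ?thesis using that by (simp add: monomial_ideal_def)
  qed
qed

lemma monomial_ideal_sum:
  "(\<And>x. x \<in> A \<Longrightarrow> f x \<in> monomial_ideal V M) \<Longrightarrow> sum f A \<in> (monomial_ideal V M :: ('v, 'k::field) mpoly set)"
  by (induction A rule: infinite_finite_induct) (simp_all add: monomial_ideal_closed)

lemma monomial_ideal_ideal: "ideal (monomial_ideal V M) (poly_ring V :: ('v, 'k::field) mpoly ring)"
proof -
  interpret cring "poly_ring V :: ('v, 'k) mpoly ring" by (rule cring_poly_ring)
  have neg: "\<ominus>\<^bsub>poly_ring V\<^esub> p = - p" if "p \<in> carrier (poly_ring V)" for p :: "('v, 'k) mpoly"
    using that by (intro minus_equality) simp_all
  show ?thesis
  proof (rule idealI)
    show "subgroup (monomial_ideal V M) (add_monoid (poly_ring V :: ('v, 'k) mpoly ring))"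
    proof (rule subgroup.intro)
      show "inv\<^bsub>add_monoid (poly_ring V)\<^esub> a \<in> monomial_ideal V M" if "a \<in> monomial_ideal V M" for a :: "('v, 'k) mpoly"
        using monomial_ideal_closed(4)[OF that] neg[of a] that by (simp add: monomial_ideal_def a_inv_def)
      show "monomial_ideal V M \<subseteq> carrier (add_monoid (poly_ring V :: ('v, 'k) mpoly ring))"
        by (auto simp: monomial_ideal_def)
    qed (simp_all add: monomial_ideal_closed(1,2))
    show "a \<otimes>\<^bsub>poly_ring V\<^esub> x \<in> monomial_ideal V M" if "a \<in> monomial_ideal V M" "x \<in> carrier (poly_ring V)"
      for a x :: "('v, 'k) mpoly"
      using monomial_ideal_closed(5)[OF that(2,1)] by (simp add: mult.commute)
  qed (simp_all add: monomial_ideal_closed(5) ring_axioms)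
qed

text \<open>The right-hand side is an ideal containing the generators. Conversely each of its elements is the sum
  of its terms, and every term is a multiple of a generator.\<close>

theorem genideal_mon:
  assumes M: "\<And>s. s \<in> M \<Longrightarrow> Poly_Mapping.keys s \<subseteq> V"
  shows "genideal (poly_ring V) (mon ` M) = (monomial_ideal V M :: ('v, 'k::field) mpoly set)"
proof
  have "mon ` M \<subseteq> (monomial_ideal V M :: ('v, 'k) mpoly set)"
    using M pp_dvd_add[of _ 0] by (fastforce simp: monomial_ideal_def mon_def)
  then show "genideal (poly_ring V) (mon ` M) \<subseteq> (monomial_ideal V M :: ('v, 'k) mpoly set)"
    using monomial_ideal_ideal unfolding genideal_def by blast
  show "monomial_ideal V M \<subseteq> (genideal (poly_ring V) (mon ` M) :: ('v, 'k) mpoly set)"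
  proof
    fix p :: "('v, 'k) mpoly" assume p: "p \<in> monomial_ideal V M"
    show "p \<in> genideal (poly_ring V) (mon ` M)"
      unfolding genideal_def
    proof safe
      fix J :: "('v, 'k) mpoly set"
      assume J: "ideal J (poly_ring V)" "mon ` M \<subseteq> J"
      interpret ideal J "poly_ring V" by fact
      have 1: "Poly_Mapping.single t (Poly_Mapping.lookup p t) \<in> J" if t: "t \<in> Poly_Mapping.keys p" for t
      proof -
        obtain s where s: "s \<in> M" "pp_dvd s t" using p t by (auto simp: monomial_ideal_def)
        have "Poly_Mapping.keys t \<subseteq> V" using p t by (auto simp: monomial_ideal_def poly_ring_carrier)
        then have "Poly_Mapping.single (t - s) (Poly_Mapping.lookup p t) \<in> carrier (poly_ring V)"
          using keys_minus_pp[of t s] by auto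
        moreover have "mon s \<in> J" using J s by blast
        ultimately have "Poly_Mapping.single (t - s) (Poly_Mapping.lookup p t) * mon s \<in> J"
          using I_l_closed[of "mon s"] unfolding poly_ring_simps by blast
        then show ?thesis by (simp add: mon_def mult_single add.commute pp_dvd_eq s)
      qed
      have "sum f A \<in> J" if "finite A" "\<And>t. t \<in> A \<Longrightarrow> f t \<in> J" for f :: "'v pp \<Rightarrow> ('v, 'k) mpoly" and A
        using that
      proof (induction A rule: finite_induct)
        case empty
        then show ?case
          using additive_subgroup.zero_closed[OF additive_subgroup_axioms] by simp
      next
        case (insert x F)
        then show ?case
          using additive_subgroup.a_closed[OF additive_subgroup_axioms, of "f x" "sum f F"] by simp
      qed
      then have "(\<Sum>t\<in>Poly_Mapping.keys p. Poly_Mapping.single t (Poly_Mapping.lookup p t)) \<in> J"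
        using 1 by simp
      then show "p \<in> J" by (simp add: poly_mapping_sum_singles)
    qed
  qed
qed

text \<open>Let \<open>N\<close> be another minimal generating set. Each \<open>s \<in> M\<close> is divisible by some \<open>t \<in> N\<close>, and \<open>t\<close> by some
  \<open>s' \<in> M\<close>; since \<open>M\<close> is an antichain, \<open>s = s' = t\<close>. Hence \<open>M \<subseteq> N\<close>, and minimality of \<open>N\<close> gives equality.\<close>

lemma min_gens_eqI:
  assumes M: "\<And>s. s \<in> M \<Longrightarrow> Poly_Mapping.keys s \<subseteq> V"
    and anti: "\<And>s t. s \<in> M \<Longrightarrow> t \<in> M \<Longrightarrow> pp_dvd s t \<Longrightarrow> s = t"
  shows "min_gens V (monomial_ideal V M :: ('v, 'k::field) mpoly set) = M"
proof -
  have mem: "mon t \<in> (monomial_ideal V N :: ('v, 'k) mpoly set) \<longleftrightarrow> (\<exists>s\<in>N. pp_dvd s t)"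
    if "Poly_Mapping.keys t \<subseteq> V" for t N
    using that by (simp add: monomial_ideal_def mon_def)
  have self: "pp_dvd s s" for s :: "'v pp" by (simp add: pp_dvd_def)
  have gen: "genideal (poly_ring V) (mon ` N) = (monomial_ideal V N :: ('v, 'k) mpoly set)"
    if "\<And>t. t \<in> N \<Longrightarrow> Poly_Mapping.keys t \<subseteq> V" for N
    using that by (rule genideal_mon)
  show ?thesis unfolding min_gens_def
  proof (rule the_equality, goal_cases)
    case 1
    have "(monomial_ideal V N :: ('v, 'k) mpoly set) \<noteq> monomial_ideal V M" if N: "N \<subset> M" for N
    proof
      assume eq: "(monomial_ideal V N :: ('v, 'k) mpoly set) = monomial_ideal V M"
      obtain t where t: "t \<in> M" "t \<notin> N" using N by blast
      then have "mon t \<in> (monomial_ideal V N :: ('v, 'k) mpoly set)"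
        unfolding eq using mem[OF M] self by blast
      then obtain s where "s \<in> N" "pp_dvd s t" using mem[OF M] t by blast
      then show False using anti[of s t] t N by blast
    qed
    moreover have "genideal (poly_ring V) (mon ` N) = (monomial_ideal V N :: ('v, 'k) mpoly set)" if "N \<subseteq> M" for N
      by (rule gen) (use M that in blast)
    ultimately show ?case using M by (metis order_refl psubset_imp_subset)
  next
    case (2 N)
    have kN: "\<And>t. t \<in> N \<Longrightarrow> Poly_Mapping.keys t \<subseteq> V" using 2 by blast
    have eq: "(monomial_ideal V N :: ('v, 'k) mpoly set) = monomial_ideal V M"
      using 2 gen[OF kN] by metis
    have "M \<subseteq> N"
    proof
      fix s assume s: "s \<in> M"
      have "mon s \<in> (monomial_ideal V N :: ('v, 'k) mpoly set)"
        unfolding eq using mem[OF M] self s by blast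
      then obtain t where t: "t \<in> N" "pp_dvd t s" using mem[OF M] s by blast
      have "mon t \<in> (monomial_ideal V M :: ('v, 'k) mpoly set)"
        unfolding eq[symmetric] using mem[OF kN] self t by blast
      then obtain s' where s': "s' \<in> M" "pp_dvd s' t" using mem[OF kN] t by blast
      have "s' = s" using anti s s' t pp_dvd_trans by blast
      then show "s \<in> N" using s' t pp_dvd_antisym by blast
    qed
    moreover have "\<not> M \<subset> N" using 2 gen[OF M] by metis
    ultimately show "N = M" by blast
  qed
qed

text \<open>All exponents involved are \<open>0\<close> or \<open>1\<close>, and the maximum is \<open>1\<close> exactly on the union of the supports.\<close>

lemma lcm_prod_vars:
  assumes "finite A" "\<And>F. F \<in> A \<Longrightarrow> finite F"
  shows "lcm_pp (prod_vars ` A) = prod_vars (\<Union>A)"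
proof -
  have keys: "(\<Union>t\<in>prod_vars ` A. Poly_Mapping.keys t) = \<Union>A"
    using assms by (simp add: keys_prod_vars)
  have fin: "finite (\<Union>A)" using assms by blast
  have max: "Max ((\<lambda>t. Poly_Mapping.lookup t x) ` prod_vars ` A) = 1" if x: "x \<in> \<Union>A" for x
  proof (rule Max_eqI)
    obtain F where F: "F \<in> A" "x \<in> F" using x by blast
    then show "1 \<in> (\<lambda>t. Poly_Mapping.lookup t x) ` prod_vars ` A"
      using assms(2)[OF F(1)] by (intro image_eqI[of _ _ "prod_vars F"]) (simp_all add: lookup_prod_vars)
    fix y assume "y \<in> (\<lambda>t. Poly_Mapping.lookup t x) ` prod_vars ` A"
    then show "y \<le> 1" using assms(2) by (auto simp: lookup_prod_vars)
  qed (use assms in simp)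
  show ?thesis
    unfolding lcm_pp_def keys prod_vars_def[of "\<Union>A"]
    by (rule sum.cong) (simp_all add: max)
qed

section \<open>Resolutions given by scalar matrices on squarefree degrees\<close>

definition index_of :: "'a list \<Rightarrow> 'a \<Rightarrow> nat" where
  "index_of l x = (LEAST j. l ! j = x)"

lemma index_of_nth: "distinct l \<Longrightarrow> j < length l \<Longrightarrow> index_of l (l ! j) = j"
  unfolding index_of_def
proof (rule Least_equality)
  fix y assume "distinct l" "j < length l" "l ! y = l ! j"
  then show "j \<le> y"
    using nth_eq_iff_index_eq[of l y j] by (cases "y < j") simp_all
qed simp

lemma index_of_less: "distinct l \<Longrightarrow> x \<in> set l \<Longrightarrow> index_of l x < length l \<and> l ! index_of l x = x"
  by (auto simp: in_set_conv_nth index_of_nth)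

lemma sum_set_nth: "distinct l \<Longrightarrow> (\<Sum>x\<in>set l. f x) = (\<Sum>j<length l. f (l ! j))"
  by (rule sum.reindex_bij_betw[symmetric]) (simp add: bij_betw_nth)

text \<open>In a multigraded resolution an entry of a differential between basis elements of degrees \<open>x\<^sup>A\<close> and \<open>x\<^sup>B\<close>
  is a scalar times the monomial \<open>x\<^sup>B / x\<^sup>A\<close>. A frame records only the scalars \<open>c i p q\<close> and the degrees
  \<open>dg i x\<close>, which are squarefree and hence given by sets of variables; \<open>xs i\<close> lists the basis of \<open>F\<^sub>i\<close>, and
  the single basis element \<open>x0\<close> of \<open>F\<^sub>0 = S\<close> has degree \<open>1\<close>. The ideal being resolved is generated
  by the squarefree monomials with supports in \<open>S\<close>.\<close>

locale squarefree_frame =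
  fixes V :: "'v set" and S :: "'v set set"
    and xs :: "nat \<Rightarrow> 'a list" and dg :: "nat \<Rightarrow> 'a \<Rightarrow> 'v set"
    and c :: "nat \<Rightarrow> 'a \<Rightarrow> 'a \<Rightarrow> 'k::field" and x0 :: 'a
  assumes finite_V: "finite V"
    and S_subset: "A \<in> S \<Longrightarrow> A \<subseteq> V"
    and distinct_xs: "distinct (xs i)"
    and dg_subset: "x \<in> set (xs i) \<Longrightarrow> dg i x \<subseteq> V"
    and xs_0: "xs 0 = [x0]" and dg_0: "dg 0 x0 = {}"
    and c_mono: "p \<in> set (xs i) \<Longrightarrow> q \<in> set (xs (Suc i)) \<Longrightarrow> c i p q \<noteq> 0 \<Longrightarrow> dg i p \<subseteq> dg (Suc i) q"
begin

definition differential :: "nat \<Rightarrow> ('a \<Rightarrow> 'k) \<Rightarrow> 'a \<Rightarrow> 'k" where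
  "differential i z p = (\<Sum>q\<in>set (xs (Suc i)). c i p q * z q)"

text \<open>The part of \<open>F\<^sub>i\<close> of a multidegree \<open>u\<close> has the basis elements of degree dividing \<open>u\<close> as a \<open>k\<close>-basis. As the
  degrees are squarefree, it depends only on the set \<open>W\<close> of variables that occur in \<open>u\<close>.\<close>

definition strand :: "nat \<Rightarrow> 'v set \<Rightarrow> ('a \<Rightarrow> 'k) \<Rightarrow> bool" where
  "strand i W z \<longleftrightarrow> (\<forall>x. z x \<noteq> 0 \<longrightarrow> x \<in> set (xs i) \<and> dg i x \<subseteq> W)"

text \<open>In homological degree \<open>0\<close> the kernel in question is that of \<open>S \<rightarrow> S/I\<close>: in multidegree \<open>u\<close> with support
  \<open>W\<close> it is everything if \<open>u\<close> is a multiple of a generator, and zero otherwise.\<close>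

definition cycle :: "nat \<Rightarrow> 'v set \<Rightarrow> ('a \<Rightarrow> 'k) \<Rightarrow> bool" where
  "cycle i W z \<longleftrightarrow> (case i of 0 \<Rightarrow> z x0 \<noteq> 0 \<longrightarrow> (\<exists>A\<in>S. A \<subseteq> W)
     | Suc i' \<Rightarrow> \<forall>p\<in>set (xs i'). differential i' z p = 0)"

definition frame_mat :: "nat \<Rightarrow> ('v, 'k) mpoly mat" where
  "frame_mat i = mat (length (xs i)) (length (xs (Suc i)))
     (\<lambda>(p, q). Poly_Mapping.single
        (prod_vars (dg (Suc i) (xs (Suc i) ! q) - dg i (xs i ! p)))
        (c i (xs i ! p) (xs (Suc i) ! q)))"

lemma frame_mat_mult_vec_carrier: "frame_mat i *\<^sub>v v \<in> carrier_vec (length (xs i))"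
  by (simp add: frame_mat_def carrier_vecI)

lemma frame_mat_0:
  assumes "p < length (xs i)" "q < length (xs (Suc i))"
  shows "Poly_Mapping.lookup (frame_mat i $$ (p, q)) 0 =
    (if dg i (xs i ! p) = dg (Suc i) (xs (Suc i) ! q) then c i (xs i ! p) (xs (Suc i) ! q) else 0)"
proof -
  have "finite (dg (Suc i) (xs (Suc i) ! q))"
    using dg_subset[of "xs (Suc i) ! q" "Suc i"] assms finite_V finite_subset by (metis nth_mem)
  then show ?thesis
    using assms c_mono[of "xs i ! p" i "xs (Suc i) ! q"]
    by (auto simp: frame_mat_def lookup_single when_def prod_vars_eq_0)
qed

text \<open>The coordinates of the component of \<open>v\<close> of multidegree \<open>u\<close> with respect to the \<open>k\<close>-basis described
  for \<open>strand\<close>.\<close>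

definition component :: "nat \<Rightarrow> 'v pp \<Rightarrow> ('v, 'k) mpoly vec \<Rightarrow> 'a \<Rightarrow> 'k" where
  "component i u v x = (if x \<in> set (xs i) \<and> dg i x \<subseteq> Poly_Mapping.keys u
     then Poly_Mapping.lookup (v $ index_of (xs i) x) (u - prod_vars (dg i x)) else 0)"

lemma finite_dg: "x \<in> set (xs i) \<Longrightarrow> finite (dg i x)"
  using dg_subset finite_V finite_subset by blast

lemma strand_component: "strand i (Poly_Mapping.keys u) (component i u v)"
  by (simp add: strand_def component_def)

lemma component_outside: "x \<notin> set (xs i) \<Longrightarrow> component i u v x = 0"
  by (simp add: component_def)

lemma component_nth:
  assumes "j < length (xs i)"
  shows "component i (t + prod_vars (dg i (xs i ! j))) v (xs i ! j) = Poly_Mapping.lookup (v $ j) t"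
proof -
  have "xs i ! j \<in> set (xs i)" using assms by simp
  then show ?thesis
    using assms finite_dg[of "xs i ! j" i]
    by (simp add: component_def index_of_nth distinct_xs keys_add_pp keys_prod_vars)
qed

lemma vec_eq_component:
  assumes "v \<in> carrier_vec (length (xs i))" "v' \<in> carrier_vec (length (xs i))"
    and "\<And>u x. x \<in> set (xs i) \<Longrightarrow> component i u v x = component i u v' x"
  shows "v = v'"
proof (rule eq_vecI)
  fix j assume j: "j < dim_vec v'"
  show "v $ j = v' $ j"
  proof (rule poly_mapping_eqI)
    fix t
    show "Poly_Mapping.lookup (v $ j) t = Poly_Mapping.lookup (v' $ j) t"
      using component_nth[of j i t v] component_nth[of j i t v'] assms j
      by (metis carrier_vecD nth_mem)
  qed
qed (use assms in auto)

lemma differential_outside: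
  assumes "p \<in> set (xs i)" "strand (Suc i) W z" "\<not> dg i p \<subseteq> W"
  shows "differential i z p = 0"
  unfolding differential_def
proof (rule sum.neutral, rule ballI)
  fix q assume "q \<in> set (xs (Suc i))"
  then show "c i p q * z q = 0"
    using assms c_mono[of p i q] unfolding strand_def by (metis mult_eq_0_iff order_trans)
qed

text \<open>Passing to components turns the polynomial matrix into the scalar one: \<open>x\<^sup>B / x\<^sup>A\<close> takes the coefficient of
  \<open>u / x\<^sup>B\<close> to that of \<open>u / x\<^sup>A\<close>. Basis elements whose degree does not divide \<open>u\<close> do not contribute.\<close>

lemma component_frame_mat:
  assumes v: "v \<in> carrier_vec (length (xs (Suc i)))" and p: "p \<in> set (xs i)"
  shows "component i u (frame_mat i *\<^sub>v v) p = differential i (component (Suc i) u v) p"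
proof (cases "dg i p \<subseteq> Poly_Mapping.keys u")
  case False
  then show ?thesis
    using differential_outside[OF p strand_component] by (simp add: component_def)
next
  case True
  let ?n = "length (xs (Suc i))" and ?j = "index_of (xs i) p"
  have j: "?j < length (xs i)" "xs i ! ?j = p" using index_of_less[OF distinct_xs p] by simp_all
  have entry: "Poly_Mapping.lookup (frame_mat i $$ (?j, q) * v $ q) (u - prod_vars (dg i p))
      = c i p (xs (Suc i) ! q) * component (Suc i) u v (xs (Suc i) ! q)" if q: "q < ?n" for q
  proof -
    let ?x = "xs (Suc i) ! q"
    have x: "?x \<in> set (xs (Suc i))" using q by simp
    have m: "frame_mat i $$ (?j, q) = Poly_Mapping.single (prod_vars (dg (Suc i) ?x - dg i p)) (c i p ?x)"
      using j q by (simp add: frame_mat_def)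
    show ?thesis
    proof (cases "c i p ?x = 0")
      case True
      then show ?thesis by (simp add: m)
    next
      case nz: False
      have sub: "dg i p \<subseteq> dg (Suc i) ?x" using c_mono[OF p x nz] .
      have fin: "finite (dg (Suc i) ?x)" using finite_dg[OF x] .
      show ?thesis
      proof (cases "dg (Suc i) ?x \<subseteq> Poly_Mapping.keys u")
        case dv: True
        have "u - prod_vars (dg i p) = prod_vars (dg (Suc i) ?x - dg i p) + (u - prod_vars (dg (Suc i) ?x))"
        proof (rule poly_mapping_eqI)
          fix y
          have "y \<in> dg (Suc i) ?x \<Longrightarrow> Poly_Mapping.lookup u y \<noteq> 0"
            using dv by (auto simp: in_keys_iff)
          then show "Poly_Mapping.lookup (u - prod_vars (dg i p)) y
            = Poly_Mapping.lookup (prod_vars (dg (Suc i) ?x - dg i p) + (u - prod_vars (dg (Suc i) ?x))) y"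
            using sub fin by (auto simp: lookup_add lookup_minus lookup_prod_vars finite_subset)
        qed
        moreover have "index_of (xs (Suc i)) ?x = q" using index_of_nth[OF distinct_xs q] .
        ultimately show ?thesis
          using x dv by (simp add: m component_def lookup_single_mult_add)
      next
        case ndv: False
        then have "\<not> dg (Suc i) ?x - dg i p \<subseteq> Poly_Mapping.keys (u - prod_vars (dg i p))"
          using True keys_minus_pp[of u "prod_vars (dg i p)"] by blast
        then have "\<not> pp_dvd (prod_vars (dg (Suc i) ?x - dg i p)) (u - prod_vars (dg i p))"
          using fin by (simp add: prod_vars_dvd)
        then show ?thesis
          using ndv by (simp add: m component_def lookup_single_mult_not_dvd)
      qed
    qed
  qed
  have "(frame_mat i *\<^sub>v v) $ ?j = (\<Sum>q<?n. frame_mat i $$ (?j, q) * v $ q)"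
    using j v by (simp add: frame_mat_def scalar_prod_def lessThan_atLeast0)
  then have "component i u (frame_mat i *\<^sub>v v) p
      = (\<Sum>q<?n. Poly_Mapping.lookup (frame_mat i $$ (?j, q) * v $ q) (u - prod_vars (dg i p)))"
    using True p by (simp add: component_def lookup_sum)
  also have "\<dots> = (\<Sum>q<?n. c i p (xs (Suc i) ! q) * component (Suc i) u v (xs (Suc i) ! q))"
    by (rule sum.cong) (simp_all add: entry)
  finally show ?thesis by (simp add: differential_def sum_set_nth distinct_xs)
qed

lemma component_0: "component i u (0\<^sub>v (length (xs i))) x = 0"
  using index_of_less[OF distinct_xs[of i], of x] by (auto simp: component_def)

lemma ex_vec_components:
  assumes fin: "finite U" and U: "\<And>u x. Y u x \<noteq> 0 \<Longrightarrow> u \<in> U"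
    and UV: "\<And>u. u \<in> U \<Longrightarrow> Poly_Mapping.keys u \<subseteq> V"
    and Y: "\<And>u. strand i (Poly_Mapping.keys u) (Y u)"
  shows "\<exists>v\<in>free_mod V (length (xs i)). \<forall>u. component i u v = Y u"
proof -
  define v where "v = vec (length (xs i)) (\<lambda>j. Abs_poly_mapping (\<lambda>t. Y (t + prod_vars (dg i (xs i ! j))) (xs i ! j)))"
  have fin': "finite {t. Y (t + a) x \<noteq> 0}" for a x
  proof -
    have "{t. Y (t + a) x \<noteq> 0} \<subseteq> (\<lambda>u. u - a) ` U"
    proof
      fix t assume "t \<in> {t. Y (t + a) x \<noteq> 0}"
      then have "t + a \<in> U" using U[of "t + a" x] by simp
      then show "t \<in> (\<lambda>u. u - a) ` U" by (intro image_eqI[of _ _ "t + a"]) simp_all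
    qed
    then show ?thesis by (rule finite_surj[OF fin])
  qed
  have lv: "Poly_Mapping.lookup (v $ j) t = Y (t + prod_vars (dg i (xs i ! j))) (xs i ! j)"
    if "j < length (xs i)" for j t
    using that fin' by (simp add: v_def)
  have "v \<in> free_mod V (length (xs i))"
    unfolding free_mod_def poly_ring_carrier
  proof safe
    fix j t y assume j: "j < length (xs i)" and "t \<in> Poly_Mapping.keys (v $ j)" "y \<in> Poly_Mapping.keys t"
    then have "Y (t + prod_vars (dg i (xs i ! j))) (xs i ! j) \<noteq> 0"
      using lv[OF j, of t] by (simp add: in_keys_iff)
    then have "t + prod_vars (dg i (xs i ! j)) \<in> U" by (rule U)
    then have "Poly_Mapping.keys (t + prod_vars (dg i (xs i ! j))) \<subseteq> V" by (rule UV)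
    then show "y \<in> V" using \<open>y \<in> _\<close> by (auto simp: keys_add_pp)
  qed (simp add: v_def)
  moreover have "component i u v x = Y u x" for u x
  proof (cases "x \<in> set (xs i) \<and> dg i x \<subseteq> Poly_Mapping.keys u")
    case True
    then have "(u - prod_vars (dg i x)) + prod_vars (dg i x) = u"
      using pp_dvd_eq[of "prod_vars (dg i x)" u] prod_vars_dvd[OF finite_dg[of x i], of u] by (simp add: add.commute)
    moreover have "index_of (xs i) x < length (xs i)" "xs i ! index_of (xs i) x = x"
      using True index_of_less[OF distinct_xs[of i], of x] by auto
    ultimately show ?thesis
      using True lv[of "index_of (xs i) x" "u - prod_vars (dg i x)"] by (simp add: component_def)
  next
    case False
    then show ?thesis using Y[of u] by (auto simp: component_def strand_def)
  qed
  ultimately show ?thesis by (intro bexI[of _ v] allI ext)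
qed

lemma component_support:
  assumes "v \<in> free_mod V (length (xs i))"
  shows "\<exists>U. finite U \<and> (\<forall>u x. component i u v x \<noteq> 0 \<longrightarrow> u \<in> U) \<and> (\<forall>u\<in>U. Poly_Mapping.keys u \<subseteq> V)"
proof -
  define U where "U = (\<Union>j\<in>{..<length (xs i)}. (\<lambda>t. t + prod_vars (dg i (xs i ! j))) ` Poly_Mapping.keys (v $ j))"
  have "u \<in> U" if nz: "component i u v x \<noteq> 0" for u x
  proof -
    from nz have x: "x \<in> set (xs i)" "dg i x \<subseteq> Poly_Mapping.keys u"
      and k: "u - prod_vars (dg i x) \<in> Poly_Mapping.keys (v $ index_of (xs i) x)"
      by (auto simp: component_def in_keys_iff split: if_splits)
    have "(u - prod_vars (dg i x)) + prod_vars (dg i x) = u"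
      using pp_dvd_eq[of "prod_vars (dg i x)" u] prod_vars_dvd[OF finite_dg[of x i], of u] x by (simp add: add.commute)
    then show ?thesis
      unfolding U_def using index_of_less[OF distinct_xs x(1)]
      by (intro UN_I[of "index_of (xs i) x"] image_eqI[OF _ k]) simp_all
  qed
  moreover have "Poly_Mapping.keys u \<subseteq> V" if u: "u \<in> U" for u
  proof -
    obtain j t where "j < length (xs i)" "t \<in> Poly_Mapping.keys (v $ j)" "u = t + prod_vars (dg i (xs i ! j))"
      using u unfolding U_def by blast
    then show ?thesis
      using assms dg_subset[of "xs i ! j" i] finite_dg[of "xs i ! j" i]
      by (auto simp: keys_add_pp keys_prod_vars free_mod_def poly_ring_carrier)
  qed
  moreover have "finite U" by (simp add: U_def)
  ultimately show ?thesis by (intro exI[of _ U]) simp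
qed

end

text \<open>Exactness is required for scalars only, one finite-dimensional strand at a time. It includes that consecutive
  differentials compose to zero.\<close>

locale exact_frame = squarefree_frame V S xs dg c x0
  for V :: "'v set" and S and xs :: "nat \<Rightarrow> 'a list" and dg
    and c :: "nat \<Rightarrow> 'a \<Rightarrow> 'a \<Rightarrow> 'k::field" and x0 +
  assumes exact: "W \<subseteq> V \<Longrightarrow> strand i W z \<Longrightarrow>
    cycle i W z \<longleftrightarrow> (\<exists>y. strand (Suc i) W y \<and> (\<forall>p\<in>set (xs i). z p = differential i y p))"
begin

text \<open>A preimage is found component by component. Only finitely many components of a vector are nonzero, and
  choosing \<open>0\<close> as the preimage of \<open>0\<close> makes the result a vector of polynomials again.\<close>

lemma frame_mat_exact:
  assumes v: "v \<in> free_mod V (length (xs i))"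
  shows "(\<forall>u. cycle i (Poly_Mapping.keys u) (component i u v)) \<longleftrightarrow>
    (\<exists>y\<in>free_mod V (length (xs (Suc i))). v = frame_mat i *\<^sub>v y)"
proof
  assume cyc: "\<forall>u. cycle i (Poly_Mapping.keys u) (component i u v)"
  obtain U where U: "finite U" "\<And>u x. component i u v x \<noteq> 0 \<Longrightarrow> u \<in> U"
    "\<And>u. u \<in> U \<Longrightarrow> Poly_Mapping.keys u \<subseteq> V"
    using component_support[OF v] by blast
  have "\<exists>y. strand (Suc i) (Poly_Mapping.keys u) y \<and> (\<forall>p\<in>set (xs i). component i u v p = differential i y p)
      \<and> (u \<notin> U \<longrightarrow> y = (\<lambda>_. 0))" for u
  proof (cases "u \<in> U")
    case True
    then show ?thesis
      using exact[OF U(3) strand_component] cyc by blast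
  next
    case False
    then have "component i u v p = 0" for p using U(2) by blast
    then show ?thesis by (intro exI[of _ "\<lambda>_. 0"]) (simp add: strand_def differential_def)
  qed
  then obtain Y where Y: "\<And>u. strand (Suc i) (Poly_Mapping.keys u) (Y u)"
      "\<And>u p. p \<in> set (xs i) \<Longrightarrow> component i u v p = differential i (Y u) p"
      "\<And>u. u \<notin> U \<Longrightarrow> Y u = (\<lambda>_. 0)"
    using choice[of "\<lambda>u y. strand (Suc i) (Poly_Mapping.keys u) y
      \<and> (\<forall>p\<in>set (xs i). component i u v p = differential i y p) \<and> (u \<notin> U \<longrightarrow> y = (\<lambda>_. 0))"] by blast
  have YU: "u \<in> U" if "Y u x \<noteq> 0" for u x
    using that Y(3)[of u] by (cases "u \<in> U") simp_all
  have "\<exists>y\<in>free_mod V (length (xs (Suc i))). \<forall>u. component (Suc i) u y = Y u"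
    by (rule ex_vec_components[of U]) (fact U(1) YU U(3) Y(1))+
  then obtain y where y: "y \<in> free_mod V (length (xs (Suc i)))" "\<And>u. component (Suc i) u y = Y u"
    by blast
  have "v = frame_mat i *\<^sub>v y"
    by (rule vec_eq_component[of _ i])
      (use v y Y(2) in \<open>auto simp: free_mod_def component_frame_mat frame_mat_mult_vec_carrier\<close>)
  then show "\<exists>y\<in>free_mod V (length (xs (Suc i))). v = frame_mat i *\<^sub>v y" using y by blast
next
  assume "\<exists>y\<in>free_mod V (length (xs (Suc i))). v = frame_mat i *\<^sub>v y"
  then obtain y where y: "y \<in> free_mod V (length (xs (Suc i)))" and v': "v = frame_mat i *\<^sub>v y" by blast
  obtain U where U: "finite U" "\<And>u x. component (Suc i) u y x \<noteq> 0 \<Longrightarrow> u \<in> U"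
    "\<And>u. u \<in> U \<Longrightarrow> Poly_Mapping.keys u \<subseteq> V"
    using component_support[OF y] by blast
  have st: "\<forall>p\<in>set (xs i). component i u v p = differential i (component (Suc i) u y) p" for u
    using component_frame_mat[of y i] y by (auto simp: v' free_mod_def)
  show "\<forall>u. cycle i (Poly_Mapping.keys u) (component i u v)"
  proof
    fix u
    show "cycle i (Poly_Mapping.keys u) (component i u v)"
    proof (cases "u \<in> U")
      case True
      then show ?thesis using exact[OF U(3) strand_component] st strand_component by blast
    next
      case False
      then have "component (Suc i) u y x = 0" for x using U(2) by blast
      then have "component i u v p = 0" for p
        using st[of u] component_outside[of p i u v] by (cases "p \<in> set (xs i)") (simp_all add: differential_def)
      then show ?thesis by (auto simp: cycle_def differential_def split: nat.split)
    qed
  qed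
qed

lemma cycle_Suc_iff:
  assumes "v \<in> carrier_vec (length (xs (Suc i)))"
  shows "frame_mat i *\<^sub>v v = 0\<^sub>v (length (xs i)) \<longleftrightarrow>
    (\<forall>u. cycle (Suc i) (Poly_Mapping.keys u) (component (Suc i) u v))"
proof
  assume "frame_mat i *\<^sub>v v = 0\<^sub>v (length (xs i))"
  then show "\<forall>u. cycle (Suc i) (Poly_Mapping.keys u) (component (Suc i) u v)"
    using component_frame_mat[OF assms] component_0 by (simp add: cycle_def)
next
  assume "\<forall>u. cycle (Suc i) (Poly_Mapping.keys u) (component (Suc i) u v)"
  then show "frame_mat i *\<^sub>v v = 0\<^sub>v (length (xs i))"
    by (intro vec_eq_component[of _ i])
      (auto simp: component_frame_mat[OF assms] component_0 cycle_def frame_mat_mult_vec_carrier assms)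
qed

text \<open>Entries \<open>x\<^sup>B / x\<^sup>A\<close> are homogeneous for every additive degree map \<open>w\<close>, so the same matrices resolve \<open>S/I\<close>
  for the multigrading and for the standard grading.\<close>

theorem graded_free_resolution:
  assumes add: "\<And>s t. w (s + t) = w s + (w t :: 'g::comm_monoid_add)"
  shows "graded_free_resolution V w (monomial_ideal V (prod_vars ` S))
    (\<lambda>i. map (\<lambda>x. w (prod_vars (dg i x))) (xs i)) frame_mat (vec 1 (\<lambda>_. 1))"
proof -
  have pv0: "prod_vars (dg 0 x0) = 0" by (simp add: dg_0 prod_vars_eq_0)
  have len: "length (xs 0) = 1" by (simp add: xs_0)
  have eps: "vec 1 (\<lambda>_. 1) \<bullet> v = v $ 0" if "v \<in> free_mod V (length (xs 0))" for v :: "('v, 'k) mpoly vec"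
    using that len by (auto simp: free_mod_def scalar_prod_def)
  have dvd: "pp_dvd (prod_vars A) t \<longleftrightarrow> A \<subseteq> Poly_Mapping.keys t" if "A \<in> S" for A t
    using that S_subset finite_V finite_subset prod_vars_dvd by metis
  have comp0: "component 0 u v x0 = Poly_Mapping.lookup (v $ 0) u" for u v
    using component_nth[of 0 0 u v] len pv0 by (simp add: xs_0)
  have cyc0: "vec 1 (\<lambda>_. 1) \<bullet> v \<in> monomial_ideal V (prod_vars ` S) \<longleftrightarrow>
      (\<forall>u. cycle 0 (Poly_Mapping.keys u) (component 0 u v))" if v: "v \<in> free_mod V (length (xs 0))" for v
    unfolding eps[OF v] using v len dvd
    by (auto simp: monomial_ideal_def cycle_def comp0 free_mod_def in_keys_iff)
  have entry: "frame_mat i $$ (p, q) \<in> carrier (poly_ring V) \<and>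
      homogeneous w (w (prod_vars (dg i (xs i ! p)))) (w (prod_vars (dg (Suc i) (xs (Suc i) ! q)))) (frame_mat i $$ (p, q))"
    if pq: "p < length (xs i)" "q < length (xs (Suc i))" for i p q
  proof (cases "c i (xs i ! p) (xs (Suc i) ! q) = 0")
    case True
    then show ?thesis using pq by (simp add: frame_mat_def homogeneous_def)
  next
    case False
    let ?A = "dg i (xs i ! p)" and ?B = "dg (Suc i) (xs (Suc i) ! q)"
    have sub: "?A \<subseteq> ?B" using c_mono False pq by simp
    have B: "?B \<subseteq> V" using dg_subset pq by simp
    have fin: "finite ?B" using B finite_V finite_subset by blast
    have "w (prod_vars (?B - ?A)) + w (prod_vars ?A) = w (prod_vars ?B)"
      using add[of "prod_vars ?A" "prod_vars (?B - ?A)"] prod_vars_diff[OF fin sub] by (simp add: add.commute)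
    then show ?thesis
      using pq False fin B by (auto simp: frame_mat_def homogeneous_def keys_prod_vars)
  qed
  have onto: "\<exists>v\<in>free_mod V (length (xs 0)). s - vec 1 (\<lambda>_. 1) \<bullet> v \<in> monomial_ideal V (prod_vars ` S)"
    if "s \<in> carrier (poly_ring V)" for s :: "('v, 'k) mpoly"
  proof
    show v: "vec 1 (\<lambda>_. s) \<in> free_mod V (length (xs 0))"
      using that len by (simp add: free_mod_def)
    show "s - vec 1 (\<lambda>_. 1) \<bullet> vec 1 (\<lambda>_. s) \<in> monomial_ideal V (prod_vars ` S)"
      unfolding eps[OF v] by (simp add: monomial_ideal_closed(1))
  qed
  have free: "free_mod V n \<subseteq> carrier_vec n" for n by (auto simp: free_mod_def)
  show ?thesis
    unfolding graded_free_resolution_def Let_def length_map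
  proof (intro conjI ballI allI impI, goal_cases)
    case 1
    then show ?case by (simp add: len free_mod_def)
  next
    case (2 j)
    then show ?case by (simp add: len xs_0 homogeneous_def pv0)
  next
    case (3 i)
    then show ?case by (simp add: frame_mat_def)
  next
    case (4 i p q)
    then show ?case using entry by simp
  next
    case (5 i p q)
    then show ?case using entry[of p i q] by (metis nth_map)
  next
    case (6 s)
    then show ?case by (rule onto)
  next
    case (7 v)
    then show ?case using cyc0 frame_mat_exact by simp
  next
    case (8 i v)
    then show ?case using cycle_Suc_iff[of v i] frame_mat_exact free by blast
  qed
qed

theorem minimal_graded_free_resolution:
  assumes add: "\<And>s t. w (s + t) = w s + (w t :: 'g::comm_monoid_add)"
    and min: "\<And>i p q. p \<in> set (xs i) \<Longrightarrow> q \<in> set (xs (Suc i)) \<Longrightarrow> c i p q \<noteq> 0 \<Longrightarrow> dg i p \<noteq> dg (Suc i) q"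
  shows "minimal_graded_free_resolution V w (monomial_ideal V (prod_vars ` S))
    (\<lambda>i. map (\<lambda>x. w (prod_vars (dg i x))) (xs i)) frame_mat (vec 1 (\<lambda>_. 1))"
  unfolding minimal_graded_free_resolution_def
proof (intro conjI allI impI)
  fix i p q
  assume pq: "p < length (map (\<lambda>x. w (prod_vars (dg i x))) (xs i))"
    "q < length (map (\<lambda>x. w (prod_vars (dg (Suc i) x))) (xs (Suc i)))"
  show "Poly_Mapping.lookup (frame_mat i $$ (p, q)) 0 = 0"
    using frame_mat_0[of p i q] pq min[of "xs i ! p" i "xs (Suc i) ! q"] by auto
qed (rule graded_free_resolution[OF add])

end

section \<open>Comparison of graded resolutions\<close>

text \<open>The degree map \<open>w\<close> covers both the multigrading and the standard grading. The set \<open>M\<close> generates the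
  ideal \<open>I\<close>; being monomial, \<open>I\<close> is homogeneous for \<open>w\<close>.\<close>

locale grading =
  fixes V :: "'v set" and M :: "'v pp set" and w :: "'v pp \<Rightarrow> 'g::comm_monoid_add"
  assumes w_add: "w (s + t) = w s + w t" and w_0: "w 0 = 0"
begin

text \<open>The homogeneous component of degree \<open>d\<close> of a coefficient in front of a basis element of degree \<open>a\<close>.\<close>

definition degree_part :: "'g \<Rightarrow> 'g \<Rightarrow> ('v, 'k::field) mpoly \<Rightarrow> ('v, 'k) mpoly" where
  "degree_part a d p = Abs_poly_mapping (\<lambda>t. Poly_Mapping.lookup p t when w t + a = d)"

lemma lookup_degree_part: "Poly_Mapping.lookup (degree_part a d p) t = (Poly_Mapping.lookup p t when w t + a = d)"
proof -
  have "{t. (Poly_Mapping.lookup p t when w t + a = d) \<noteq> 0} \<subseteq> Poly_Mapping.keys p"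
    by (auto simp: in_keys_iff)
  then have "finite {t. (Poly_Mapping.lookup p t when w t + a = d) \<noteq> 0}"
    using finite_subset finite_keys by blast
  then show ?thesis by (simp add: degree_part_def)
qed

lemma keys_degree_part: "Poly_Mapping.keys (degree_part a d p) \<subseteq> Poly_Mapping.keys p"
  by (auto simp: in_keys_iff lookup_degree_part)

lemma homogeneous_part: "homogeneous w a d (degree_part a d p)"
  by (auto simp: homogeneous_def in_keys_iff lookup_degree_part)

lemma degree_part_homogeneous: "homogeneous w a d p \<Longrightarrow> degree_part a d p = p"
  by (rule poly_mapping_eqI) (auto simp: homogeneous_def in_keys_iff lookup_degree_part when_def)

lemma degree_part_carrier: "p \<in> carrier (poly_ring V) \<Longrightarrow> degree_part a d p \<in> carrier (poly_ring V)"
  using keys_degree_part[of a d p] by (auto simp: poly_ring_carrier)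

lemma degree_part_ideal: "p \<in> monomial_ideal V M \<Longrightarrow> degree_part a d p \<in> monomial_ideal V M"
  using keys_degree_part[of a d p] degree_part_carrier[of p a d] by (auto simp: monomial_ideal_def)

lemma degree_part_sum: "degree_part a d (sum f A) = (\<Sum>x\<in>A. degree_part a d (f x))"
  by (rule poly_mapping_eqI) (simp add: lookup_degree_part lookup_sum when_def)

lemma degree_part_diff: "degree_part a d (p - q) = degree_part a d p - degree_part a d q"
  by (rule poly_mapping_eqI) (simp add: lookup_degree_part lookup_minus when_def)

lemma degree_part_single_mult:
  assumes "w s + a = b"
  shows "degree_part a d (Poly_Mapping.single s k * p) = Poly_Mapping.single s k * degree_part b d p"
proof (rule poly_mapping_eqI)
  fix t
  show "Poly_Mapping.lookup (degree_part a d (Poly_Mapping.single s k * p)) t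
    = Poly_Mapping.lookup (Poly_Mapping.single s k * degree_part b d p) t"
  proof (cases "pp_dvd s t")
    case True
    define r where "r = t - s"
    have t: "t = s + r" using pp_dvd_eq[OF True] by (simp add: r_def)
    have "w (s + r) + a = w r + b" using assms[symmetric] by (simp add: w_add ac_simps)
    then show ?thesis by (simp add: t lookup_degree_part lookup_single_mult_add when_def)
  next
    case False
    then show ?thesis by (simp add: lookup_degree_part lookup_single_mult_not_dvd)
  qed
qed

text \<open>A term of \<open>p\<close> sends the terms of \<open>q\<close> of degree \<open>d\<close> over \<open>b\<close>, and no others, to terms of degree \<open>d\<close> over \<open>a\<close>.\<close>

lemma degree_part_mult:
  assumes "homogeneous w a b p"
  shows "degree_part a d (p * q) = p * degree_part b d q"
proof -
  let ?s = "\<lambda>t. Poly_Mapping.single t (Poly_Mapping.lookup p t)"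
  have "degree_part a d ((\<Sum>t\<in>Poly_Mapping.keys p. ?s t) * q) = (\<Sum>t\<in>Poly_Mapping.keys p. ?s t) * degree_part b d q"
    unfolding sum_distrib_right degree_part_sum
    by (rule sum.cong) (use assms in \<open>auto simp: homogeneous_def intro!: degree_part_single_mult\<close>)
  then show ?thesis by (simp only: poly_mapping_sum_singles)
qed

lemma homogeneous_mult:
  assumes "homogeneous w a b p" "homogeneous w b d q"
  shows "homogeneous w a d (p * q)"
  using degree_part_mult[OF assms(1), of d q] degree_part_homogeneous[OF assms(2)] homogeneous_part[of a d "p * q"] by simp

lemma homogeneous_sum: "(\<And>x. x \<in> A \<Longrightarrow> homogeneous w a b (f x)) \<Longrightarrow> homogeneous w a b (sum f A)"
  using homogeneous_part[of a b "sum f A"] by (simp add: degree_part_sum degree_part_homogeneous)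

lemma homogeneous_diff: "homogeneous w a b p \<Longrightarrow> homogeneous w a b q \<Longrightarrow> homogeneous w a b (p - q)"
  using homogeneous_part[of a b "p - q"] by (simp add: degree_part_diff degree_part_homogeneous)

text \<open>Matrices of degree-preserving maps between graded free modules with basis degrees \<open>es\<close> and \<open>ds\<close>.\<close>

definition graded_mat :: "'g list \<Rightarrow> 'g list \<Rightarrow> ('v, 'k::field) mpoly mat \<Rightarrow> bool" where
  "graded_mat ds es A \<longleftrightarrow> A \<in> carrier_mat (length ds) (length es) \<and>
     (\<forall>p<length ds. \<forall>q<length es. A $$ (p, q) \<in> carrier (poly_ring V) \<and> homogeneous w (ds ! p) (es ! q) (A $$ (p, q)))"

lemma graded_mat_carrier: "graded_mat ds es A \<Longrightarrow> A \<in> carrier_mat (length ds) (length es)"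
  by (simp add: graded_mat_def)

lemma graded_mat_mult:
  assumes A: "graded_mat ds es A" and B: "graded_mat es fs B"
  shows "graded_mat ds fs (A * B)"
  unfolding graded_mat_def
proof (intro conjI allI impI)
  show "A * B \<in> carrier_mat (length ds) (length fs)"
    using graded_mat_carrier[OF A] graded_mat_carrier[OF B] by (rule mult_carrier_mat)
  fix p r assume pr: "p < length ds" "r < length fs"
  have e: "(A * B) $$ (p, r) = (\<Sum>q = 0..<length es. A $$ (p, q) * B $$ (q, r))"
    using pr A B by (auto simp: graded_mat_def scalar_prod_def intro!: sum.cong)
  show "(A * B) $$ (p, r) \<in> carrier (poly_ring V)"
    unfolding e using pr A B by (intro poly_ring_sum poly_ring_closed) (auto simp: graded_mat_def)
  show "homogeneous w (ds ! p) (fs ! r) ((A * B) $$ (p, r))"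
    unfolding e
  proof (rule homogeneous_sum)
    fix q assume "q \<in> {0..<length es}"
    then show "homogeneous w (ds ! p) (fs ! r) (A $$ (p, q) * B $$ (q, r))"
      using pr A B homogeneous_mult[of "ds ! p" "es ! q" "A $$ (p, q)" "fs ! r" "B $$ (q, r)"]
      by (simp add: graded_mat_def)
  qed
qed

lemma graded_mat_diff: "graded_mat ds es A \<Longrightarrow> graded_mat ds es B \<Longrightarrow> graded_mat ds es (A - B)"
  by (auto simp: graded_mat_def homogeneous_diff)

lemma graded_mat_one: "graded_mat ds ds (1\<^sub>m (length ds))"
  by (auto simp: graded_mat_def homogeneous_def w_0)

lemma graded_mat_mult_vec:
  assumes "graded_mat ds es A" "v \<in> free_mod V (length es)"
  shows "A *\<^sub>v v \<in> free_mod V (length ds)"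
  using assms unfolding graded_mat_def free_mod_def
  by (auto simp: scalar_prod_def intro!: poly_ring_sum poly_ring_closed)

lemma graded_mat_col:
  assumes "graded_mat ds es A" "q < length es"
  shows "col A q \<in> free_mod V (length ds)"
  using assms by (auto simp: graded_mat_def free_mod_def)

end

locale graded_resolution = grading V M w
  for V :: "'v set" and M :: "'v pp set" and w :: "'v pp \<Rightarrow> 'g::comm_monoid_add" +
  fixes degs :: "nat \<Rightarrow> 'g list" and D :: "nat \<Rightarrow> ('v, 'k::field) mpoly mat" and \<epsilon> :: "('v, 'k) mpoly vec"
  assumes res: "graded_free_resolution V w (monomial_ideal V M) degs D \<epsilon>"
begin

text \<open>This treats the kernel of \<open>F\<^sub>0 \<rightarrow> S/I\<close> and the kernels of the differentials uniformly, so that exactness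
  reads the same in every homological degree (\<open>is_cycle_iff\<close>).\<close>

definition is_cycle :: "nat \<Rightarrow> ('v, 'k) mpoly vec \<Rightarrow> bool" where
  "is_cycle i v \<longleftrightarrow> (case i of 0 \<Rightarrow> \<epsilon> \<bullet> v \<in> monomial_ideal V M
     | Suc i' \<Rightarrow> D i' *\<^sub>v v = 0\<^sub>v (length (degs i')))"

lemma eps: "\<epsilon> \<in> free_mod V (length (degs 0))" "j < length (degs 0) \<Longrightarrow> homogeneous w 0 (degs 0 ! j) (\<epsilon> $ j)"
  using res by (simp_all add: graded_free_resolution_def Let_def)

lemma graded_mat_D: "graded_mat (degs i) (degs (Suc i)) (D i)"
  using res by (simp add: graded_free_resolution_def Let_def graded_mat_def)

lemma onto: "s \<in> carrier (poly_ring V) \<Longrightarrow> \<exists>v\<in>free_mod V (length (degs 0)). s - \<epsilon> \<bullet> v \<in> monomial_ideal V M"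
  using res by (simp add: graded_free_resolution_def Let_def)

lemma is_cycle_iff: "v \<in> free_mod V (length (degs i)) \<Longrightarrow>
    is_cycle i v \<longleftrightarrow> (\<exists>u\<in>free_mod V (length (degs (Suc i))). v = D i *\<^sub>v u)"
  using res by (cases i) (simp_all add: graded_free_resolution_def Let_def is_cycle_def)

lemma is_cycle_col_D:
  assumes "q < length (degs (Suc i))"
  shows "is_cycle i (col (D i) q)"
proof -
  let ?u = "unit_vec (length (degs (Suc i))) q :: ('v, 'k) mpoly vec"
  have "?u \<in> free_mod V (length (degs (Suc i)))"
    by (simp add: free_mod_def unit_vec_def)
  moreover have "col (D i) q = D i *\<^sub>v ?u"
    using graded_mat_D[of i] assms by (intro eq_vecI) (auto simp: graded_mat_def)
  ultimately show ?thesis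
    using is_cycle_iff[OF graded_mat_col[OF graded_mat_D assms]] by blast
qed

text \<open>Each column has a preimage by exactness; replacing its entries by their components of the right degree
  keeps it a preimage, because the column itself is homogeneous.\<close>

lemma lift_through_differential:
  assumes X: "graded_mat (degs i) es X" and is_cycle: "\<And>q. q < length es \<Longrightarrow> is_cycle i (col X q)"
  shows "\<exists>Y. graded_mat (degs (Suc i)) es Y \<and> X = D i * Y"
proof -
  let ?m = "length (degs i)" and ?n = "length (degs (Suc i))"
  have "\<forall>q. \<exists>u. q < length es \<longrightarrow> u \<in> free_mod V ?n \<and> col X q = D i *\<^sub>v u"
    using is_cycle is_cycle_iff[OF graded_mat_col[OF X]] by blast
  from choice[OF this] obtain u where u: "\<And>q. q < length es \<Longrightarrow> u q \<in> free_mod V ?n"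
    and Xu: "\<And>q. q < length es \<Longrightarrow> col X q = D i *\<^sub>v u q"
    by blast
  define Y where "Y = mat ?n (length es) (\<lambda>(j, q). degree_part (degs (Suc i) ! j) (es ! q) (u q $ j))"
  have "graded_mat (degs (Suc i)) es Y"
    using u by (auto simp: graded_mat_def Y_def homogeneous_part free_mod_def intro!: degree_part_carrier)
  moreover have "X = D i * Y"
  proof (rule eq_matI)
    show "dim_row X = dim_row (D i * Y)" "dim_col X = dim_col (D i * Y)"
      using X graded_mat_D[of i] by (auto simp: graded_mat_def Y_def)
    fix p q assume "p < dim_row (D i * Y)" "q < dim_col (D i * Y)"
    then have pq: "p < ?m" "q < length es" using graded_mat_D[of i] by (auto simp: graded_mat_def Y_def)
    have D: "D i \<in> carrier_mat ?m ?n" and Xc: "X \<in> carrier_mat ?m (length es)"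
      and uc: "u q \<in> carrier_vec ?n"
      using graded_mat_D X u[OF pq(2)] by (auto simp: graded_mat_def free_mod_def)
    have h: "homogeneous w (degs i ! p) (degs (Suc i) ! j) (D i $$ (p, j))" if "j < ?n" for j
      using graded_mat_D[of i] pq that by (auto simp: graded_mat_def)
    have "X $$ (p, q) = col X q $ p" using pq Xc by auto
    also have "\<dots> = (\<Sum>j = 0..<?n. D i $$ (p, j) * u q $ j)"
      unfolding Xu[OF pq(2)] using pq D uc by (auto simp: scalar_prod_def intro!: sum.cong)
    finally have e: "X $$ (p, q) = (\<Sum>j = 0..<?n. D i $$ (p, j) * u q $ j)" .
    have "X $$ (p, q) = degree_part (degs i ! p) (es ! q) (X $$ (p, q))"
      using degree_part_homogeneous[of "degs i ! p" "es ! q" "X $$ (p, q)"] X pq by (simp add: graded_mat_def)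
    also have "\<dots> = (\<Sum>j = 0..<?n. D i $$ (p, j) * degree_part (degs (Suc i) ! j) (es ! q) (u q $ j))"
      unfolding e degree_part_sum by (rule sum.cong) (simp_all add: degree_part_mult h)
    also have "\<dots> = (D i * Y) $$ (p, q)"
      using pq D by (auto simp: Y_def scalar_prod_def intro!: sum.cong)
    finally show "X $$ (p, q) = (D i * Y) $$ (p, q)" .
  qed
  ultimately show ?thesis by blast
qed

end

locale resolution_pair = G: graded_resolution V M w dG G \<epsilon>G + F: graded_resolution V M w dF F \<epsilon>F
  for V :: "'v set" and M :: "'v pp set" and w :: "'v pp \<Rightarrow> 'g::comm_monoid_add"
    and dG dF :: "nat \<Rightarrow> 'g list" and G F :: "nat \<Rightarrow> ('v, 'k::field) mpoly mat"
    and \<epsilon>G \<epsilon>F :: "('v, 'k) mpoly vec"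
begin

text \<open>The identity of \<open>S/I\<close> is lifted to \<open>G\<^sub>0 \<rightarrow> F\<^sub>0\<close> on basis elements; it is compatible with the augmentations
  only modulo \<open>I\<close>.\<close>

lemma chain_map_0:
  "\<exists>A. G.graded_mat (dF 0) (dG 0) A \<and> (\<forall>v\<in>free_mod V (length (dG 0)). \<epsilon>F \<bullet> (A *\<^sub>v v) - \<epsilon>G \<bullet> v \<in> monomial_ideal V M)"
proof -
  let ?m = "length (dF 0)" and ?n = "length (dG 0)"
  have "\<forall>j. \<exists>v. j < ?n \<longrightarrow> v \<in> free_mod V ?m \<and> \<epsilon>G $ j - \<epsilon>F \<bullet> v \<in> monomial_ideal V M"
    using F.onto[of "\<epsilon>G $ _"] G.eps(1) unfolding free_mod_def by blast
  from choice[OF this] obtain u where u: "\<And>j. j < ?n \<Longrightarrow> u j \<in> free_mod V ?m"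
    and eu: "\<And>j. j < ?n \<Longrightarrow> \<epsilon>G $ j - \<epsilon>F \<bullet> u j \<in> monomial_ideal V M"
    by blast
  define A where "A = mat ?m ?n (\<lambda>(p, j). G.degree_part (dF 0 ! p) (dG 0 ! j) (u j $ p))"
  have A: "G.graded_mat (dF 0) (dG 0) A"
    using u by (auto simp: G.graded_mat_def A_def G.homogeneous_part free_mod_def intro!: G.degree_part_carrier)
  have Ac: "A \<in> carrier_mat ?m ?n" by (simp add: A_def)
  have ec: "\<epsilon>F \<in> carrier_vec ?m" "\<epsilon>G \<in> carrier_vec ?n"
    using F.eps(1) G.eps(1) by (auto simp: free_mod_def)
  have col: "(\<Sum>p = 0..<?m. \<epsilon>F $ p * A $$ (p, j)) - \<epsilon>G $ j \<in> monomial_ideal V M" if j: "j < ?n" for j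
  proof -
    have uc: "u j \<in> carrier_vec ?m" using u[OF j] by (simp add: free_mod_def)
    have "G.degree_part 0 (dG 0 ! j) (\<epsilon>F \<bullet> u j) = (\<Sum>p = 0..<?m. \<epsilon>F $ p * A $$ (p, j))"
      using uc j by (auto simp: scalar_prod_def G.degree_part_sum A_def intro!: sum.cong G.degree_part_mult F.eps(2))
    then have "G.degree_part 0 (dG 0 ! j) (\<epsilon>G $ j - \<epsilon>F \<bullet> u j) = \<epsilon>G $ j - (\<Sum>p = 0..<?m. \<epsilon>F $ p * A $$ (p, j))"
      using G.degree_part_homogeneous[OF G.eps(2)[OF j]] by (simp add: G.degree_part_diff)
    then have "\<epsilon>G $ j - (\<Sum>p = 0..<?m. \<epsilon>F $ p * A $$ (p, j)) \<in> monomial_ideal V M"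
      using G.degree_part_ideal[OF eu[OF j], of 0 "dG 0 ! j"] by simp
    from monomial_ideal_closed(4)[OF this] show ?thesis by simp
  qed
  have "\<epsilon>F \<bullet> (A *\<^sub>v v) - \<epsilon>G \<bullet> v \<in> monomial_ideal V M" if v: "v \<in> free_mod V ?n" for v
  proof -
    have vc: "v \<in> carrier_vec ?n" using v by (simp add: free_mod_def)
    have "\<epsilon>F \<bullet> (A *\<^sub>v v) = (\<Sum>p = 0..<?m. \<Sum>j = 0..<?n. \<epsilon>F $ p * A $$ (p, j) * v $ j)"
      using Ac vc by (auto simp: scalar_prod_def sum_distrib_left mult.assoc intro!: sum.cong)
    also have "\<dots> = (\<Sum>j = 0..<?n. (\<Sum>p = 0..<?m. \<epsilon>F $ p * A $$ (p, j)) * v $ j)"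
      by (subst sum.swap) (simp add: sum_distrib_right)
    finally have "\<epsilon>F \<bullet> (A *\<^sub>v v) - \<epsilon>G \<bullet> v
        = (\<Sum>j = 0..<?n. v $ j * ((\<Sum>p = 0..<?m. \<epsilon>F $ p * A $$ (p, j)) - \<epsilon>G $ j))"
      using vc by (simp add: scalar_prod_def sum_subtractf[symmetric] algebra_simps)
    moreover have "v $ j * ((\<Sum>p = 0..<?m. \<epsilon>F $ p * A $$ (p, j)) - \<epsilon>G $ j) \<in> monomial_ideal V M"
      if "j \<in> {0..<?n}" for j
      using that v col[of j] by (intro monomial_ideal_closed(5)) (auto simp: free_mod_def)
    ultimately show ?thesis by (simp only: monomial_ideal_sum)
  qed
  then show ?thesis using A by blast
qed

text \<open>The lift is extended step by step. What carries the recursion is that the map found so far sends cycles to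
  cycles.\<close>

lemma chain_map:
  "\<exists>f. (\<forall>i. G.graded_mat (dF i) (dG i) (f i) \<and> F i * f (Suc i) = f i * G i) \<and>
     (\<forall>v\<in>free_mod V (length (dG 0)). \<epsilon>F \<bullet> (f 0 *\<^sub>v v) - \<epsilon>G \<bullet> v \<in> monomial_ideal V M)"
proof -
  define P where "P i A \<longleftrightarrow> G.graded_mat (dF i) (dG i) A \<and>
    (i = 0 \<longrightarrow> (\<forall>v\<in>free_mod V (length (dG 0)). \<epsilon>F \<bullet> (A *\<^sub>v v) - \<epsilon>G \<bullet> v \<in> monomial_ideal V M)) \<and>
    (\<forall>v\<in>free_mod V (length (dG i)). G.is_cycle i v \<longrightarrow> F.is_cycle i (A *\<^sub>v v))" for i A
  \<comment> \<open>The value at \<open>0\<close> is pinned down by the condition on the augmentations inside \<open>P\<close>.\<close>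
  have "\<exists>f. \<forall>i. P i (f i) \<and> F i * f (Suc i) = f i * G i"
  proof (rule dependent_nat_choice)
    obtain A where A: "G.graded_mat (dF 0) (dG 0) A"
      and c: "\<And>v. v \<in> free_mod V (length (dG 0)) \<Longrightarrow> \<epsilon>F \<bullet> (A *\<^sub>v v) - \<epsilon>G \<bullet> v \<in> monomial_ideal V M"
      using chain_map_0 by blast
    have "F.is_cycle 0 (A *\<^sub>v v)" if "v \<in> free_mod V (length (dG 0))" "G.is_cycle 0 v" for v
      using monomial_ideal_closed(2)[OF c[OF that(1)], of "\<epsilon>G \<bullet> v"] that(2)
      by (simp add: F.is_cycle_def G.is_cycle_def)
    then show "\<exists>A. P 0 A" using A c unfolding P_def by blast
  next
    fix A i assume PA: "P i A"
    have A: "G.graded_mat (dF i) (dG i) A" using PA by (simp add: P_def)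
    have is_cycle: "F.is_cycle i (col (A * G i) q)" if q: "q < length (dG (Suc i))" for q
    proof -
      have "col (A * G i) q = A *\<^sub>v col (G i) q"
        using G.graded_mat_carrier[OF A] G.graded_mat_carrier[OF G.graded_mat_D] q by (rule col_mult2)
      then show ?thesis
        using PA G.is_cycle_col_D[OF q] G.graded_mat_col[OF G.graded_mat_D q] by (simp add: P_def)
    qed
    obtain B where B: "G.graded_mat (dF (Suc i)) (dG (Suc i)) B" "A * G i = F i * B"
      using F.lift_through_differential[OF G.graded_mat_mult[OF A G.graded_mat_D] is_cycle] by blast
    note car = G.graded_mat_carrier[OF A] G.graded_mat_carrier[OF B(1)] G.graded_mat_carrier[OF G.graded_mat_D] G.graded_mat_carrier[OF F.graded_mat_D]
    have "F.is_cycle (Suc i) (B *\<^sub>v v)" if v: "v \<in> free_mod V (length (dG (Suc i)))" and "G.is_cycle (Suc i) v" for v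
    proof -
      have vc: "v \<in> carrier_vec (length (dG (Suc i)))" using v by (simp add: free_mod_def)
      have "F i *\<^sub>v (B *\<^sub>v v) = (F i * B) *\<^sub>v v"
        using car(4) car(2) vc by (rule assoc_mult_mat_vec[symmetric])
      also have "\<dots> = A *\<^sub>v (G i *\<^sub>v v)"
        unfolding B(2)[symmetric] using car(1) car(3) vc by (rule assoc_mult_mat_vec)
      also have "\<dots> = 0\<^sub>v (length (dF i))"
        using \<open>G.is_cycle (Suc i) v\<close> car(1) by (intro eq_vecI) (auto simp: G.is_cycle_def)
      finally show ?thesis by (simp add: F.is_cycle_def)
    qed
    then show "\<exists>B. P (Suc i) B \<and> F i * B = A * G i"
      using B by (intro exI[of _ B]) (simp add: P_def)
  qed
  then show ?thesis unfolding P_def by blast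
qed

end

context graded_resolution begin

text \<open>The homotopy is built degree by degree. Since \<open>D i * K (Suc i) = K i * D i\<close> and \<open>K i - D i * h i\<close> vanishes on
  the image of \<open>D i\<close>, the columns of \<open>K (Suc i) - h i * D i\<close> are cycles and lift through \<open>D (Suc i)\<close>.\<close>

lemma homotopy:
  assumes K: "\<And>i. graded_mat (degs i) (degs i) (K i)" and comm: "\<And>i. D i * K (Suc i) = K i * D i"
    and K0: "\<And>v. v \<in> free_mod V (length (degs 0)) \<Longrightarrow> \<epsilon> \<bullet> (K 0 *\<^sub>v v) \<in> monomial_ideal V M"
  shows "\<exists>h. (\<forall>i. graded_mat (degs (Suc i)) (degs i) (h i) \<and> K (Suc i) - h i * D i = D (Suc i) * h (Suc i)) \<and>
    K 0 = D 0 * h 0"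
proof -
  define P where "P i h \<longleftrightarrow> graded_mat (degs (Suc i)) (degs i) h \<and> (i = 0 \<longrightarrow> K 0 = D 0 * h) \<and>
    (K i - D i * h) * D i = 0\<^sub>m (length (degs i)) (length (degs (Suc i)))" for i h
  note cD = graded_mat_carrier[OF graded_mat_D] and cK = graded_mat_carrier[OF K]
  have "\<exists>h. \<forall>i. P i (h i) \<and> K (Suc i) - h i * D i = D (Suc i) * h (Suc i)"
  proof (rule dependent_nat_choice)
    have "is_cycle 0 (col (K 0) q)" if q: "q < length (degs 0)" for q
    proof -
      let ?u = "unit_vec (length (degs 0)) q :: ('v, 'k) mpoly vec"
      have "?u \<in> free_mod V (length (degs 0))" by (simp add: free_mod_def unit_vec_def)
      moreover have "col (K 0) q = K 0 *\<^sub>v ?u"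
        using cK[of 0] q by (intro eq_vecI) auto
      ultimately show ?thesis using K0 by (simp add: is_cycle_def)
    qed
    then obtain h where h: "graded_mat (degs (Suc 0)) (degs 0) h" "K 0 = D 0 * h"
      using lift_through_differential[OF K[of 0]] by blast
    have "(K 0 - D 0 * h) = 0\<^sub>m (length (degs 0)) (length (degs 0))"
      using cK[of 0] by (auto simp: h(2)[symmetric])
    then have "P 0 h" using h cD[of 0] by (simp add: P_def)
    then show "\<exists>h. P 0 h" by blast
  next
    fix h i assume Ph: "P i h"
    have gh: "graded_mat (degs (Suc i)) (degs i) h" using Ph by (simp add: P_def)
    note ch = graded_mat_carrier[OF gh]
    let ?X = "K (Suc i) - h * D i"
    have X: "graded_mat (degs (Suc i)) (degs (Suc i)) ?X"
      by (rule graded_mat_diff[OF K graded_mat_mult[OF gh graded_mat_D]])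
    have "D i * ?X = D i * K (Suc i) - D i * (h * D i)"
      using cD cK mult_carrier_mat[OF ch cD] by (rule mult_minus_distrib_mat)
    also have "D i * (h * D i) = (D i * h) * D i"
      using cD ch cD by (rule assoc_mult_mat[symmetric])
    also have "D i * K (Suc i) - (D i * h) * D i = (K i - D i * h) * D i"
      unfolding comm using cK mult_carrier_mat[OF cD ch] cD by (rule minus_mult_distrib_mat[symmetric])
    also have "\<dots> = 0\<^sub>m (length (degs i)) (length (degs (Suc i)))" using Ph by (simp add: P_def)
    finally have DX: "D i * ?X = 0\<^sub>m (length (degs i)) (length (degs (Suc i)))" .
    have "is_cycle (Suc i) (col ?X q)" if q: "q < length (degs (Suc i))" for q
    proof -
      have "D i *\<^sub>v col ?X q = col (D i * ?X) q"
        using cD graded_mat_carrier[OF X] q by (rule col_mult2[symmetric])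
      also have "\<dots> = 0\<^sub>v (length (degs i))" unfolding DX using q by auto
      finally show ?thesis by (simp add: is_cycle_def)
    qed
    then obtain h' where h': "graded_mat (degs (Suc (Suc i))) (degs (Suc i)) h'" "?X = D (Suc i) * h'"
      using lift_through_differential[OF X] by blast
    have "(K (Suc i) - D (Suc i) * h') * D (Suc i) = 0\<^sub>m (length (degs (Suc i))) (length (degs (Suc (Suc i))))"
    proof -
      have "K (Suc i) - D (Suc i) * h' = h * D i"
        unfolding h'(2)[symmetric] using cK[of "Suc i"] mult_carrier_mat[OF ch cD[of i]] by (intro eq_matI) auto
      moreover have "h * D i * D (Suc i) = h * (D i * D (Suc i))"
        using ch cD cD by (rule assoc_mult_mat)
      moreover have "D i * D (Suc i) = 0\<^sub>m (length (degs i)) (length (degs (Suc (Suc i))))"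
      proof (rule eq_matI)
        fix p q
        assume "p < dim_row (0\<^sub>m (length (degs i)) (length (degs (Suc (Suc i)))))"
          "q < dim_col (0\<^sub>m (length (degs i)) (length (degs (Suc (Suc i)))))"
        then have pq: "p < length (degs i)" "q < length (degs (Suc (Suc i)))" by auto
        have "col (D i * D (Suc i)) q = D i *\<^sub>v col (D (Suc i)) q"
          using cD cD pq(2) by (rule col_mult2)
        also have "\<dots> = 0\<^sub>v (length (degs i))" using is_cycle_col_D[OF pq(2)] by (simp add: is_cycle_def)
        finally have "col (D i * D (Suc i)) q $ p = 0" using pq by simp
        then show "(D i * D (Suc i)) $$ (p, q) = 0\<^sub>m (length (degs i)) (length (degs (Suc (Suc i)))) $$ (p, q)"
          using pq cD[of i] cD[of "Suc i"] by auto
      qed (use cD[of i] cD[of "Suc i"] in auto)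
      ultimately show ?thesis using ch by simp
    qed
    then show "\<exists>h'. P (Suc i) h' \<and> K (Suc i) - h * D i = D (Suc i) * h'"
      using h' by (intro exI[of _ h']) (simp add: P_def)
  qed
  then obtain h where "\<And>i. P i (h i)" "\<And>i. K (Suc i) - h i * D i = D (Suc i) * h (Suc i)" by blast
  then show ?thesis by (intro exI[of _ h]) (simp add: P_def)
qed

end

lemma lookup_mult_mat_0:
  fixes A B :: "('v, 'k::field) mpoly mat"
  assumes "A \<in> carrier_mat m n" "B \<in> carrier_mat n l" "p < m" "r < l"
  shows "Poly_Mapping.lookup ((A * B) $$ (p, r)) 0
    = (\<Sum>q<n. Poly_Mapping.lookup (A $$ (p, q)) 0 * Poly_Mapping.lookup (B $$ (q, r)) 0)"
proof -
  have "(A * B) $$ (p, r) = (\<Sum>q<n. A $$ (p, q) * B $$ (q, r))"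
    using assms by (auto simp: scalar_prod_def lessThan_atLeast0 intro!: sum.cong)
  then show ?thesis by (simp add: lookup_sum lookup_mult_0)
qed

text \<open>A basis element \<open>e\<close> of \<open>G\<^sub>s\<close> whose row and column in the differentials have no constant terms cannot be
  cancelled. For comparison maps \<open>f: G \<rightarrow> F\<close> and \<open>g: F \<rightarrow> G\<close> one has \<open>g f - 1 = D h + h D\<close>, and the hypotheses on
  \<open>e\<close> make the constant term of the right-hand side at \<open>(e, e)\<close> vanish. So \<open>g f\<close> has constant term \<open>1\<close> there,
  and some entry \<open>f(p, e)\<close> has a nonzero constant term, which for a degree-preserving map forces
  the degrees of \<open>p\<close> and \<open>e\<close> to agree.\<close>

theorem (in resolution_pair) critical_degree:
  assumes e: "e < length (dG s)"
    and row: "\<And>q. q < length (dG (Suc s)) \<Longrightarrow> Poly_Mapping.lookup (G s $$ (e, q)) 0 = 0"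
    and col: "\<And>s' p. s = Suc s' \<Longrightarrow> p < length (dG s') \<Longrightarrow> Poly_Mapping.lookup (G s' $$ (p, e)) 0 = 0"
  shows "dG s ! e \<in> set (dF s)"
proof -
  interpret FG: resolution_pair V M w dF dG F G \<epsilon>F \<epsilon>G by unfold_locales
  obtain f where f: "\<And>i. G.graded_mat (dF i) (dG i) (f i)" "\<And>i. F i * f (Suc i) = f i * G i"
    and f0: "\<And>v. v \<in> free_mod V (length (dG 0)) \<Longrightarrow> \<epsilon>F \<bullet> (f 0 *\<^sub>v v) - \<epsilon>G \<bullet> v \<in> monomial_ideal V M"
    using chain_map by blast
  obtain g where g: "\<And>i. G.graded_mat (dG i) (dF i) (g i)" "\<And>i. G i * g (Suc i) = g i * F i"
    and g0: "\<And>v. v \<in> free_mod V (length (dF 0)) \<Longrightarrow> \<epsilon>G \<bullet> (g 0 *\<^sub>v v) - \<epsilon>F \<bullet> v \<in> monomial_ideal V M"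
    using FG.chain_map by blast
  note cf = G.graded_mat_carrier[OF f(1)] and cg = G.graded_mat_carrier[OF g(1)]
    and cG = G.graded_mat_carrier[OF G.graded_mat_D] and cF = G.graded_mat_carrier[OF F.graded_mat_D]
  \<comment> \<open>The difference between the composite comparison map and the identity induces zero on \<open>S/I\<close>.\<close>
  define K where "K i = g i * f i - 1\<^sub>m (length (dG i))" for i
  have K: "G.graded_mat (dG i) (dG i) (K i)" for i
    unfolding K_def by (rule G.graded_mat_diff[OF G.graded_mat_mult[OF g(1) f(1)] G.graded_mat_one])
  have comm: "G i * K (Suc i) = K i * G i" for i
  proof -
    have "G i * K (Suc i) = G i * (g (Suc i) * f (Suc i)) - G i * 1\<^sub>m (length (dG (Suc i)))"
      unfolding K_def using cG mult_carrier_mat[OF cg cf] one_carrier_mat by (rule mult_minus_distrib_mat)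
    also have "G i * (g (Suc i) * f (Suc i)) = (G i * g (Suc i)) * f (Suc i)"
      using cG cg cf by (rule assoc_mult_mat[symmetric])
    also have "\<dots> = g i * (f i * G i)"
      unfolding g(2) f(2)[symmetric] using cg cF cf by (rule assoc_mult_mat)
    also have "\<dots> = (g i * f i) * G i"
      using cg cf cG by (rule assoc_mult_mat[symmetric])
    also have "G i * 1\<^sub>m (length (dG (Suc i))) = 1\<^sub>m (length (dG i)) * G i"
      using cG[of i] by simp
    also have "(g i * f i) * G i - 1\<^sub>m (length (dG i)) * G i = K i * G i"
      unfolding K_def using mult_carrier_mat[OF cg cf] one_carrier_mat cG by (rule minus_mult_distrib_mat[symmetric])
    finally show ?thesis .
  qed
  have K0: "\<epsilon>G \<bullet> (K 0 *\<^sub>v v) \<in> monomial_ideal V M" if v: "v \<in> free_mod V (length (dG 0))" for v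
  proof -
    have vc: "v \<in> carrier_vec (length (dG 0))" using v by (simp add: free_mod_def)
    have ec: "\<epsilon>G \<in> carrier_vec (length (dG 0))" using G.eps(1) by (simp add: free_mod_def)
    have "K 0 *\<^sub>v v = (g 0 * f 0) *\<^sub>v v - 1\<^sub>m (length (dG 0)) *\<^sub>v v"
      unfolding K_def using mult_carrier_mat[OF cg cf] one_carrier_mat vc by (rule minus_mult_distrib_mat_vec)
    also have "(g 0 * f 0) *\<^sub>v v = g 0 *\<^sub>v (f 0 *\<^sub>v v)"
      using cg cf vc by (rule assoc_mult_mat_vec)
    finally have "K 0 *\<^sub>v v = g 0 *\<^sub>v (f 0 *\<^sub>v v) - v" using vc by simp
    then have "\<epsilon>G \<bullet> (K 0 *\<^sub>v v) = \<epsilon>G \<bullet> (g 0 *\<^sub>v (f 0 *\<^sub>v v)) - \<epsilon>G \<bullet> v"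
      using ec vc mult_mat_vec_carrier[OF cg mult_mat_vec_carrier[OF cf vc]]
      by (simp add: scalar_prod_minus_distrib)
    also have "\<dots> = (\<epsilon>G \<bullet> (g 0 *\<^sub>v (f 0 *\<^sub>v v)) - \<epsilon>F \<bullet> (f 0 *\<^sub>v v)) + (\<epsilon>F \<bullet> (f 0 *\<^sub>v v) - \<epsilon>G \<bullet> v)"
      by simp
    also have "\<dots> \<in> monomial_ideal V M"
      by (intro monomial_ideal_closed(2) g0 f0 v G.graded_mat_mult_vec[OF f(1)])
    finally show ?thesis .
  qed
  obtain h where h: "\<And>i. G.graded_mat (dG (Suc i)) (dG i) (h i)"
    and hS: "\<And>i. K (Suc i) - h i * G i = G (Suc i) * h (Suc i)" and h0: "K 0 = G 0 * h 0"
    using G.homotopy[OF K comm K0] by blast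
  note ch = G.graded_mat_carrier[OF h]
  have "Poly_Mapping.lookup ((G s * h s) $$ (e, e)) 0 = 0"
    unfolding lookup_mult_mat_0[OF cG ch e e] using row by simp
  moreover have "Poly_Mapping.lookup (K s $$ (e, e)) 0 = Poly_Mapping.lookup ((G s * h s) $$ (e, e)) 0"
  proof (cases s)
    case 0
    then show ?thesis using h0 by simp
  next
    case (Suc i)
    have "Poly_Mapping.lookup ((h i * G i) $$ (e, e)) 0 = 0"
      unfolding lookup_mult_mat_0[OF ch cG e[unfolded Suc] e[unfolded Suc]] using col[OF Suc] by simp
    moreover have "(G s * h s) $$ (e, e) = K s $$ (e, e) - (h i * G i) $$ (e, e)"
      unfolding Suc hS[symmetric] using e[unfolded Suc] ch[of i] cG[of i] by simp
    ultimately show ?thesis by (simp add: lookup_minus)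
  qed
  ultimately have "Poly_Mapping.lookup (K s $$ (e, e)) 0 = 0" by simp
  moreover have "K s $$ (e, e) = (g s * f s) $$ (e, e) - 1"
    unfolding K_def using e cf[of s] cg[of s] by simp
  ultimately have "Poly_Mapping.lookup ((g s * f s) $$ (e, e)) 0 = 1"
    by (simp add: lookup_minus)
  then have "(\<Sum>p<length (dF s). Poly_Mapping.lookup (g s $$ (e, p)) 0 * Poly_Mapping.lookup (f s $$ (p, e)) 0) \<noteq> 0"
    using lookup_mult_mat_0[OF cg cf e e] by simp
  then obtain p where p: "p < length (dF s)" "Poly_Mapping.lookup (f s $$ (p, e)) 0 \<noteq> 0"
    by (metis (no_types, lifting) lessThan_iff mult_zero_right sum.neutral)
  then have "w 0 + dF s ! p = dG s ! e"
    using f(1)[of s] e by (auto simp: G.graded_mat_def homogeneous_def in_keys_iff)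
  then show ?thesis using nth_mem[OF p(1)] by (simp add: G.w_0)
qed

text \<open>In a minimal resolution every basis element satisfies the hypotheses of \<open>critical_degree\<close>.\<close>

lemma minimal_degrees_subset:
  fixes w :: "'v pp \<Rightarrow> 'g::comm_monoid_add"
  assumes w: "grading w"
    and G: "minimal_graded_free_resolution V w (monomial_ideal V M) dG (G :: nat \<Rightarrow> ('v, 'k::field) mpoly mat) \<epsilon>G"
    and F: "graded_free_resolution V w (monomial_ideal V M) dF (F :: nat \<Rightarrow> ('v, 'k) mpoly mat) \<epsilon>F"
  shows "set (dG i) \<subseteq> set (dF i)"
proof
  interpret grading V M w by (rule w)
  interpret resolution_pair V M w dG dF G F \<epsilon>G \<epsilon>F
    using G F by unfold_locales (simp_all add: minimal_graded_free_resolution_def)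
  fix d assume "d \<in> set (dG i)"
  then obtain e where e: "e < length (dG i)" "d = dG i ! e" by (auto simp: in_set_conv_nth)
  show "d \<in> set (dF i)"
    unfolding e(2)
    by (rule critical_degree) (use e G in \<open>auto simp: minimal_graded_free_resolution_def\<close>)
qed

text \<open>The Betti number refers to some minimal resolution, which has the same degrees as the given one by
  \<open>minimal_degrees_subset\<close> in both directions.\<close>

theorem graded_betti_nonzero_iff:
  fixes w :: "'v pp \<Rightarrow> 'g::comm_monoid_add"
  assumes w: "grading w"
    and G: "minimal_graded_free_resolution V w (monomial_ideal V M) degs (D :: nat \<Rightarrow> ('v, 'k::field) mpoly mat) \<epsilon>"
  shows "graded_betti V w (monomial_ideal V M :: ('v, 'k) mpoly set) i d \<noteq> 0 \<longleftrightarrow> d \<in> set (degs i)"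
proof -
  let ?P = "\<lambda>n. \<exists>degs D \<epsilon>. minimal_graded_free_resolution V w (monomial_ideal V M :: ('v, 'k) mpoly set) degs D \<epsilon>
      \<and> n = count_list (degs i) d"
  have "?P (graded_betti V w (monomial_ideal V M :: ('v, 'k) mpoly set) i d)"
    unfolding graded_betti_def
    by (rule someI[of ?P "count_list (degs i) d"]) (intro exI conjI, rule G, rule refl)
  then obtain degs' D' \<epsilon>' where G': "minimal_graded_free_resolution V w (monomial_ideal V M) degs' (D' :: nat \<Rightarrow> ('v, 'k) mpoly mat) \<epsilon>'"
    and n: "graded_betti V w (monomial_ideal V M :: ('v, 'k) mpoly set) i d = count_list (degs' i) d"
    by (elim exE conjE) (rule that)
  have "graded_free_resolution V w (monomial_ideal V M) degs D \<epsilon>"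
    "graded_free_resolution V w (monomial_ideal V M) degs' D' \<epsilon>'"
    using conjunct1[OF G[unfolded minimal_graded_free_resolution_def]]
      conjunct1[OF G'[unfolded minimal_graded_free_resolution_def]] by simp_all
  then have "set (degs' i) = set (degs i)"
    by (intro subset_antisym minimal_degrees_subset[OF w G'] minimal_degrees_subset[OF w G])
  then show ?thesis unfolding n count_list_0_iff by simp
qed

section \<open>Existence of a minimal resolution\<close>

text \<open>Subspaces of \<open>k\<^sup>n\<close> are finitely generated: the vectors with last coordinate zero are handled by
  induction, and one further vector suffices to clear the last coordinate.\<close>

lemma finite_spanning_set:
  fixes U :: "(nat \<Rightarrow> 'k::field) set"
  assumes "\<And>z u c. z \<in> U \<Longrightarrow> u \<in> U \<Longrightarrow> (\<lambda>p. z p + c * u p) \<in> U"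
    and "\<And>z p. z \<in> U \<Longrightarrow> z p \<noteq> 0 \<Longrightarrow> p < n"
  shows "\<exists>T. finite T \<and> T \<subseteq> U \<and> (\<forall>z\<in>U. \<exists>a. \<forall>p. z p = (\<Sum>t\<in>T. a t * t p))"
  using assms
proof (induction n arbitrary: U)
  case 0
  have "z p = 0" if "z \<in> U" for z p using 0(2)[OF that, of p] by auto
  then show ?case by (intro exI[of _ "{}"]) simp
next
  case (Suc n)
  define U' where "U' = {z \<in> U. z n = 0}"
  have "\<exists>T. finite T \<and> T \<subseteq> U' \<and> (\<forall>z\<in>U'. \<exists>a. \<forall>p. z p = (\<Sum>t\<in>T. a t * t p))"
  proof (rule Suc.IH)
    show "p < n" if "z \<in> U'" "z p \<noteq> 0" for z p
      using that Suc.prems(2)[of z p] by (cases "p = n") (auto simp: U'_def)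
  qed (auto simp: U'_def Suc.prems(1))
  then obtain T where T: "finite T" "T \<subseteq> U'" "\<And>z. z \<in> U' \<Longrightarrow> \<exists>a. \<forall>p. z p = (\<Sum>t\<in>T. a t * t p)"
    by blast
  show ?case
  proof (cases "U \<subseteq> U'")
    case True
    then show ?thesis using T by (intro exI[of _ T]) (auto simp: U'_def)
  next
    case False
    then obtain u where u: "u \<in> U" "u n \<noteq> 0" by (auto simp: U'_def)
    have uT: "u \<notin> T" using T(2) u by (auto simp: U'_def)
    have "\<exists>a. \<forall>p. z p = (\<Sum>t\<in>insert u T. a t * t p)" if z: "z \<in> U" for z
    proof -
      let ?z = "\<lambda>p. z p + (- z n / u n) * u p"
      have "?z \<in> U'" using Suc.prems(1)[OF z u(1), of "- z n / u n"] u(2) by (simp add: U'_def)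
      then obtain a where a: "\<And>p. ?z p = (\<Sum>t\<in>T. a t * t p)" using T(3) by blast
      have "z p = (\<Sum>t\<in>insert u T. (a(u := z n / u n)) t * t p)" for p
      proof -
        have "(\<Sum>t\<in>T. (a(u := z n / u n)) t * t p) = (\<Sum>t\<in>T. a t * t p)"
          using uT by (intro sum.cong) auto
        then show ?thesis using T(1) uT a[of p, symmetric] by simp
      qed
      then show ?thesis by blast
    qed
    then show ?thesis using T u by (intro exI[of _ "insert u T"]) (auto simp: U'_def)
  qed
qed

text \<open>The cycles of a frame in a fixed homological degree, collected as a family of subspaces \<open>Z W\<close> indexed by the
  squarefree degrees. That \<open>A p\<close> is a proper subset of \<open>W\<close> wherever a cycle is nonzero
  expresses minimality: a cycle of degree \<open>W\<close> never involves a basis element of that same degree.\<close>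

definition strand_family :: "'v set \<Rightarrow> nat \<Rightarrow> (nat \<Rightarrow> 'v set) \<Rightarrow> ('v set \<Rightarrow> (nat \<Rightarrow> 'k::field) set) \<Rightarrow> bool" where
  "strand_family V n A Z \<longleftrightarrow>
     (\<forall>p<n. A p \<subseteq> V) \<and>
     (\<forall>W. \<forall>z\<in>Z W. \<forall>p. z p \<noteq> 0 \<longrightarrow> p < n \<and> A p \<subset> W) \<and>
     (\<forall>W. (\<lambda>_. 0) \<in> Z W) \<and> (\<forall>W W'. W \<subseteq> W' \<longrightarrow> Z W \<subseteq> Z W') \<and>
     (\<forall>W. \<forall>z\<in>Z W. \<forall>u\<in>Z W. \<forall>c. (\<lambda>p. z p + c * u p) \<in> Z W)"

lemma strand_family_support:
  assumes "strand_family V n A Z" "z \<in> Z W" "z p \<noteq> 0"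
  shows "p < n" "A p \<subset> W"
proof -
  have "\<forall>W. \<forall>z\<in>Z W. \<forall>p. z p \<noteq> 0 \<longrightarrow> p < n \<and> A p \<subset> W"
    using assms(1) unfolding strand_family_def by (elim conjE)
  then show "p < n" "A p \<subset> W" using assms(2,3) by blast+
qed

lemma strand_family_mono:
  assumes "strand_family V n A Z" "z \<in> Z W" "W \<subseteq> W'"
  shows "z \<in> Z W'"
proof -
  have "\<forall>W W'. W \<subseteq> W' \<longrightarrow> Z W \<subseteq> Z W'"
    using assms(1) unfolding strand_family_def by (elim conjE)
  then show ?thesis using assms(2,3) by blast
qed

lemma strand_family_sum:
  assumes Z: "strand_family V n A Z" and B: "\<And>q. q \<in> B \<Longrightarrow> y q \<noteq> 0 \<Longrightarrow> f q \<in> Z W"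
  shows "(\<lambda>p. \<Sum>q\<in>B. f q p * y q) \<in> Z W"
  using B
proof (induction B rule: infinite_finite_induct)
  case (insert x B)
  have IH: "(\<lambda>p. \<Sum>q\<in>B. f q p * y q) \<in> Z W" using insert by blast
  show ?case
  proof (cases "y x = 0")
    case False
    then have "f x \<in> Z W" using insert.prems by blast
    then have "(\<lambda>p. (\<Sum>q\<in>B. f q p * y q) + y x * f x p) \<in> Z W"
      using IH Z unfolding strand_family_def by blast
    then show ?thesis using insert.hyps by (simp add: ac_simps)
  qed (use IH insert.hyps in simp)
qed (use Z in \<open>simp_all add: strand_family_def\<close>)

text \<open>The generators are kept as a set of pairs of a degree and a vector, since minimal generating sets are obtained by
  removing elements.\<close>

definition generates :: "'v set \<Rightarrow> ('v set \<Rightarrow> (nat \<Rightarrow> 'k::field) set) \<Rightarrow> ('v set \<times> (nat \<Rightarrow> 'k)) set \<Rightarrow> bool" where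
  "generates V Z T \<longleftrightarrow> finite T \<and> (\<forall>(B, t)\<in>T. B \<subseteq> V \<and> t \<in> Z B) \<and>
     (\<forall>W\<subseteq>V. \<forall>z\<in>Z W. \<exists>y. (\<forall>g\<in>T. y g \<noteq> 0 \<longrightarrow> fst g \<subseteq> W) \<and> (\<forall>p. z p = (\<Sum>g\<in>T. y g * snd g p)))"

lemma generates_expand:
  assumes "generates V Z T" "W \<subseteq> V" "z \<in> Z W"
  shows "\<exists>y. (\<forall>g\<in>T. y g \<noteq> 0 \<longrightarrow> fst g \<subseteq> W) \<and> (\<forall>p. z p = (\<Sum>g\<in>T. y g * snd g p))"
proof -
  have "\<forall>W\<subseteq>V. \<forall>z\<in>Z W. \<exists>y. (\<forall>g\<in>T. y g \<noteq> 0 \<longrightarrow> fst g \<subseteq> W) \<and> (\<forall>p. z p = (\<Sum>g\<in>T. y g * snd g p))"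
    using assms(1) unfolding generates_def by (elim conjE)
  from bspec[OF mp[OF spec[OF this] assms(2)] assms(3)] show ?thesis .
qed

text \<open>There are finitely many squarefree degrees, each with a finite-dimensional space of cycles.\<close>

lemma ex_generates:
  assumes V: "finite V" and Z: "strand_family V n A Z"
  shows "\<exists>T. generates V Z T"
proof -
  have "\<forall>W. \<exists>T. finite T \<and> T \<subseteq> Z W \<and> (\<forall>z\<in>Z W. \<exists>a. \<forall>p. z p = (\<Sum>t\<in>T. a t * t p))"
  proof
    fix W
    show "\<exists>T. finite T \<and> T \<subseteq> Z W \<and> (\<forall>z\<in>Z W. \<exists>a. \<forall>p. z p = (\<Sum>t\<in>T. a t * t p))"
      by (rule finite_spanning_set[of _ n]) (use Z in \<open>auto simp: strand_family_def\<close>)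
  qed
  from choice[OF this] obtain T where "\<forall>W. finite (T W) \<and> T W \<subseteq> Z W \<and>
      (\<forall>z\<in>Z W. \<exists>a. \<forall>p. z p = (\<Sum>t\<in>T W. a t * t p))"
    by (elim exE) (rule that)
  then have T: "finite (T W)" "T W \<subseteq> Z W" "z \<in> Z W \<Longrightarrow> \<exists>a. \<forall>p. z p = (\<Sum>t\<in>T W. a t * t p)" for W z
    by simp_all
  have "generates V Z (Sigma (Pow V) T)"
    unfolding generates_def
  proof (intro conjI allI impI ballI)
    show fin: "finite (Sigma (Pow V) T)" using V T(1) by simp
    show "case g of (B, t) \<Rightarrow> B \<subseteq> V \<and> t \<in> Z B" if "g \<in> Sigma (Pow V) T" for g
      using that T(2) by blast
    fix W z assume W: "W \<subseteq> V" and z: "z \<in> Z W"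
    from T(3)[OF z] obtain a where a: "\<forall>p. z p = (\<Sum>t\<in>T W. a t * t p)"
      by (elim exE) (rule that)
    let ?y = "\<lambda>g. if fst g = W then a (snd g) else 0"
    have "z p = (\<Sum>g\<in>Sigma (Pow V) T. ?y g * snd g p)" for p
    proof -
      have "(\<Sum>g\<in>Sigma (Pow V) T. ?y g * snd g p) = (\<Sum>g\<in>Pair W ` T W. ?y g * snd g p)"
        using W fin by (intro sum.mono_neutral_right) auto
      also have "\<dots> = (\<Sum>t\<in>T W. a t * t p)"
        by (subst sum.reindex) (auto simp: inj_on_def)
      finally show ?thesis using a by simp
    qed
    then show "\<exists>y. (\<forall>g\<in>Sigma (Pow V) T. y g \<noteq> 0 \<longrightarrow> fst g \<subseteq> W) \<and>
        (\<forall>p. z p = (\<Sum>g\<in>Sigma (Pow V) T. y g * snd g p))"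
      by (intro exI[of _ ?y]) auto
  qed
  then show ?thesis by blast
qed

text \<open>A relation in the degree of \<open>g0\<close> in which \<open>g0\<close> itself has a nonzero coefficient can be solved for \<open>g0\<close>,
  because the coefficients are scalars.\<close>

lemma generates_remove:
  assumes T: "generates V Z T" and g0: "g0 \<in> T" and y0: "y g0 \<noteq> 0"
    and y: "\<And>g. g \<in> T \<Longrightarrow> y g \<noteq> 0 \<Longrightarrow> fst g \<subseteq> fst g0"
    and rel: "\<And>p. (\<Sum>g\<in>T. y g * snd g p) = 0"
  shows "generates V Z (T - {g0})"
  unfolding generates_def
proof (intro conjI allI impI ballI)
  have fin: "finite T" using T by (simp add: generates_def)
  then show "finite (T - {g0})" by simp
  show "case g of (B, t) \<Rightarrow> B \<subseteq> V \<and> t \<in> Z B" if "g \<in> T - {g0}" for g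
    using that T by (auto simp: generates_def)
  fix W z assume "W \<subseteq> V" "z \<in> Z W"
  from generates_expand[OF T this]
  obtain x where x': "\<forall>g\<in>T. x g \<noteq> 0 \<longrightarrow> fst g \<subseteq> W" "\<forall>p. z p = (\<Sum>g\<in>T. x g * snd g p)"
    by (elim exE conjE) (rule that)
  then have x: "g \<in> T \<Longrightarrow> x g \<noteq> 0 \<Longrightarrow> fst g \<subseteq> W" "z p = (\<Sum>g\<in>T. x g * snd g p)" for g p
    by simp_all
  \<comment> \<open>Subtracting a multiple of the relation \<open>y\<close> removes \<open>g0\<close> from the expression \<open>x\<close> of \<open>z\<close>. If
    \<open>x g0 \<noteq> 0\<close>, then \<open>W\<close> contains the degree of \<open>g0\<close>, so the degrees remain below \<open>W\<close>.\<close>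
  define x' where "x' g = x g - x g0 / y g0 * y g" for g
  have "fst g \<subseteq> W" if "g \<in> T - {g0}" "x' g \<noteq> 0" for g
  proof (cases "x g = 0")
    case True
    then have "x g0 \<noteq> 0" "y g \<noteq> 0" using that by (auto simp: x'_def)
    then show ?thesis using x(1)[OF g0] y[of g] that by blast
  qed (use x(1)[of g] that in blast)
  moreover have "z p = (\<Sum>g\<in>T - {g0}. x' g * snd g p)" for p
  proof -
    have "(\<Sum>g\<in>T. x' g * snd g p) = (\<Sum>g\<in>T. x g * snd g p) - x g0 / y g0 * (\<Sum>g\<in>T. y g * snd g p)"
      by (simp add: x'_def left_diff_distrib sum_subtractf sum_distrib_left mult.assoc)
    then have "z p = (\<Sum>g\<in>T. x' g * snd g p)" using x(2)[of p] rel by simp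
    also have "\<dots> = x' g0 * snd g0 p + (\<Sum>g\<in>T - {g0}. x' g * snd g p)"
      using fin g0 by (rule sum.remove)
    also have "x' g0 = 0" using y0 by (simp add: x'_def)
    finally show ?thesis by simp
  qed
  ultimately show "\<exists>y. (\<forall>g\<in>T - {g0}. y g \<noteq> 0 \<longrightarrow> fst g \<subseteq> W) \<and> (\<forall>p. z p = (\<Sum>g\<in>T - {g0}. y g * snd g p))"
    by (intro exI[of _ x'] conjI ballI allI impI)
qed

definition kernel_strands :: "nat \<Rightarrow> (nat \<Rightarrow> 'v set) \<Rightarrow> (nat \<Rightarrow> nat \<Rightarrow> 'k::field) \<Rightarrow> 'v set \<Rightarrow> (nat \<Rightarrow> 'k) set" where
  "kernel_strands n A C W = {y. (\<forall>q. y q \<noteq> 0 \<longrightarrow> q < n \<and> A q \<subseteq> W) \<and> (\<forall>p. (\<Sum>q<n. C p q * y q) = 0)}"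

text \<open>The columns of \<open>C\<close>, taken in the degrees \<open>A\<close>, generate the family \<open>Z\<close>.\<close>

definition covers :: "'v set \<Rightarrow> ('v set \<Rightarrow> (nat \<Rightarrow> 'k::field) set) \<Rightarrow> nat \<Rightarrow> (nat \<Rightarrow> 'v set) \<Rightarrow> (nat \<Rightarrow> nat \<Rightarrow> 'k) \<Rightarrow> bool" where
  "covers V Z n A C \<longleftrightarrow> (\<forall>q<n. A q \<subseteq> V \<and> (\<lambda>p. C p q) \<in> Z (A q)) \<and>
     (\<forall>W\<subseteq>V. \<forall>z\<in>Z W. \<exists>y. (\<forall>q. y q \<noteq> 0 \<longrightarrow> q < n \<and> A q \<subseteq> W) \<and> (\<forall>p. z p = (\<Sum>q<n. C p q * y q)))"

lemma covers_expand:
  assumes "covers V Z n A C" "W \<subseteq> V" "z \<in> Z W"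
  shows "\<exists>y. (\<forall>q. y q \<noteq> 0 \<longrightarrow> q < n \<and> A q \<subseteq> W) \<and> (\<forall>p. z p = (\<Sum>q<n. C p q * y q))"
proof -
  have "\<forall>W\<subseteq>V. \<forall>z\<in>Z W. \<exists>y. (\<forall>q. y q \<noteq> 0 \<longrightarrow> q < n \<and> A q \<subseteq> W) \<and> (\<forall>p. z p = (\<Sum>q<n. C p q * y q))"
    using assms(1) unfolding covers_def by (elim conjE)
  from bspec[OF mp[OF spec[OF this] assms(2)] assms(3)] show ?thesis .
qed

text \<open>A generating set of least cardinality. By \<open>generates_remove\<close> none of its relations has a nonzero
  coefficient at a generator of the same degree, so the kernel is again a strand family.\<close>

lemma ex_minimal_cover:
  assumes V: "finite V" and Z: "strand_family V n A Z"
  shows "\<exists>n' A' C. covers V Z n' A' C \<and> strand_family V n' A' (kernel_strands n' A' C)"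
proof -
  obtain T0 where "generates V Z T0" using ex_generates[OF assms] by blast
  then have "\<exists>T. generates V Z T \<and> (\<forall>T'. generates V Z T' \<longrightarrow> card T \<le> card T')"
    by (rule ex_has_least_nat)
  then obtain T where T: "generates V Z T" and min: "\<And>T'. generates V Z T' \<Longrightarrow> card T \<le> card T'"
    by blast
  have fin: "finite T" using T by (simp add: generates_def)
  obtain gs where gs: "set gs = T" "distinct gs" using finite_distinct_list[OF fin] by blast
  define n' where "n' = length gs"
  define A' where "A' q = fst (gs ! q)" for q
  define C where "C p q = snd (gs ! q) p" for p q
  have sum: "(\<Sum>g\<in>T. y g * snd g p) = (\<Sum>q<n'. C p q * y (gs ! q))" for y p
    unfolding gs(1)[symmetric] sum_set_nth[OF gs(2)] n'_def by (simp add: C_def mult.commute)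
  have gT: "gs ! q \<in> T" if "q < n'" for q using that gs by (auto simp: n'_def)
  have AV: "A' q \<subseteq> V" "(\<lambda>p. C p q) \<in> Z (A' q)" if "q < n'" for q
    using gT[OF that] T by (auto simp: generates_def A'_def C_def case_prod_unfold)
  have "covers V Z n' A' C"
    unfolding covers_def
  proof (intro conjI allI impI ballI)
    fix W z assume "W \<subseteq> V" "z \<in> Z W"
    from generates_expand[OF T this]
    obtain y where "\<forall>g\<in>T. y g \<noteq> 0 \<longrightarrow> fst g \<subseteq> W" "\<forall>p. z p = (\<Sum>g\<in>T. y g * snd g p)"
      by (elim exE conjE) (rule that)
    then have y: "g \<in> T \<Longrightarrow> y g \<noteq> 0 \<Longrightarrow> fst g \<subseteq> W" "z p = (\<Sum>g\<in>T. y g * snd g p)" for g p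
      by simp_all
    define x where "x q = (if q < n' then y (gs ! q) else 0)" for q
    have "z p = (\<Sum>q<n'. C p q * x q)" for p unfolding y(2) sum by (simp add: x_def)
    moreover have "q < n' \<and> A' q \<subseteq> W" if "x q \<noteq> 0" for q
      using that y(1)[OF gT] by (auto simp: x_def A'_def split: if_splits)
    ultimately show "\<exists>y. (\<forall>q. y q \<noteq> 0 \<longrightarrow> q < n' \<and> A' q \<subseteq> W) \<and> (\<forall>p. z p = (\<Sum>q<n'. C p q * y q))"
      by (intro exI[of _ x] conjI allI impI) simp_all
  qed (use AV in auto)
  moreover have "strand_family V n' A' (kernel_strands n' A' C)"
    unfolding strand_family_def
  proof (intro conjI allI impI ballI)
    show "A' p \<subseteq> V" if "p < n'" for p using AV that by blast
    show "(\<lambda>_. 0) \<in> kernel_strands n' A' C W" for W by (simp add: kernel_strands_def)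
    show "kernel_strands n' A' C W \<subseteq> kernel_strands n' A' C W'" if "W \<subseteq> W'" for W W'
      using that by (auto simp: kernel_strands_def)
    show "(\<lambda>p. z p + c * u p) \<in> kernel_strands n' A' C W"
      if z: "z \<in> kernel_strands n' A' C W" and u: "u \<in> kernel_strands n' A' C W" for W z u c
    proof -
      have "(\<Sum>q<n'. C p q * (z q + c * u q)) = (\<Sum>q<n'. C p q * z q) + c * (\<Sum>q<n'. C p q * u q)" for p
        by (simp add: algebra_simps sum.distrib sum_distrib_left)
      then have "(\<Sum>q<n'. C p q * (z q + c * u q)) = 0" for p
        using z u by (simp add: kernel_strands_def)
      moreover have "q < n' \<and> A' q \<subseteq> W" if "z q + c * u q \<noteq> 0" for q
      proof -
        have "z q \<noteq> 0 \<or> u q \<noteq> 0" using that by auto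
        then show ?thesis using z u by (auto simp: kernel_strands_def)
      qed
      ultimately show ?thesis by (simp add: kernel_strands_def)
    qed
    fix W z p assume z: "z \<in> kernel_strands n' A' C W" and p: "z p \<noteq> 0"
    show n: "p < n'" using z p by (auto simp: kernel_strands_def)
    have "A' p \<noteq> W"
    proof
      assume W: "A' p = W"
      define y where "y g = z (index_of gs g)" for g
      have y: "y (gs ! q) = z q" if "q < n'" for q
        using that gs(2) by (simp add: y_def index_of_nth n'_def)
      have "generates V Z (T - {gs ! p})"
      proof (rule generates_remove[OF T gT[OF n], of y])
        show "y (gs ! p) \<noteq> 0" using y n p by simp
        show "(\<Sum>g\<in>T. y g * snd g r) = 0" for r
          unfolding sum using z y by (simp add: kernel_strands_def)
        fix g assume "g \<in> T" "y g \<noteq> 0"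
        then obtain q where "q < n'" "g = gs ! q" using gs by (auto simp: n'_def in_set_conv_nth)
        then show "fst g \<subseteq> fst (gs ! p)"
          using \<open>y g \<noteq> 0\<close> y z W by (auto simp: kernel_strands_def A'_def)
      qed
      then show False using min gT[OF n] fin card_Diff1_less[of T "gs ! p"] by fastforce
    qed
    then show "A' p \<subset> W" using z p by (auto simp: kernel_strands_def)
  qed
  ultimately show ?thesis by blast
qed

text \<open>Starting from the kernel of \<open>S \<rightarrow> S/I\<close>, the differentials are chosen one after the other by
  \<open>ex_minimal_cover\<close>. The assumption that no generator is \<open>1\<close> makes the first family satisfy the
  minimality condition.\<close>

theorem ex_minimal_exact_frame:
  fixes V :: "'v set" and S :: "'v set set"
  assumes V: "finite V" and S: "\<And>F. F \<in> S \<Longrightarrow> F \<subseteq> V \<and> F \<noteq> {}"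
  shows "\<exists>xs dg (c :: nat \<Rightarrow> nat \<Rightarrow> nat \<Rightarrow> 'k::field). exact_frame V S xs dg c 0 \<and>
    (\<forall>i p q. p \<in> set (xs i) \<longrightarrow> q \<in> set (xs (Suc i)) \<longrightarrow> c i p q \<noteq> 0 \<longrightarrow> dg i p \<noteq> dg (Suc i) q)"
proof -
  define Z0 :: "'v set \<Rightarrow> (nat \<Rightarrow> 'k) set" where
    "Z0 W = {z. (\<forall>p. z p \<noteq> 0 \<longrightarrow> p < 1) \<and> (z 0 \<noteq> 0 \<longrightarrow> (\<exists>F\<in>S. F \<subseteq> W))}" for W
  have fam0: "strand_family V 1 (\<lambda>_. {}) Z0"
    unfolding strand_family_def
  proof (intro conjI allI impI ballI)
    fix W z p assume "z \<in> Z0 W" "z p \<noteq> 0"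
    then show "p < 1" "{} \<subset> W" using S by (auto simp: Z0_def)
  next
    show "(\<lambda>_. 0) \<in> Z0 W" for W by (simp add: Z0_def)
    show "Z0 W \<subseteq> Z0 W'" if "W \<subseteq> W'" for W W'
      using order_trans[OF _ that] unfolding Z0_def by blast
  next
    fix W z u c assume zu: "z \<in> Z0 W" "u \<in> Z0 W"
    have nz: "z p \<noteq> 0 \<or> u p \<noteq> 0" if "z p + c * u p \<noteq> 0" for p using that by auto
    have "p < 1" if "z p + c * u p \<noteq> 0" for p
      using nz[OF that] zu unfolding Z0_def by blast
    moreover have "\<exists>F\<in>S. F \<subseteq> W" if "z 0 + c * u 0 \<noteq> 0"
      using nz[OF that] zu unfolding Z0_def by blast
    ultimately show "(\<lambda>p. z p + c * u p) \<in> Z0 W" by (simp add: Z0_def)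
  qed simp
  \<comment> \<open>A state consists of the number of basis elements, their degrees and the family of cycles.\<close>
  define step where "step st C st' \<longleftrightarrow> (case st of (n, A, Z) \<Rightarrow> case st' of (n', A', Z') \<Rightarrow>
      covers V Z n' A' C \<and> Z' = kernel_strands n' A' C)" for st :: "nat \<times> (nat \<Rightarrow> 'v set) \<times> ('v set \<Rightarrow> (nat \<Rightarrow> 'k) set)" and C st'
  define P where "P i st \<longleftrightarrow> (i = 0 \<longrightarrow> st = (1, \<lambda>_. {}, Z0)) \<and> (case st of (n, A, Z) \<Rightarrow> strand_family V n A Z)"
    for i :: nat and st :: "nat \<times> (nat \<Rightarrow> 'v set) \<times> ('v set \<Rightarrow> (nat \<Rightarrow> 'k) set)"
  have "\<exists>f. \<forall>i. P i (f i) \<and> (\<exists>C. step (f i) C (f (Suc i)))"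
  proof (rule dependent_nat_choice)
    show "\<exists>st. P 0 st" using fam0 by (auto simp: P_def)
    fix st i assume "P i st"
    moreover obtain n A Z where st1: "st = (n, A, Z)" by (cases st)
    ultimately have st: "st = (n, A, Z)" "strand_family V n A Z" by (simp_all add: P_def)
    obtain n' A' C where "covers V Z n' A' C" "strand_family V n' A' (kernel_strands n' A' C)"
      using ex_minimal_cover[OF V st(2)] by blast
    then show "\<exists>st'. P (Suc i) st' \<and> (\<exists>C. step st C st')"
      by (intro exI[of _ "(n', A', kernel_strands n' A' C)"]) (auto simp: P_def step_def st(1))
  qed
  then obtain f where f: "\<And>i. P i (f i)" "\<forall>i. \<exists>C. step (f i) C (f (Suc i))" by blast
  from choice[OF f(2)] obtain c where c: "\<And>i. step (f i) (c i) (f (Suc i))" by blast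
  define N where "N i = fst (f i)" for i
  define dg where "dg i = fst (snd (f i))" for i
  define Z where "Z i = snd (snd (f i))" for i
  have init: "N 0 = 1" "dg 0 = (\<lambda>_. {})" "Z 0 = Z0" using f(1)[of 0] by (simp_all add: P_def N_def dg_def Z_def)
  have fam: "strand_family V (N i) (dg i) (Z i)" for i
    using f(1)[of i] by (simp add: P_def N_def dg_def Z_def case_prod_unfold)
  have cov: "covers V (Z i) (N (Suc i)) (dg (Suc i)) (c i)"
    and ker: "Z (Suc i) = kernel_strands (N (Suc i)) (dg (Suc i)) (c i)" for i
    using c[of i] by (simp_all add: step_def N_def dg_def Z_def case_prod_unfold)
  let ?xs = "\<lambda>i. [0..<N i]"
  have c_less: "p < N i \<and> dg i p \<subset> dg (Suc i) q" if "q < N (Suc i)" "c i p q \<noteq> 0" for i p q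
  proof -
    have "(\<lambda>p. c i p q) \<in> Z i (dg (Suc i) q)" using cov[of i] that by (simp add: covers_def)
    from strand_family_support[OF fam this that(2)] show ?thesis by simp
  qed
  interpret squarefree_frame V S ?xs dg c 0
  proof
    show "dg i x \<subseteq> V" if "x \<in> set (?xs i)" for i x
      using fam[of i] that by (simp add: strand_family_def)
    show "dg i p \<subseteq> dg (Suc i) q" if "q \<in> set (?xs (Suc i))" "c i p q \<noteq> 0" for i p q
      using c_less[of q i p] that by auto
  qed (use V S init in auto)
  have differential: "differential i y p = (\<Sum>q<N (Suc i). c i p q * y q)" for i y p
    unfolding differential_def by (simp add: lessThan_atLeast0)
  have strand: "strand i W z \<longleftrightarrow> (\<forall>p. z p \<noteq> 0 \<longrightarrow> p < N i \<and> dg i p \<subseteq> W)" for i W z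
    by (simp add: strand_def)
  have cyc: "cycle i W z \<longleftrightarrow> z \<in> Z i W" if st: "strand i W z" for i W z
  proof (cases i)
    case 0
    then show ?thesis using st by (auto simp: cycle_def init Z0_def strand)
  next
    case (Suc j)
    have "differential j z p = 0" if "\<not> p < N j" for p
      unfolding differential using c_less[of _ j p] that by (intro sum.neutral) auto
    then show ?thesis
      using st Suc by (auto simp: cycle_def ker kernel_strands_def strand differential)
  qed
  have "exact_frame V S ?xs dg c 0"
  proof
    fix W i z assume W: "W \<subseteq> V" and st: "strand i W z"
    show "cycle i W z \<longleftrightarrow> (\<exists>y. strand (Suc i) W y \<and> (\<forall>p\<in>set (?xs i). z p = differential i y p))"
    proof
      assume "cycle i W z"
      then have "z \<in> Z i W" using cyc[OF st] by simp
      from covers_expand[OF cov W this]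
      obtain y where "\<forall>q. y q \<noteq> 0 \<longrightarrow> q < N (Suc i) \<and> dg (Suc i) q \<subseteq> W"
        "\<forall>p. z p = (\<Sum>q<N (Suc i). c i p q * y q)"
        by (elim exE conjE) (rule that)
      then show "\<exists>y. strand (Suc i) W y \<and> (\<forall>p\<in>set (?xs i). z p = differential i y p)"
        unfolding strand differential by (intro exI[of _ y]) simp
    next
      assume "\<exists>y. strand (Suc i) W y \<and> (\<forall>p\<in>set (?xs i). z p = differential i y p)"
      then obtain y where y: "strand (Suc i) W y" "\<And>p. p < N i \<Longrightarrow> z p = differential i y p" by auto
      have "z = (\<lambda>p. \<Sum>q<N (Suc i). c i p q * y q)"
      proof
        fix p
        show "z p = (\<Sum>q<N (Suc i). c i p q * y q)"
        proof (cases "p < N i")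
          case False
          have "(\<Sum>q<N (Suc i). c i p q * y q) = 0"
            using c_less[of _ i p] False by (intro sum.neutral) auto
          then show ?thesis using st False by (auto simp: strand)
        qed (use y(2) differential in simp)
      qed
      moreover have "(\<lambda>p. \<Sum>q<N (Suc i). c i p q * y q) \<in> Z i W"
      proof (rule strand_family_sum[OF fam])
        fix q assume q: "q \<in> {..<N (Suc i)}" "y q \<noteq> 0"
        have "(\<lambda>p. c i p q) \<in> Z i (dg (Suc i) q)" using cov[of i] q by (simp add: covers_def)
        moreover have "dg (Suc i) q \<subseteq> W" using y(1) q by (simp add: strand)
        ultimately show "(\<lambda>p. c i p q) \<in> Z i W" by (rule strand_family_mono[OF fam])
      qed
      ultimately have "z \<in> Z i W" by simp
      then show "cycle i W z" using cyc[OF st] by simp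
    qed
  qed
  moreover have "dg i p \<noteq> dg (Suc i) q" if "q \<in> set (?xs (Suc i))" "c i p q \<noteq> 0" for i p q
    using c_less[of q i p] that by auto
  ultimately show ?thesis by blast
qed

section \<open>The Lyubeznik resolution and well-ordered covers\<close>

definition sgn_in :: "nat \<Rightarrow> nat set \<Rightarrow> 'k::field" where
  "sgn_in j \<tau> = (-1) ^ card {l \<in> \<tau>. l < j}"

lemma sgn_in_insert:
  assumes "finite \<tau>" "i \<notin> \<tau>"
  shows "sgn_in j (insert i \<tau>) = (if i < j then - sgn_in j \<tau> else (sgn_in j \<tau> :: 'k::field))"
proof (cases "i < j")
  case True
  then have "{l \<in> insert i \<tau>. l < j} = insert i {l \<in> \<tau>. l < j}" by auto
  then show ?thesis using assms True by (simp add: sgn_in_def)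
next
  case False
  then have "{l \<in> insert i \<tau>. l < j} = {l \<in> \<tau>. l < j}" by auto
  then show ?thesis using False by (simp add: sgn_in_def)
qed

lemma sgn_in_least: "(\<And>l. l \<in> \<tau> \<Longrightarrow> j \<le> l) \<Longrightarrow> sgn_in j \<tau> = 1"
proof -
  assume "\<And>l. l \<in> \<tau> \<Longrightarrow> j \<le> l"
  then have "{l \<in> \<tau>. l < j} = {}" by (auto simp: not_less)
  then show ?thesis unfolding sgn_in_def by (simp only: card.empty power_0)
qed

text \<open>The simplicial differential in the coordinates of a frame: the coefficient of the boundary at \<open>\<tau>\<close>
  collects the coefficients of the sets obtained by adding one element to \<open>\<tau>\<close>.\<close>

definition boundary :: "nat \<Rightarrow> (nat set \<Rightarrow> 'k::field) \<Rightarrow> nat set \<Rightarrow> 'k" where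
  "boundary N z \<tau> = (\<Sum>j\<in>{..<N} - \<tau>. sgn_in j \<tau> * z (insert j \<tau>))"

text \<open>The two orders of adding a pair of elements contribute with opposite signs.\<close>

lemma boundary_boundary:
  assumes "finite \<tau>"
  shows "boundary N (boundary N z) \<tau> = 0"
proof -
  let ?R = "{..<N} - \<tau>"
  define f where "f j l = sgn_in j \<tau> * (sgn_in l (insert j \<tau>) * z (insert l (insert j \<tau>)))" for j l
  have anti: "f l j = - f j l" if "j \<in> ?R" "l \<in> ?R" "j < l" for j l
    using that assms by (auto simp: f_def sgn_in_insert insert_commute)
  \<comment> \<open>Antisymmetry of the whole double sum would only give that twice the sum is zero, which says
    nothing in characteristic two; the sum is therefore split into the pairs with \<open>j < l\<close> and with \<open>l < j\<close>.\<close>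
  have split: "(\<Sum>l\<in>{..<N} - insert j \<tau>. f j l) = (\<Sum>l\<in>{l\<in>?R. j < l}. f j l) + (\<Sum>l\<in>{l\<in>?R. l < j}. f j l)" for j
  proof -
    have eq: "{..<N} - insert j \<tau> = {l\<in>?R. j < l} \<union> {l\<in>?R. l < j}" by auto
    show ?thesis unfolding eq by (rule sum.union_disjoint) auto
  qed
  have "boundary N (boundary N z) \<tau> = (\<Sum>j\<in>?R. \<Sum>l\<in>{..<N} - insert j \<tau>. f j l)"
    by (simp add: boundary_def sum_distrib_left f_def)
  also have "\<dots> = (\<Sum>j\<in>?R. \<Sum>l\<in>{l\<in>?R. j < l}. f j l) + (\<Sum>j\<in>?R. \<Sum>l\<in>{l\<in>?R. l < j}. f j l)"
    by (simp add: split sum.distrib)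
  also have "(\<Sum>j\<in>?R. \<Sum>l\<in>{l\<in>?R. l < j}. f j l) = (\<Sum>l\<in>?R. \<Sum>j\<in>{j\<in>?R. l < j}. f j l)"
    by (rule sum.swap_restrict) auto
  also have "\<dots> = (\<Sum>l\<in>?R. \<Sum>j\<in>{j\<in>?R. l < j}. - f l j)"
    by (intro sum.cong refl) (simp add: anti)
  finally show ?thesis by (simp add: sum_negf)
qed

text \<open>The monomial generators of the ideal, given by their supports, in a fixed linear order.\<close>

locale lyubeznik =
  fixes V :: "'v set" and gen :: "nat \<Rightarrow> 'v set" and N :: nat
  assumes finite_V: "finite V" and gen_subset: "i < N \<Longrightarrow> gen i \<subseteq> V"
begin

text \<open>Lyubeznik's condition: no generator preceding an element \<open>j\<close> of \<open>\<sigma>\<close> divides the least common multiple of the elements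
  of \<open>\<sigma>\<close> from \<open>j\<close> on.\<close>

definition admissible :: "nat set \<Rightarrow> bool" where
  "admissible \<sigma> \<longleftrightarrow> \<sigma> \<subseteq> {..<N} \<and> (\<forall>j\<in>\<sigma>. \<forall>q<j. \<not> gen q \<subseteq> \<Union>(gen ` {i\<in>\<sigma>. j \<le> i}))"

definition faces_of_card :: "nat \<Rightarrow> nat set list" where
  "faces_of_card i = (SOME l. distinct l \<and> set l = {\<sigma>. admissible \<sigma> \<and> card \<sigma> = i})"

text \<open>For \<open>\<sigma> = \<tau> \<union> {j}\<close> this is the usual sign, the parity of the number of elements of \<open>\<sigma>\<close> before \<open>j\<close>.\<close>

definition incidence :: "nat set \<Rightarrow> nat set \<Rightarrow> 'k::field" where
  "incidence \<tau> \<sigma> = (if \<tau> \<subset> \<sigma> then (-1) ^ card {l \<in> \<sigma>. \<forall>j\<in>\<sigma> - \<tau>. l < j} else 0)"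

abbreviation supp :: "nat set \<Rightarrow> 'v set" where
  "supp \<sigma> \<equiv> \<Union>(gen ` \<sigma>)"

lemma admissible_finite: "admissible \<sigma> \<Longrightarrow> finite \<sigma>"
  using finite_subset[of \<sigma> "{..<N}"] by (simp add: admissible_def)

lemma admissible_subset:
  assumes "admissible \<sigma>" "\<tau> \<subseteq> \<sigma>"
  shows "admissible \<tau>"
  unfolding admissible_def
proof (intro conjI ballI allI impI notI)
  show "\<tau> \<subseteq> {..<N}" using assms by (auto simp: admissible_def)
  fix j q assume jq: "j \<in> \<tau>" "q < j" "gen q \<subseteq> supp {i \<in> \<tau>. j \<le> i}"
  have "supp {i \<in> \<tau>. j \<le> i} \<subseteq> supp {i \<in> \<sigma>. j \<le> i}" using assms(2) by blast
  then have "gen q \<subseteq> supp {i \<in> \<sigma>. j \<le> i}" using jq(3) by (rule subset_trans[rotated])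
  then show False using assms jq(1,2) unfolding admissible_def by blast
qed

lemma faces_of_card: "distinct (faces_of_card i)" "set (faces_of_card i) = {\<sigma>. admissible \<sigma> \<and> card \<sigma> = i}"
proof -
  have "{\<sigma>. admissible \<sigma> \<and> card \<sigma> = i} \<subseteq> Pow {..<N}" by (auto simp: admissible_def)
  then have "finite {\<sigma>. admissible \<sigma> \<and> card \<sigma> = i}" by (rule finite_subset) simp
  from finite_distinct_list[OF this]
  have "\<exists>l. distinct l \<and> set l = {\<sigma>. admissible \<sigma> \<and> card \<sigma> = i}"
    by (simp only: conj_commute)
  then have *: "distinct (faces_of_card i) \<and> set (faces_of_card i) = {\<sigma>. admissible \<sigma> \<and> card \<sigma> = i}"
    unfolding faces_of_card_def by (rule someI_ex)
  from * show "distinct (faces_of_card i)" by (rule conjunct1)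
  from * show "set (faces_of_card i) = {\<sigma>. admissible \<sigma> \<and> card \<sigma> = i}" by (rule conjunct2)
qed

lemma faces_of_card_0: "faces_of_card 0 = [{}]"
proof -
  have "admissible \<sigma> \<and> card \<sigma> = 0 \<longleftrightarrow> \<sigma> = {}" for \<sigma>
  proof (cases "\<sigma> = {}")
    case False
    then show ?thesis using admissible_finite[of \<sigma>] card_0_eq[of \<sigma>] by blast
  qed (simp add: admissible_def)
  then have set0: "set (faces_of_card 0) = {{}}" by (simp add: faces_of_card(2))
  then have "length (faces_of_card 0) = 1" using distinct_card[OF faces_of_card(1)[of 0]] by simp
  then show ?thesis using set0 by (cases "faces_of_card 0") simp_all
qed

lemma incidence_insert:
  assumes "j \<notin> \<tau>"
  shows "incidence \<tau> (insert j \<tau>) = sgn_in j \<tau>"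
proof -
  have "insert j \<tau> - \<tau> = {j}" "{l \<in> insert j \<tau>. l < j} = {l \<in> \<tau>. l < j}" using assms by auto
  then show ?thesis using assms by (auto simp: incidence_def sgn_in_def)
qed

lemma incidence_cases:
  assumes "\<sigma> \<in> set (faces_of_card (Suc i))" "\<tau> \<in> set (faces_of_card i)" "incidence \<tau> \<sigma> \<noteq> (0 :: 'k::field)"
  shows "\<exists>j. j \<in> {..<N} - \<tau> \<and> \<sigma> = insert j \<tau>"
proof -
  have sub: "\<tau> \<subset> \<sigma>" using assms(3) by (auto simp: incidence_def split: if_splits)
  have fin: "finite \<sigma>" and \<sigma>: "admissible \<sigma>" using assms(1) admissible_finite by (auto simp: faces_of_card)
  obtain j where j: "j \<in> \<sigma>" "j \<notin> \<tau>" using sub by blast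
  have eq: "insert j \<tau> = \<sigma>"
    using sub j fin assms(1,2) finite_subset[of \<tau> \<sigma>] by (intro card_subset_eq) (auto simp: faces_of_card)
  have "j < N" using \<sigma> j by (auto simp: admissible_def)
  then show ?thesis using j eq by (intro exI[of _ j]) simp
qed

sublocale squarefree_frame V "gen ` {..<N}" faces_of_card "\<lambda>_. supp" "\<lambda>_. incidence :: nat set \<Rightarrow> nat set \<Rightarrow> 'k::field" "{}"
proof
  show "supp x \<subseteq> V" if "x \<in> set (faces_of_card i)" for x i
    using that gen_subset by (auto simp: faces_of_card admissible_def)
  show "supp p \<subseteq> supp q" if "incidence p q \<noteq> (0 :: 'k)" for p q
    using that by (auto simp: incidence_def split: if_splits)
qed (use finite_V gen_subset faces_of_card_0 in \<open>auto simp: faces_of_card(1)\<close>)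

lemma strand_vanishes:
  assumes "strand i W z" "\<not> (admissible \<sigma> \<and> card \<sigma> = i)"
  shows "z \<sigma> = (0 :: 'k::field)"
  using assms(2) spec[OF assms(1)[unfolded strand_def], of \<sigma>] by (auto simp: faces_of_card)

lemma differential_boundary:
  fixes z :: "nat set \<Rightarrow> 'k::field"
  assumes z: "strand (Suc i) W z" and \<tau>: "\<tau> \<in> set (faces_of_card i)"
  shows "differential i z \<tau> = boundary N z \<tau>"
proof -
  let ?J = "{j \<in> {..<N} - \<tau>. insert j \<tau> \<in> set (faces_of_card (Suc i))}"
  have "differential i z \<tau> = (\<Sum>\<sigma>\<in>(\<lambda>j. insert j \<tau>) ` ?J. incidence \<tau> \<sigma> * z \<sigma>)"
    unfolding differential_def
  proof (rule sum.mono_neutral_right)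
    show "\<forall>\<sigma>\<in>set (faces_of_card (Suc i)) - (\<lambda>j. insert j \<tau>) ` ?J. incidence \<tau> \<sigma> * z \<sigma> = 0"
    proof
      fix \<sigma> assume \<sigma>: "\<sigma> \<in> set (faces_of_card (Suc i)) - (\<lambda>j. insert j \<tau>) ` ?J"
      from \<sigma> have \<sigma>1: "\<sigma> \<in> set (faces_of_card (Suc i))" by (rule DiffD1)
      from \<sigma> have \<sigma>2: "\<sigma> \<notin> (\<lambda>j. insert j \<tau>) ` ?J" by (elim DiffE)
      have "incidence \<tau> \<sigma> = (0 :: 'k)"
      proof (rule ccontr)
        assume "incidence \<tau> \<sigma> \<noteq> (0 :: 'k)"
        from incidence_cases[OF \<sigma>1 \<tau> this] obtain j where "j \<in> {..<N} - \<tau>" "\<sigma> = insert j \<tau>"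
          by (elim exE conjE) (rule that)
        then have "\<sigma> \<in> (\<lambda>j. insert j \<tau>) ` ?J" using \<sigma>1 by (intro image_eqI[of _ _ j] CollectI conjI) simp_all
        then show False using \<sigma>2 by contradiction
      qed
      then show "incidence \<tau> \<sigma> * z \<sigma> = 0" by simp
    qed
  qed auto
  also have "\<dots> = (\<Sum>j\<in>?J. incidence \<tau> (insert j \<tau>) * z (insert j \<tau>))"
    by (subst sum.reindex) (auto simp: inj_on_def)
  also have "\<dots> = (\<Sum>j\<in>?J. sgn_in j \<tau> * z (insert j \<tau>))"
    by (rule sum.cong) (auto simp: incidence_insert)
  also have "\<dots> = boundary N z \<tau>"
    unfolding boundary_def
    by (rule sum.mono_neutral_left) (use z in \<open>auto simp: strand_def\<close>)
  finally show ?thesis .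
qed

text \<open>The first generator \<open>q\<close> that divides \<open>x\<^sup>W\<close> can be added to any admissible set in degree \<open>W\<close>, since no
  generator before \<open>q\<close> divides \<open>x\<^sup>W\<close>. So the admissible sets in degree \<open>W\<close> form a cone with apex \<open>q\<close>.\<close>

lemma admissible_cone:
  assumes \<rho>: "admissible \<rho>" "supp \<rho> \<subseteq> W" and q: "q < N" "gen q \<subseteq> W" "\<And>j. gen j \<subseteq> W \<Longrightarrow> q \<le> j"
  shows "admissible (insert q \<rho>)"
  unfolding admissible_def
proof (intro conjI ballI allI impI notI)
  show "insert q \<rho> \<subseteq> {..<N}" using \<rho> q by (auto simp: admissible_def)
  fix j p assume j: "j \<in> insert q \<rho>" and p: "p < j" and sub: "gen p \<subseteq> supp {i \<in> insert q \<rho>. j \<le> i}"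
  have "supp {i \<in> insert q \<rho>. j \<le> i} \<subseteq> W" using \<rho>(2) q(2) by auto
  then have "q \<le> p" by (intro q(3) subset_trans[OF sub])
  then have "j \<in> \<rho>" and eq: "{i \<in> insert q \<rho>. j \<le> i} = {i \<in> \<rho>. j \<le> i}" using j p by auto
  have "\<forall>j\<in>\<rho>. \<forall>q<j. \<not> gen q \<subseteq> supp {i \<in> \<rho>. j \<le> i}"
    using \<rho>(1) unfolding admissible_def by (elim conjE)
  then show False using p \<open>j \<in> \<rho>\<close> sub[unfolded eq] by blast
qed

text \<open>If some generator divides \<open>x\<^sup>W\<close>, the strand of degree \<open>W\<close> is the augmented chain complex of a cone, and adding
  the apex is a contracting homotopy. Otherwise the empty set is the only admissible set of degree \<open>W\<close>.\<close>

sublocale exact_frame V "gen ` {..<N}" faces_of_card "\<lambda>_. supp" "\<lambda>_. incidence :: nat set \<Rightarrow> nat set \<Rightarrow> 'k::field" "{}"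
proof
  fix W i and z :: "nat set \<Rightarrow> 'k"
  assume W: "W \<subseteq> V" and st: "strand i W z"
  show "cycle i W z \<longleftrightarrow> (\<exists>y. strand (Suc i) W y \<and> (\<forall>p\<in>set (faces_of_card i). z p = differential i y p))"
  proof
    assume cyc: "cycle i W z"
    show "\<exists>y. strand (Suc i) W y \<and> (\<forall>p\<in>set (faces_of_card i). z p = differential i y p)"
    proof (cases "\<forall>\<sigma>. z \<sigma> = 0")
      case True
      then show ?thesis by (intro exI[of _ "\<lambda>_. 0"]) (simp add: strand_def differential_def)
    next
      case False
      then obtain \<sigma>0 where \<sigma>0: "z \<sigma>0 \<noteq> 0" by blast
      have supp_z: "admissible \<sigma>" "card \<sigma> = i" "supp \<sigma> \<subseteq> W" if "z \<sigma> \<noteq> 0" for \<sigma>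
        using st that by (auto simp: strand_def faces_of_card)
      have "\<exists>q. q < N \<and> gen q \<subseteq> W"
      proof (cases i)
        case 0
        then have "\<sigma>0 = {}" using supp_z[OF \<sigma>0] admissible_finite by auto
        then show ?thesis using cyc \<sigma>0 0 by (auto simp: cycle_def)
      next
        case (Suc i')
        then have "\<sigma>0 \<noteq> {}" using supp_z(2)[OF \<sigma>0] by auto
        then obtain q where "q \<in> \<sigma>0" by blast
        then show ?thesis using supp_z[OF \<sigma>0] by (auto simp: admissible_def)
      qed
      define q where "q = (LEAST q. gen q \<subseteq> W)"
      have q: "gen q \<subseteq> W"
        unfolding q_def using \<open>\<exists>q. q < N \<and> gen q \<subseteq> W\<close> LeastI_ex[of "\<lambda>q. gen q \<subseteq> W"] by blast
      have q_le: "\<And>j. gen j \<subseteq> W \<Longrightarrow> q \<le> j"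
        unfolding q_def by (rule Least_le)
      have qN: "q < N" using q_le \<open>\<exists>q. q < N \<and> gen q \<subseteq> W\<close> by (auto intro: le_less_trans)
      have z_ge: "q \<le> l" if "z \<sigma> \<noteq> 0" "l \<in> \<sigma>" for \<sigma> l
        using q_le[of l] supp_z(3)[OF that(1)] that(2) by blast
      \<comment> \<open>The cone over \<open>z\<close> with apex \<open>q\<close>; its sign is \<open>+1\<close> because \<open>q\<close> precedes all other elements.\<close>
      define y where "y \<tau> = (if q \<in> \<tau> then z (\<tau> - {q}) else 0)" for \<tau>
      have y: "strand (Suc i) W y"
        unfolding strand_def faces_of_card
      proof (intro allI impI)
        fix \<tau> assume "y \<tau> \<noteq> 0"
        then have \<tau>: "q \<in> \<tau>" "z (\<tau> - {q}) \<noteq> 0" by (auto simp: y_def split: if_splits)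
        have ins: "insert q (\<tau> - {q}) = \<tau>" using \<tau>(1) by auto
        note s = supp_z[OF \<tau>(2)]
        have adm: "admissible \<tau>"
          using admissible_cone[OF s(1,3) qN q q_le] unfolding ins .
        moreover have "card \<tau> = Suc i"
          using s(2) card_Suc_Diff1[OF admissible_finite[OF adm] \<tau>(1)] by simp
        moreover have "supp (insert q (\<tau> - {q})) \<subseteq> W" using s(3) q by auto
        ultimately show "\<tau> \<in> {\<sigma>. admissible \<sigma> \<and> card \<sigma> = Suc i} \<and> supp \<tau> \<subseteq> W"
          unfolding ins by simp
      qed
      have "z \<sigma> = boundary N y \<sigma>" if \<sigma>: "\<sigma> \<in> set (faces_of_card i)" for \<sigma>
      proof (cases "q \<in> \<sigma>")
        case False
        have "boundary N y \<sigma> = (\<Sum>j\<in>{q}. sgn_in j \<sigma> * y (insert j \<sigma>))"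
          unfolding boundary_def
          by (rule sum.mono_neutral_right) (use False qN in \<open>auto simp: y_def\<close>)
        also have "\<dots> = sgn_in q \<sigma> * z \<sigma>" using False by (simp add: y_def)
        also have "\<dots> = z \<sigma>"
          using sgn_in_least[of \<sigma> q] z_ge[of \<sigma>] by (cases "z \<sigma> = 0") auto
        finally show ?thesis by simp
      next
        case True
        define \<rho> where "\<rho> = \<sigma> - {q}"
        have \<sigma>_eq: "\<sigma> = insert q \<rho>" and q\<rho>: "q \<notin> \<rho>" using True by (auto simp: \<rho>_def)
        have adm: "admissible \<sigma>" "card \<sigma> = i" using \<sigma> by (auto simp: faces_of_card)
        have fin: "finite \<sigma>" "finite \<rho>" using admissible_finite[OF adm(1)] by (auto simp: \<rho>_def)
        obtain i' where i': "i = Suc i'" using adm(2) fin(1) True by (cases i) auto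
        have \<rho>: "\<rho> \<in> set (faces_of_card i')"
          using adm i' fin q\<rho> admissible_subset[OF adm(1), of \<rho>] unfolding \<sigma>_eq by (auto simp: faces_of_card)
        have "differential i' z \<rho> = 0" using cyc \<rho> by (simp add: i' cycle_def)
        then have "boundary N z \<rho> = 0" using differential_boundary[OF st[unfolded i'] \<rho>] by simp
        moreover have split: "{..<N} - \<rho> = insert q ({..<N} - \<sigma>)" using qN q\<rho> by (auto simp: \<sigma>_eq)
        have "boundary N z \<rho> = sgn_in q \<rho> * z (insert q \<rho>) + (\<Sum>j\<in>{..<N} - \<sigma>. sgn_in j \<rho> * z (insert j \<rho>))"
          unfolding boundary_def split by (rule sum.insert) (use True in simp_all)
        ultimately have 0: "sgn_in q \<rho> * z \<sigma> + (\<Sum>j\<in>{..<N} - \<sigma>. sgn_in j \<rho> * z (insert j \<rho>)) = 0"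
          unfolding \<sigma>_eq by simp
        have "boundary N y \<sigma> = (\<Sum>j\<in>{..<N} - \<sigma>. - (sgn_in j \<rho> * z (insert j \<rho>)))"
          unfolding boundary_def
        proof (rule sum.cong)
          fix j assume j: "j \<in> {..<N} - \<sigma>"
          then have "insert j \<sigma> - {q} = insert j \<rho>" using q\<rho> by (auto simp: \<sigma>_eq)
          then have "y (insert j \<sigma>) = z (insert j \<rho>)" using True by (simp add: y_def)
          moreover have "sgn_in j \<sigma> = (- sgn_in j \<rho> :: 'k)" if "z (insert j \<rho>) \<noteq> 0"
          proof -
            have "q \<le> j" using z_ge[OF that, of j] by simp
            then have "q < j" using j True by (cases "q = j") auto
            then show ?thesis unfolding \<sigma>_eq using sgn_in_insert[where 'k = 'k, OF fin(2) q\<rho>] by simp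
          qed
          ultimately show "sgn_in j \<sigma> * y (insert j \<sigma>) = - (sgn_in j \<rho> * z (insert j \<rho>))"
            by (cases "z (insert j \<rho>) = 0") simp_all
        qed simp
        also have "\<dots> = sgn_in q \<rho> * z \<sigma>" using 0 by (simp add: sum_negf add_eq_0_iff)
        also have "\<dots> = z \<sigma>"
          using sgn_in_least[of \<rho> q] z_ge[of \<sigma>] by (cases "z \<sigma> = 0") (auto simp: \<sigma>_eq)
        finally show ?thesis by simp
      qed
      then show ?thesis using y differential_boundary[OF y] by (intro exI[of _ y]) simp
    qed
  next
    assume "\<exists>y. strand (Suc i) W y \<and> (\<forall>p\<in>set (faces_of_card i). z p = differential i y p)"
    then obtain y where y: "strand (Suc i) W y" and zy: "\<forall>p\<in>set (faces_of_card i). z p = differential i y p"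
      by (elim exE conjE) (rule that)
    have z: "z \<sigma> = boundary N y \<sigma>" for \<sigma>
    proof (cases "\<sigma> \<in> set (faces_of_card i)")
      case True
      then show ?thesis using zy differential_boundary[OF y] by simp
    next
      case False
      have "y (insert j \<sigma>) = 0" if "j \<in> {..<N} - \<sigma>" for j
      proof (rule strand_vanishes[OF y], rule notI)
        assume a: "admissible (insert j \<sigma>) \<and> card (insert j \<sigma>) = Suc i"
        then have "admissible \<sigma>" "finite \<sigma>" using admissible_subset[of "insert j \<sigma>" \<sigma>] admissible_finite by auto
        then show False using a that False by (simp add: faces_of_card)
      qed
      then have "boundary N y \<sigma> = 0" unfolding boundary_def by (intro sum.neutral) simp
      moreover have "z \<sigma> = 0" using st False by (auto simp: strand_def)
      ultimately show ?thesis by simp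
    qed
    show "cycle i W z"
    proof (cases i)
      case 0
      have "\<exists>A\<in>gen ` {..<N}. A \<subseteq> W" if "z {} \<noteq> 0"
      proof -
        have "\<exists>j\<in>{..<N} - {}. sgn_in j {} * y (insert j {}) \<noteq> 0"
          using that z[of "{}"] sum.neutral[of "{..<N} - {}" "\<lambda>j. sgn_in j {} * y (insert j {})"]
          unfolding boundary_def by force
        then obtain j where "j < N" "y {j} \<noteq> 0" by auto
        then show ?thesis using y by (auto simp: strand_def)
      qed
      then show ?thesis by (simp add: cycle_def 0)
    next
      case (Suc i')
      have "differential i' z p = 0" if p: "p \<in> set (faces_of_card i')" for p
      proof -
        have "differential i' z p = boundary N z p" using differential_boundary[OF st[unfolded Suc] p] .
        also have "\<dots> = boundary N (boundary N y) p"
          using ext[of z "boundary N y", OF z] by (rule arg_cong)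
        also have "\<dots> = 0"
          using p admissible_finite by (intro boundary_boundary) (auto simp: faces_of_card)
        finally show ?thesis .
      qed
      then show ?thesis by (simp add: cycle_def Suc)
    qed
  qed
qed

text \<open>The first \<open>s\<close> generators form an admissible set \<open>\<sigma>\<close>. Its column has no constant terms because dropping an
  element of \<open>\<sigma>\<close> changes the degree. Its row has none because for \<open>gen h\<close> in the support of \<open>\<sigma>\<close>
  the set \<open>\<sigma> \<union> {h}\<close> is not admissible: the generator \<open>k\<close> divides the least common multiple of the later
  elements. Hence \<open>critical_degree\<close> applies.\<close>

theorem well_ordered_cover_degree:
  fixes w :: "'v pp \<Rightarrow> 'g::comm_monoid_add" and D :: "nat \<Rightarrow> ('v, 'k::field) mpoly mat"
  assumes w: "grading w"
    and res: "graded_free_resolution V w (monomial_ideal V (prod_vars ` gen ` {..<N})) degs D \<epsilon>"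
    and s: "s \<le> N"
    and free: "\<And>k. k < s \<Longrightarrow> \<not> gen k \<subseteq> supp ({..<s} - {k})"
    and ordered: "\<And>h. s \<le> h \<Longrightarrow> h < N \<Longrightarrow> gen h \<subseteq> supp {..<s} \<Longrightarrow> \<exists>k<s. gen k \<subseteq> gen h \<union> supp {k<..<s}"
  shows "w (prod_vars (supp {..<s})) \<in> set (degs s)"
proof -
  interpret grading V "prod_vars ` gen ` {..<N}" w by (rule w)
  let ?dG = "\<lambda>i. map (\<lambda>\<sigma>. w (prod_vars (supp \<sigma>))) (faces_of_card i)"
  interpret resolution_pair V "prod_vars ` gen ` {..<N}" w ?dG degs frame_mat D "vec 1 (\<lambda>_. 1 :: ('v, 'k) mpoly)" \<epsilon>
    using res graded_free_resolution[OF w_add] by unfold_locales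
  have "admissible {..<s}"
    unfolding admissible_def
  proof (intro conjI ballI allI impI notI)
    fix j q assume jq: "j \<in> {..<s}" "q < j" "gen q \<subseteq> supp {i \<in> {..<s}. j \<le> i}"
    have "supp {i \<in> {..<s}. j \<le> i} \<subseteq> supp ({..<s} - {q})" using jq(2) by auto
    then show False using free[of q] jq by (auto dest: subset_trans)
  qed (use s in auto)
  then have mem: "{..<s} \<in> set (faces_of_card s)" by (simp add: faces_of_card(2))
  define e where "e = index_of (faces_of_card s) {..<s}"
  have e: "e < length (faces_of_card s)" "faces_of_card s ! e = {..<s}" using index_of_less[OF faces_of_card(1) mem] by (simp_all add: e_def)
  have "?dG s ! e \<in> set (degs s)"
  proof (rule critical_degree)
    show "e < length (?dG s)" using e by simp
    fix q assume "q < length (?dG (Suc s))"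
    then have q: "q < length (faces_of_card (Suc s))" by simp
    define \<tau> where "\<tau> = faces_of_card (Suc s) ! q"
    have \<tau>: "\<tau> \<in> set (faces_of_card (Suc s))" using q by (simp add: \<tau>_def)
    have "incidence {..<s} \<tau> = (0 :: 'k)" if eq: "supp {..<s} = supp \<tau>"
    proof (rule ccontr)
      assume "incidence {..<s} \<tau> \<noteq> (0 :: 'k)"
      from incidence_cases[OF \<tau> mem this] obtain h where h: "h \<in> {..<N} - {..<s}" "\<tau> = insert h {..<s}"
        by (elim exE conjE) (rule that)
      have "gen h \<subseteq> supp {..<s}" unfolding eq h(2) by auto
      then obtain k where k: "k < s" "gen k \<subseteq> gen h \<union> supp {k<..<s}" using ordered[of h] h(1) by auto
      \<comment> \<open>The successor of \<open>k\<close> in \<open>\<tau>\<close>.\<close>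
      define j where "j = (if Suc k < s then Suc k else h)"
      have j: "j \<in> \<tau>" "k < j" using h k(1) by (auto simp: j_def)
      have "h \<in> {i \<in> \<tau>. j \<le> i}" "{k<..<s} \<subseteq> {i \<in> \<tau>. j \<le> i}" using h by (auto simp: j_def)
      then have "gen h \<union> supp {k<..<s} \<subseteq> supp {i \<in> \<tau>. j \<le> i}" by blast
      then have "gen k \<subseteq> supp {i \<in> \<tau>. j \<le> i}" using k(2) by (rule subset_trans[rotated])
      moreover have "\<forall>j\<in>\<tau>. \<forall>q<j. \<not> gen q \<subseteq> supp {i \<in> \<tau>. j \<le> i}"
        using \<tau> by (simp add: faces_of_card(2) admissible_def)
      ultimately show False using j by blast
    qed
    then show "Poly_Mapping.lookup (frame_mat s $$ (e, q) :: ('v, 'k) mpoly) 0 = 0"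
      unfolding frame_mat_0[OF e(1) q] e(2) \<tau>_def by (simp only: if_cancel split: if_split) blast
  next
    fix s' p assume s': "s = Suc s'" and "p < length (?dG s')"
    then have p: "p < length (faces_of_card s')" by simp
    define \<tau> where "\<tau> = faces_of_card s' ! p"
    have "incidence \<tau> {..<s} = (0 :: 'k)" if eq: "supp \<tau> = supp {..<s}"
    proof (rule ccontr)
      assume "incidence \<tau> {..<s} \<noteq> (0 :: 'k)"
      then have "\<tau> \<subset> {..<s}" by (simp add: incidence_def split: if_splits)
      then obtain k where k: "k < s" "\<tau> \<subseteq> {..<s} - {k}" by auto
      have "gen k \<subseteq> supp \<tau>" unfolding eq using k(1) by auto
      also have "\<dots> \<subseteq> supp ({..<s} - {k})" using k(2) by blast
      finally show False using free[OF k(1)] by simp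
    qed
    then show "Poly_Mapping.lookup (frame_mat s' $$ (p, e) :: ('v, 'k) mpoly) 0 = 0"
      unfolding frame_mat_0[OF p e(1)[unfolded s']] e(2)[unfolded s'] \<tau>_def s' by (simp only: if_cancel split: if_split) blast
  qed
  then show ?thesis using e by simp
qed

end

text \<open>The remaining generators are appended to the cover in an arbitrary order.\<close>

theorem well_ordered_facet_cover:
  fixes w :: "'v pp \<Rightarrow> 'g::comm_monoid_add" and D :: "nat \<Rightarrow> ('v, 'k::field) mpoly mat"
  assumes V: "finite V" and S: "\<And>F. F \<in> S \<Longrightarrow> F \<subseteq> V" and w: "grading w"
    and res: "graded_free_resolution V w (monomial_ideal V (prod_vars ` S)) degs D \<epsilon>"
    and Ps: "distinct Ps" "set Ps \<subseteq> S"
    and free: "\<And>F. F \<in> set Ps \<Longrightarrow> \<not> F \<subseteq> \<Union>(set Ps - {F})"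
    and ordered: "\<And>H. H \<in> S - set Ps \<Longrightarrow> H \<subseteq> \<Union>(set Ps) \<Longrightarrow>
      \<exists>k<length Ps. Ps ! k \<subseteq> H \<union> \<Union>(set (drop (Suc k) Ps))"
  shows "w (prod_vars (\<Union>(set Ps))) \<in> set (degs (length Ps))"
proof -
  have "S \<subseteq> Pow V" using S by blast
  then have finS: "finite S" using V by (simp add: finite_subset)
  obtain Qs where Qs: "set Qs = S - set Ps" using finite_list[of "S - set Ps"] finS by auto
  define gen where "gen = nth (Ps @ Qs)"
  let ?s = "length Ps" and ?N = "length (Ps @ Qs)"
  have genN: "gen ` {..<?N} = S"
  proof -
    have "gen ` {..<?N} = set (Ps @ Qs)" unfolding gen_def by (auto simp: set_conv_nth simp del: length_append)
    then show ?thesis using Ps(2) Qs by auto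
  qed
  have gs: "gen ` A = (!) Ps ` A" if "A \<subseteq> {..<?s}" for A
    using that by (intro image_cong) (auto simp: gen_def nth_append)
  have set: "gen ` {..<?s} = set Ps" by (auto simp: gs[OF order_refl] set_conv_nth)
  interpret lyubeznik V gen ?N
  proof
    show "gen i \<subseteq> V" if "i < ?N" for i using S genN that by blast
  qed (rule V)
  have "w (prod_vars (\<Union>(gen ` {..<?s}))) \<in> set (degs ?s)"
  proof (rule well_ordered_cover_degree[OF w])
    show "graded_free_resolution V w (monomial_ideal V (prod_vars ` gen ` {..<?N})) degs D \<epsilon>"
      unfolding genN by (rule res)
    show "?s \<le> ?N" by simp
    fix k assume k: "k < ?s"
    have "gen ` ({..<?s} - {k}) \<subseteq> set Ps - {Ps ! k}"
      unfolding gs[OF Diff_subset] using Ps(1) k by (auto simp: nth_eq_iff_index_eq)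
    then have "\<Union>(gen ` ({..<?s} - {k})) \<subseteq> \<Union>(set Ps - {Ps ! k})" by blast
    moreover have "gen k = Ps ! k" using k by (simp add: gen_def nth_append)
    ultimately show "\<not> gen k \<subseteq> \<Union>(gen ` ({..<?s} - {k}))" using free[of "Ps ! k"] k by auto
  next
    fix h assume h: "?s \<le> h" "h < ?N" "gen h \<subseteq> \<Union>(gen ` {..<?s})"
    have "gen h \<in> set Qs" using h by (simp add: gen_def nth_append)
    then have "gen h \<in> S - set Ps" using Qs by simp
    then obtain k where k: "k < ?s" "Ps ! k \<subseteq> gen h \<union> \<Union>(set (drop (Suc k) Ps))"
      using ordered[of "gen h"] h(3) unfolding set by blast
    have "set (drop (Suc k) Ps) \<subseteq> gen ` {k<..<?s}"
    proof
      fix F assume "F \<in> set (drop (Suc k) Ps)"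
      then obtain i where "i < length (drop (Suc k) Ps)" "F = drop (Suc k) Ps ! i" by (auto simp: in_set_conv_nth)
      then have "F = Ps ! (Suc k + i)" "Suc k + i < ?s" by auto
      then show "F \<in> gen ` {k<..<?s}" by (intro image_eqI[of _ _ "Suc k + i"]) (auto simp: gen_def nth_append)
    qed
    from order_trans[OF k(2) Un_mono[OF order_refl Union_mono[OF this]]]
    have "Ps ! k \<subseteq> gen h \<union> \<Union>(gen ` {k<..<?s})" .
    moreover have "Ps ! k = gen k" using k by (simp add: gen_def nth_append)
    ultimately show "\<exists>k<?s. gen k \<subseteq> gen h \<union> \<Union>(gen ` {k<..<?s})"
      using k(1) by (intro exI[of _ k] conjI) (simp_all only:)
  qed
  then show ?thesis unfolding set .
qed

section \<open>Strongly disjoint bouquets\<close>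

lemma face_in_facet:
  assumes "simplicial_complex B" "F \<in> B"
  shows "\<exists>G\<in>facets B. F \<subseteq> G"
proof -
  have fin: "finite {G \<in> B. F \<subseteq> G}" using assms by (simp add: simplicial_complex_def)
  obtain G where G: "G \<in> {G \<in> B. F \<subseteq> G}" "\<forall>H\<in>{G \<in> B. F \<subseteq> G}. G \<subseteq> H \<longrightarrow> G = H"
    using finite_has_maximal2[OF fin, of F] assms(2) by auto
  have "G \<in> facets B"
    unfolding facets_def
  proof (intro CollectI conjI ballI impI)
    show "G \<in> B" using G(1) by simp
    fix H assume H: "H \<in> B" "G \<subseteq> H"
    then have "H \<in> {G \<in> B. F \<subseteq> G}" using G(1) by blast
    then show "H = G" using bspec[OF G(2)] H(2) by blast
  qed
  then show ?thesis using G(1) by blast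
qed

lemma Union_facets:
  assumes "simplicial_complex B"
  shows "\<Union>(facets B) = vertices B"
proof (intro subset_antisym subsetI)
  fix v assume "v \<in> \<Union>(facets B)"
  then obtain F where "F \<in> B" "v \<in> F" by (auto simp: facets_def)
  moreover have "{v} \<subseteq> F" using \<open>v \<in> F\<close> by simp
  ultimately show "v \<in> vertices B" using assms unfolding simplicial_complex_def vertices_def by blast
next
  fix v assume "v \<in> vertices B"
  then show "v \<in> \<Union>(facets B)" using face_in_facet[OF assms, of "{v}"] by (auto simp: vertices_def)
qed

lemma facet_maximal: "F \<in> facets \<Delta> \<Longrightarrow> G \<in> facets \<Delta> \<Longrightarrow> F \<subseteq> G \<Longrightarrow> F = G"
  by (auto simp: facets_def)

lemma facet_nonempty:
  assumes "F \<in> facets \<Delta>" "\<Delta> \<noteq> {{}}"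
  shows "F \<noteq> {}"
proof
  assume "F = {}"
  then have "\<Delta> = {{}}" using assms(1) by (auto simp: facets_def)
  then show False using assms(2) by simp
qed

text \<open>A common neighbour gives a path of length two.\<close>

lemma not_three_disjoint:
  assumes "F \<in> facets \<Delta>" "H \<in> facets \<Delta>" "F' \<in> facets \<Delta>" "F \<inter> H \<noteq> {}" "H \<inter> F' \<noteq> {}"
  shows "\<not> three_disjoint \<Delta> F F'"
proof -
  have "facet_path \<Delta> F F' 2"
    unfolding facet_path_def
    by (rule exI[of _ "\<lambda>i. if i = 0 then F else if i = 1 then H else F'"])
      (use assms in \<open>auto simp: less_2_cases_iff\<close>)
  then have "facet_dist \<Delta> F F' \<le> enat 2"
    unfolding facet_dist_def by (intro Inf_lower) auto
  also have "enat 2 < 3" by (simp add: numeral_eq_enat)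
  finally show ?thesis by (simp add: three_disjoint_def)
qed

locale bouquets =
  fixes \<Delta> :: "'v set set" and \<B> :: "'v set set set"
  assumes complex: "simplicial_complex \<Delta>" and nontrivial: "\<Delta> \<noteq> {{}}"
    and contains: "contains_strongly_disjoint \<Delta> \<B>"
begin

lemma finite_vertices: "finite (vertices \<Delta>)"
  unfolding Union_facets[OF complex, symmetric] using complex
  by (auto simp: simplicial_complex_def facets_def)

lemma facet_subset: "F \<in> facets \<Delta> \<Longrightarrow> F \<subseteq> vertices \<Delta>"
  using Union_facets[OF complex] by blast

lemma finite_facet: "F \<in> facets \<Delta> \<Longrightarrow> finite F"
  using facet_subset finite_vertices by (rule finite_subset)

lemma bouquet: "B \<in> \<B> \<Longrightarrow> bouquet \<Delta> B"
  using contains by (simp add: contains_strongly_disjoint_def strongly_disjoint_def)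

lemma bouquet_facets: "B \<in> \<B> \<Longrightarrow> facets B \<subseteq> facets \<Delta>"
  using bouquet by (simp add: bouquet_def subcollection_def)

lemma bouquet_Union_facets: "B \<in> \<B> \<Longrightarrow> \<Union>(facets B) = vertices B"
  by (rule Union_facets) (use bouquet[of B] in \<open>simp add: bouquet_def subcollection_def\<close>)

lemma vertex_disjoint: "B \<in> \<B> \<Longrightarrow> B' \<in> \<B> \<Longrightarrow> B \<noteq> B' \<Longrightarrow> vertices B \<inter> vertices B' = {}"
  using contains by (simp add: contains_strongly_disjoint_def strongly_disjoint_def)

text \<open>Distinct bouquets have disjoint vertex sets, so intersecting facets lie in the same bouquet.\<close>

lemma same_bouquet:
  assumes "B \<in> \<B>" "B' \<in> \<B>" "F \<in> facets B" "F' \<in> facets B'" "F \<inter> F' \<noteq> {}"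
  shows "B = B'"
proof (rule ccontr)
  assume "B \<noteq> B'"
  moreover have "F \<subseteq> vertices B" "F' \<subseteq> vertices B'"
    using assms bouquet_Union_facets by blast+
  ultimately show False using vertex_disjoint[OF assms(1,2)] assms(5) by blast
qed

lemma V_of_eq:
  assumes "\<B>1 \<subseteq> \<B>"
  shows "V_of \<B>1 = \<Union>(Facets_of \<B>1)"
proof -
  have "V_of \<B>1 = (\<Union>B\<in>\<B>1. \<Union>(facets B))"
    unfolding V_of_def using assms bouquet_Union_facets by (intro SUP_cong) auto
  then show ?thesis by (auto simp: Facets_of_def)
qed

lemma Facets_of_subset: "\<B>1 \<subseteq> \<B> \<Longrightarrow> Facets_of \<B>1 \<subseteq> facets \<Delta>"
  using bouquet_facets by (auto simp: Facets_of_def)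

lemma finite_facets: "finite (facets \<Delta>)"
  using complex by (simp add: simplicial_complex_def facets_def)

lemma finite_Facets_of: "\<B>1 \<subseteq> \<B> \<Longrightarrow> finite (Facets_of \<B>1)"
  using finite_subset[OF Facets_of_subset finite_facets] .

text \<open>A vertex that is free in its bouquet is free among all facets of \<open>\<B>\<close>, as the bouquets are
  vertex-disjoint.\<close>

lemma free_in_bouquets:
  assumes "F \<in> Facets_of \<B>"
  shows "\<not> F \<subseteq> \<Union>(Facets_of \<B> - {F})"
proof -
  obtain B where B: "B \<in> \<B>" "F \<in> facets B" using assms by (auto simp: Facets_of_def)
  have "\<exists>v. free_vertex B F v" using bouquet[OF B(1)] B(2) by (simp add: bouquet_def)
  then obtain v where v: "v \<in> F" "\<And>G. G \<in> facets B \<Longrightarrow> G \<noteq> F \<Longrightarrow> v \<notin> G"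
    unfolding free_vertex_def by blast
  have "v \<notin> G" if G: "G \<in> Facets_of \<B>" "G \<noteq> F" for G
  proof
    assume "v \<in> G"
    obtain B' where B': "B' \<in> \<B>" "G \<in> facets B'" using G by (auto simp: Facets_of_def)
    have "B = B'" using same_bouquet[OF B(1) B'(1) B(2) B'(2)] v(1) \<open>v \<in> G\<close> by blast
    then show False using v(2) B'(2) G(2) \<open>v \<in> G\<close> by blast
  qed
  then show ?thesis using v(1) by blast
qed

text \<open>The chosen facets \<open>G B\<close> come last. A facet \<open>H\<close> that is covered by the list but not in it, and meets an earlier facet \<open>F\<close> of a bouquet \<open>B\<close>,
  contains \<open>F - Root B\<close>, and the root lies in \<open>G B\<close>. A facet that meets only chosen facets meets a single
  one by 3-disjointness, so it lies in that facet and equals it.\<close>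

lemma ex_well_ordered_list:
  assumes sub: "\<B>1 \<subseteq> \<B>"
  shows "\<exists>Ps. distinct Ps \<and> set Ps = Facets_of \<B>1 \<and> (\<forall>H. H \<in> facets \<Delta> - set Ps \<longrightarrow> H \<subseteq> \<Union>(set Ps) \<longrightarrow>
    (\<exists>k<length Ps. Ps ! k \<subseteq> H \<union> \<Union>(set (drop (Suc k) Ps))))"
proof -
  have "\<exists>G. (\<forall>B\<in>\<B>. G B \<in> facets B) \<and> pairwise (three_disjoint \<Delta>) (G ` \<B>)"
    using contains by (simp add: contains_strongly_disjoint_def strongly_disjoint_def)
  then obtain G where G': "\<forall>B\<in>\<B>. G B \<in> facets B" and dist: "pairwise (three_disjoint \<Delta>) (G ` \<B>)"
    by (elim exE conjE) (rule that)
  from G' have G: "\<And>B. B \<in> \<B> \<Longrightarrow> G B \<in> facets B" by simp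
  have absorb: "F - Root B \<subseteq> H" if "H \<in> facets \<Delta> - Facets_of \<B>" "B \<in> \<B>" "F \<in> facets B" "H \<inter> F \<noteq> {}" for F B H
    using contains that by (simp add: contains_strongly_disjoint_def)
  have chosen: "G ` \<B>1 \<subseteq> Facets_of \<B>1" using G sub by (auto simp: Facets_of_def)
  have fin: "finite (Facets_of \<B>1)" using finite_Facets_of[OF sub] .
  obtain Ls where Ls: "distinct Ls" "set Ls = Facets_of \<B>1 - G ` \<B>1"
    using finite_distinct_list[of "Facets_of \<B>1 - G ` \<B>1"] fin by auto
  obtain Gs where Gs: "distinct Gs" "set Gs = G ` \<B>1"
    using finite_distinct_list[of "G ` \<B>1"] finite_subset[OF chosen fin] by auto
  \<comment> \<open>The order matters: the facets \<open>G B\<close>, which contain the roots, come after all others.\<close>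
  define Ps where "Ps = Ls @ Gs"
  have Ps: "distinct Ps" "set Ps = Facets_of \<B>1" using Ls Gs chosen by (auto simp: Ps_def)
  have main: "\<exists>k<length Ps. Ps ! k \<subseteq> H \<union> \<Union>(set (drop (Suc k) Ps))"
    if H: "H \<in> facets \<Delta> - set Ps" and cov: "H \<subseteq> \<Union>(set Ps)" for H
  proof -
    have ne: "H \<noteq> {}" using facet_nonempty nontrivial H by blast
    have HB: "H \<notin> Facets_of \<B>"
    proof
      assume "H \<in> Facets_of \<B>"
      then obtain B where B: "B \<in> \<B>" "H \<in> facets B" by (auto simp: Facets_of_def)
      obtain v where "v \<in> H" using ne by blast
      then obtain F where F: "F \<in> Facets_of \<B>1" "v \<in> F" using cov Ps(2) by blast
      then obtain B' where B': "B' \<in> \<B>1" "F \<in> facets B'" by (auto simp: Facets_of_def)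
      have "B' \<in> \<B>" using B'(1) sub by blast
      then have "B = B'" using same_bouquet[OF B(1) _ B(2) B'(2)] \<open>v \<in> H\<close> F(2) by blast
      then show False using H B B' Ps(2) by (auto simp: Facets_of_def)
    qed
    show ?thesis
    proof (cases "\<exists>F\<in>set Ls. H \<inter> F \<noteq> {}")
      case True
      then obtain F where F: "F \<in> set Ls" "H \<inter> F \<noteq> {}" by blast
      then obtain B where B: "B \<in> \<B>1" "F \<in> facets B" using Ls(2) by (auto simp: Facets_of_def)
      have B\<B>: "B \<in> \<B>" using B(1) sub by blast
      have "Root B \<subseteq> G B" using G[OF B\<B>] by (auto simp: Root_def)
      then have FH: "F \<subseteq> H \<union> G B" using absorb[of H B F] H HB B\<B> B(2) F(2) by blast
      obtain k where k: "k < length Ls" "F = Ls ! k" using F(1) by (auto simp: in_set_conv_nth)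
      have "G B \<in> set (drop (Suc k) Ps)" using k(1) Gs(2) B(1) by (simp add: Ps_def)
      then have "G B \<subseteq> \<Union>(set (drop (Suc k) Ps))" by (rule Union_upper)
      then have "Ps ! k \<subseteq> H \<union> \<Union>(set (drop (Suc k) Ps))"
        using FH k by (simp add: Ps_def nth_append) blast
      then show ?thesis using k(1) by (intro exI[of _ k]) (simp add: Ps_def)
    next
      case False
      have cov': "\<exists>B\<in>\<B>1. v \<in> G B" if v: "v \<in> H" for v
      proof -
        obtain F where F: "F \<in> set Ps" "v \<in> F" using cov v by blast
        have "F \<notin> set Ls" using False v F(2) by blast
        then have "F \<in> G ` \<B>1" using F(1) Ls(2) Ps(2) by simp
        then show ?thesis using F(2) by blast
      qed
      obtain v where v: "v \<in> H" using ne by blast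
      then obtain B where B: "B \<in> \<B>1" "v \<in> G B" using cov' by blast
      then have HGB: "H \<inter> G B \<noteq> {}" using v by blast
      have "G B' = G B" if B': "B' \<in> \<B>1" "H \<inter> G B' \<noteq> {}" for B'
      proof (rule ccontr)
        assume "G B' \<noteq> G B"
        then have "three_disjoint \<Delta> (G B') (G B)"
          using dist B(1) B'(1) sub by (auto simp: pairwise_def)
        moreover have "G B' \<in> facets \<Delta>" "G B \<in> facets \<Delta>"
          using B(1) B'(1) sub G bouquet_facets by blast+
        ultimately show False
          using not_three_disjoint[of "G B'" \<Delta> H "G B"] H HGB B'(2) by blast
      qed
      then have "H \<subseteq> G B" using cov' by (metis disjoint_iff subsetI)
      moreover have "G B \<in> facets \<Delta>" using B(1) sub G bouquet_facets by blast
      ultimately have "H = G B" using facet_maximal[of H \<Delta> "G B"] H by blast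
      then have "H \<in> set Ps" using B(1) Gs(2) by (simp add: Ps_def)
      then show ?thesis using H by simp
    qed
  qed
  show ?thesis
    by (intro exI[of _ Ps] conjI allI impI) (rule Ps(1), rule Ps(2), rule main)
qed

lemma facet_ideal: "facet_ideal \<Delta> = (monomial_ideal (vertices \<Delta>) (prod_vars ` facets \<Delta>) :: ('v, 'k::field) mpoly set)"
proof -
  have "facet_ideal \<Delta> = genideal (poly_ring (vertices \<Delta>)) (mon ` prod_vars ` facets \<Delta>)"
    by (simp add: facet_ideal_def image_image)
  also have "\<dots> = (monomial_ideal (vertices \<Delta>) (prod_vars ` facets \<Delta>) :: ('v, 'k) mpoly set)"
  proof (rule genideal_mon)
    fix s assume "s \<in> prod_vars ` facets \<Delta>"
    then obtain F where "F \<in> facets \<Delta>" "s = prod_vars F" by blast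
    then show "Poly_Mapping.keys s \<subseteq> vertices \<Delta>"
      using facet_subset[of F] by (simp add: keys_prod_vars finite_facet)
  qed
  finally show ?thesis .
qed

text \<open>The list of \<open>ex_well_ordered_list\<close> is a well-ordered cover of the vertices of the bouquets; free vertices
  keep each facet from being contained in the union of the others.\<close>

lemma bouquet_degree:
  fixes w :: "'v pp \<Rightarrow> 'g::comm_monoid_add" and D :: "nat \<Rightarrow> ('v, 'k::field) mpoly mat"
  assumes sub: "\<B>1 \<subseteq> \<B>" and w: "grading w"
    and res: "graded_free_resolution (vertices \<Delta>) w (monomial_ideal (vertices \<Delta>) (prod_vars ` facets \<Delta>)) degs D \<epsilon>"
  shows "w (prod_vars (V_of \<B>1)) \<in> set (degs (card (Facets_of \<B>1)))"
proof -
  obtain Ps where Ps: "distinct Ps" "set Ps = Facets_of \<B>1"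
    and ordered: "\<forall>H. H \<in> facets \<Delta> - set Ps \<longrightarrow> H \<subseteq> \<Union>(set Ps) \<longrightarrow>
      (\<exists>k<length Ps. Ps ! k \<subseteq> H \<union> \<Union>(set (drop (Suc k) Ps)))"
    using ex_well_ordered_list[OF sub] by (elim exE conjE) (rule that)
  have "w (prod_vars (\<Union>(set Ps))) \<in> set (degs (length Ps))"
  proof (rule well_ordered_facet_cover[OF finite_vertices facet_subset w res Ps(1)])
    show "set Ps \<subseteq> facets \<Delta>" unfolding Ps(2) by (rule Facets_of_subset[OF sub])
    fix F assume "F \<in> set Ps"
    then have "\<not> F \<subseteq> \<Union>(Facets_of \<B> - {F})" using free_in_bouquets sub Ps(2) by (auto simp: Facets_of_def)
    moreover have "\<Union>(set Ps - {F}) \<subseteq> \<Union>(Facets_of \<B> - {F})"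
      unfolding Ps(2) using sub by (auto simp: Facets_of_def)
    ultimately show "\<not> F \<subseteq> \<Union>(set Ps - {F})" by (meson order_trans)
  qed (assumption, rule ordered[rule_format])
  moreover have "length Ps = card (Facets_of \<B>1)" using distinct_card[OF Ps(1)] Ps(2) by simp
  moreover have "\<Union>(set Ps) = V_of \<B>1" using V_of_eq[OF sub] Ps(2) by simp
  ultimately show ?thesis by simp
qed

lemma V_of_subset: "\<B>1 \<subseteq> \<B> \<Longrightarrow> V_of \<B>1 \<subseteq> vertices \<Delta>"
  using contains by (auto simp: contains_strongly_disjoint_def V_of_def)

text \<open>Facets are maximal faces, so the facet monomials form an antichain under divisibility.\<close>

lemma min_gens_facets:
  "min_gens (vertices \<Delta>) (monomial_ideal (vertices \<Delta>) (prod_vars ` facets \<Delta>) :: ('v, 'k::field) mpoly set)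
    = prod_vars ` facets \<Delta>"
proof (rule min_gens_eqI)
  fix s assume "s \<in> prod_vars ` facets \<Delta>"
  then obtain F where "F \<in> facets \<Delta>" "s = prod_vars F" by blast
  then show "Poly_Mapping.keys s \<subseteq> vertices \<Delta>"
    using facet_subset[of F] by (simp add: keys_prod_vars finite_facet)
next
  fix s t :: "'v pp" assume "s \<in> prod_vars ` facets \<Delta>" "t \<in> prod_vars ` facets \<Delta>" and dvd: "pp_dvd s t"
  then obtain F G where FG: "F \<in> facets \<Delta>" "G \<in> facets \<Delta>" "s = prod_vars F" "t = prod_vars G" by blast
  have "F \<subseteq> G" using dvd FG by (simp add: prod_vars_dvd keys_prod_vars finite_facet)
  then show "s = t" using facet_maximal[OF FG(1,2)] FG by simp
qed

lemma V_of_in_lcm_lattice: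
  assumes "\<B>1 \<subseteq> \<B>"
  shows "prod_vars (V_of \<B>1) \<in> lcm_lattice (vertices \<Delta>)
    (monomial_ideal (vertices \<Delta>) (prod_vars ` facets \<Delta>) :: ('v, 'k::field) mpoly set)"
  unfolding lcm_lattice_def min_gens_facets
proof (intro CollectI exI conjI)
  show "prod_vars ` Facets_of \<B>1 \<subseteq> prod_vars ` facets \<Delta>"
    using Facets_of_subset[OF assms] by (rule image_mono)
  show "prod_vars (V_of \<B>1) = lcm_pp (prod_vars ` Facets_of \<B>1)"
    unfolding V_of_eq[OF assms]
    by (rule lcm_prod_vars[symmetric]) (use finite_Facets_of[OF assms] Facets_of_subset[OF assms] finite_facet in auto)
qed

lemma V_of_disjoint:
  assumes "\<B>1 \<subseteq> \<B>" "\<B>2 \<subseteq> \<B>" "\<B>1 \<inter> \<B>2 = {}"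
  shows "V_of \<B>1 \<inter> V_of \<B>2 = {}"
proof (rule ccontr)
  assume "V_of \<B>1 \<inter> V_of \<B>2 \<noteq> {}"
  then obtain v B B' where v: "B \<in> \<B>1" "B' \<in> \<B>2" "v \<in> vertices B" "v \<in> vertices B'"
    by (auto simp: V_of_def)
  then have "B \<noteq> B'" "B \<in> \<B>" "B' \<in> \<B>" using assms by auto
  then show False using vertex_disjoint[of B B'] v by blast
qed

lemma Facets_of_disjoint:
  assumes "\<B>1 \<subseteq> \<B>" "\<B>2 \<subseteq> \<B>" "\<B>1 \<inter> \<B>2 = {}"
  shows "Facets_of \<B>1 \<inter> Facets_of \<B>2 = {}"
proof (rule ccontr)
  assume "Facets_of \<B>1 \<inter> Facets_of \<B>2 \<noteq> {}"
  then obtain F where F: "F \<in> Facets_of \<B>1" "F \<in> Facets_of \<B>2" by blast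
  have "F \<in> facets \<Delta>" using F(1) Facets_of_subset[OF assms(1)] by blast
  then obtain v where "v \<in> F" using facet_nonempty[OF _ nontrivial] by blast
  then have "v \<in> V_of \<B>1 \<inter> V_of \<B>2" unfolding V_of_eq[OF assms(1)] V_of_eq[OF assms(2)] using F by blast
  then show False using V_of_disjoint[OF assms] by blast
qed

end

theorem theorem5p7:
  fixes \<Delta> :: "'v set set"
    and \<B> \<B>' \<B>'' :: "'v set set set"
    and I :: "('v, 'k::field) mpoly set"
    and b b' b'' :: nat
    and m m' :: "'v pp"
  assumes "simplicial_complex \<Delta>"
    and "\<Delta> \<noteq> {{}}"
    and "I = facet_ideal \<Delta>"
    and "contains_strongly_disjoint \<Delta> \<B>"
    and "\<B> = \<B>' \<union> \<B>''" and "\<B>' \<inter> \<B>'' = {}"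
    and "b' = card (Facets_of \<B>')"
    and "b'' = card (Facets_of \<B>'')"
    and "b = card (Facets_of \<B>)"
    and "m = prod_vars (V_of \<B>')"
    and "m' = prod_vars (V_of \<B>'')"
  shows "b = b' + b'' \<and>
    lattice_complements (vertices \<Delta>) I m m' \<and>
    betti_multi (vertices \<Delta>) I b' m \<noteq> 0 \<and>
    betti_multi (vertices \<Delta>) I b'' m' \<noteq> 0 \<and>
    t_max (vertices \<Delta>) I b \<le> t_max (vertices \<Delta>) I b' + t_max (vertices \<Delta>) I b''"
proof -
  interpret bouquets \<Delta> \<B> using assms(1,2,4) by unfold_locales
  let ?V = "vertices \<Delta>"
  have sub: "\<B>' \<subseteq> \<B>" "\<B>'' \<subseteq> \<B>" using assms(5) by auto
  have I: "I = monomial_ideal ?V (prod_vars ` facets \<Delta>)" unfolding assms(3) by (rule facet_ideal)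
  have V_Un: "V_of \<B>' \<union> V_of \<B>'' = ?V"
    using assms(4,5) by (auto simp: contains_strongly_disjoint_def V_of_def)
  note V_disj = V_of_disjoint[OF sub assms(6)]
  have finV: "finite (V_of \<B>1)" if "\<B>1 \<subseteq> \<B>" for \<B>1
    using V_of_subset[OF that] finite_vertices by (rule finite_subset)
  have b: "b = b' + b''"
  proof -
    have "Facets_of \<B> = Facets_of \<B>' \<union> Facets_of \<B>''" using assms(5) by (auto simp: Facets_of_def)
    then show ?thesis
      using card_Un_disjoint[OF finite_Facets_of[OF sub(1)] finite_Facets_of[OF sub(2)] Facets_of_disjoint[OF sub assms(6)]]
      by (simp add: assms(7,8,9))
  qed
  have complements: "lattice_complements ?V I m m'"
    unfolding lattice_complements_def
  proof (intro conjI)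
    show "m \<in> lcm_lattice ?V I" "m' \<in> lcm_lattice ?V I"
      unfolding I assms(10,11) using V_of_in_lcm_lattice sub by blast+
    have "lcm_pp (prod_vars ` {V_of \<B>', V_of \<B>''}) = prod_vars (\<Union>{V_of \<B>', V_of \<B>''})"
      by (rule lcm_prod_vars) (use finV sub in auto)
    then show "lcm_pp {m, m'} = prod_vars ?V" by (simp add: assms(10,11) V_Un)
    have "gcd_pp m m' = 0"
      unfolding gcd_pp_def assms(10,11) using V_disj finV sub by (simp add: keys_prod_vars)
    moreover have "mon 0 \<notin> I"
    proof
      assume "mon 0 \<in> I"
      then obtain F where F: "F \<in> facets \<Delta>" "pp_dvd (prod_vars F) 0"
        unfolding I by (auto simp: monomial_ideal_def mon_def)
      then have "F = {}" by (simp add: prod_vars_dvd finite_facet)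
      then show False using facet_nonempty[OF F(1) nontrivial] by simp
    qed
    ultimately show "mon (gcd_pp m m') \<notin> I" by simp
  qed
  obtain xs dg and c :: "nat \<Rightarrow> nat \<Rightarrow> nat \<Rightarrow> 'k" where frame: "exact_frame ?V (facets \<Delta>) xs dg c 0"
    and min: "\<And>i p q. p \<in> set (xs i) \<Longrightarrow> q \<in> set (xs (Suc i)) \<Longrightarrow> c i p q \<noteq> 0 \<Longrightarrow> dg i p \<noteq> dg (Suc i) q"
    using ex_minimal_exact_frame[OF finite_vertices, of "facets \<Delta>"] facet_subset facet_nonempty[OF _ nontrivial]
    by blast
  interpret exact_frame ?V "facets \<Delta>" xs dg c 0 by (rule frame)
  have multi: "grading (\<lambda>t :: 'v pp. t)" and total: "grading (total_deg :: 'v pp \<Rightarrow> nat)"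
    by (unfold_locales, simp_all add: total_deg_add) (simp add: total_deg_def)
  note min_multi = minimal_graded_free_resolution[OF grading.w_add[OF multi] min]
  note min_total = minimal_graded_free_resolution[OF grading.w_add[OF total] min]
  have betti_multi: "betti_multi ?V I i t \<noteq> 0 \<longleftrightarrow> t \<in> set (map (\<lambda>x. prod_vars (dg i x)) (xs i))" for i t
    unfolding I by (rule graded_betti_nonzero_iff[OF multi min_multi])
  have betti_total: "betti ?V I i j \<noteq> 0 \<longleftrightarrow> j \<in> set (map (\<lambda>x. total_deg (prod_vars (dg i x))) (xs i))" for i j
    unfolding I by (rule graded_betti_nonzero_iff[OF total min_total])
  note res_multi = graded_free_resolution[OF grading.w_add[OF multi]]
  note res_total = graded_free_resolution[OF grading.w_add[OF total]]
  have betti: "betti_multi ?V I b' m \<noteq> 0" "betti_multi ?V I b'' m' \<noteq> 0"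
    unfolding betti_multi assms(7,8,10,11)
    using bouquet_degree[OF sub(1) multi res_multi] bouquet_degree[OF sub(2) multi res_multi] by simp_all
  have degree_set: "{j. betti ?V I i j \<noteq> 0} = total_deg ` prod_vars ` dg i ` set (xs i)" for i
    unfolding betti_total by (auto simp: image_image)
  have card_mem: "card (V_of \<B>1) \<in> {j. betti ?V I (card (Facets_of \<B>1)) j \<noteq> 0}" if "\<B>1 \<subseteq> \<B>" for \<B>1
    using bouquet_degree[OF that total res_total] unfolding mem_Collect_eq betti_total
    by (simp add: total_deg_prod_vars finV[OF that])
  have fin: "finite {j. betti ?V I i j \<noteq> 0}" for i
    unfolding degree_set by simp
  have lower: "card (V_of \<B>1) \<le> t_max ?V I (card (Facets_of \<B>1))" if "\<B>1 \<subseteq> \<B>" for \<B>1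
    unfolding t_max_def by (rule Max_ge[OF fin card_mem[OF that]])
  have "t_max ?V I b \<le> card ?V"
    unfolding t_max_def
  proof (rule Max.boundedI[OF fin])
    show "{j. betti ?V I b j \<noteq> 0} \<noteq> {}" using card_mem[OF order_refl] unfolding assms(9) by blast
    fix j assume "j \<in> {j. betti ?V I b j \<noteq> 0}"
    then obtain x where x: "x \<in> set (xs b)" "j = total_deg (prod_vars (dg b x))" unfolding degree_set by blast
    then have "j = card (dg b x)" by (simp add: total_deg_prod_vars finite_dg)
    also have "\<dots> \<le> card ?V" using finite_vertices dg_subset[OF x(1)] by (rule card_mono)
    finally show "j \<le> card ?V" .
  qed
  also have "card ?V = card (V_of \<B>') + card (V_of \<B>'')"
    unfolding V_Un[symmetric] using finV[OF sub(1)] finV[OF sub(2)] V_disj by (rule card_Un_disjoint)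
  also have "\<dots> \<le> t_max ?V I b' + t_max ?V I b''"
    unfolding assms(7,8) by (intro add_mono lower sub)
  finally show ?thesis using b complements betti by blast
qed

end
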